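(* Let $R$ be a finite $P_W$-algebra and let $L$ be an $R$-module with a free rank filtration. Then every associated prime of $L$ as an $R$-module is toral, i.e. equals the kernel of one of the structure maps $\phi_{V,k}: R\to P_V$ appearing in the free rank filtration.
   Context: Fix a prime $p$. All rings are graded commutative $\mathbb{F}_p$-algebras and all modules are graded; $\Sigma^d$ denotes suspension. For a finite dimensional $\mathbb{F}_p$-vector space $V$, $P_V$ is the symmetric algebra on $V^*$ with $V^*$ placed in degree $1$ if $p=2$ and degree $2$ if $p$ is odd; an inclusion $V\subset W$ induces a map $P_W\to P_V$. Fix a finite dimensional $\mathbb{F}_p$-vector space $W$. A finite $P_W$-algebra is a graded $\mathbb{F}_p$-algebra $R$ with a graded algebra map $P_W\to R$ making $R$ a finitely generated $P_W$-module. An $R$-module is $j$-free if it is a suspension of an $R$-algebra of the form $P_V\otimes N$, where $V\subset W$ is a $j$-dimensional subspace, $N$ is a bounded (nonzero in only finitely many degrees) connected (nonnegatively graded with $N^0=\mathbb{F}_p$) $\mathbb{F}_p$-algebra, and the composite $P_W\to R\to P_V\otimes N\to P_V$ (the last map using the augmentation $N\to\mathbb{F}_p$) is the map induced by $V\subset W$. The composite $R\to P_V\otimes N\to P_V$ is the structure map of the $j$-free module. A free rank filtration of an $R$-module $L$ is a descending filtration by $R$-submodules $0=F_{i+1}\subset F_i\subset\dots\subset F_0=L$ together with, for each $j$, a decomposition of $F_j/F_{j+1}$ as a finite direct sum of $j$-free modules $\Sigma^{d_{V,k}}(P_V\otimes N_{V,k})$ ($V\subset W$, $\dim V=j$, with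 $k$ indexing the summands for $V$); their structure maps are denoted $\phi_{V,k}:R\to P_V$. *)

theory Defs
  imports
    "HOL-Algebra.Algebra"
    "HOL-Library.Poly_Mapping"
    "Berlekamp_Zassenhaus.Finite_Field"
begin

text \<open>
  The prime field is the type \<open>'p mod_ring\<close> with \<open>'p :: prime_card\<close>, so \<open>p = CARD('p)\<close>.
  The ambient vector space \<open>W\<close> is a whole type \<open>'w\<close> with scalar multiplication \<open>scale\<close>,
  and its subspaces \<open>V\<close> are sets.  Graded rings, algebras and modules are internally graded
  by the integers and carried by sets, so that families of them are possible.
\<close>

definition Fp :: "('p::prime_card) mod_ring ring"
  where "Fp = \<lparr>carrier = UNIV, monoid.mult = (*), one = 1, ring.zero = 0, ring.add = (+)\<rparr>"


section \<open>Graded algebras and modules\<close>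

text \<open>
  One record serves for algebras (\<open>smult\<close> is the action of the prime field) and for modules
  over an algebra (\<open>smult\<close> is the action of the algebra; \<open>mult\<close> and \<open>one\<close> are then ignored).
\<close>

record ('a, 'b) graded = "('a, 'b) module" +
  homog :: "int \<Rightarrow> 'b set"

definition homog_decomp :: "('a, 'b) graded \<Rightarrow> 'b \<Rightarrow> (int \<Rightarrow> 'b) \<Rightarrow> bool"
  where "homog_decomp M x f \<longleftrightarrow>
    (\<forall>n. f n \<in> homog M n) \<and> finite {n. f n \<noteq> \<zero>\<^bsub>M\<^esub>} \<and> x = finsum M f {n. f n \<noteq> \<zero>\<^bsub>M\<^esub>}"

definition homog_part :: "('a, 'b) graded \<Rightarrow> int \<Rightarrow> 'b \<Rightarrow> 'b"
  where "homog_part M n x = (THE f. homog_decomp M x f) n"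

locale graded_abelian_group = abelian_group M for M :: "('a, 'b) graded" (structure) +
  assumes homog_subgroup: "additive_subgroup (homog M n) M"
    and unique_decomp: "x \<in> carrier M \<Longrightarrow> \<exists>!f. homog_decomp M x f"

locale graded_fp_algebra =
  ring A + module Fp A + graded_abelian_group A
  for A :: "('p::prime_card mod_ring, 'a) graded" (structure) +
  assumes smult_mult_left:
      "\<lbrakk>x \<in> carrier A; y \<in> carrier A\<rbrakk> \<Longrightarrow> (c \<odot> x) \<otimes> y = c \<odot> (x \<otimes> y)"
    and smult_mult_right:
      "\<lbrakk>x \<in> carrier A; y \<in> carrier A\<rbrakk> \<Longrightarrow> x \<otimes> (c \<odot> y) = c \<odot> (x \<otimes> y)"
    and homog_smult: "x \<in> homog A m \<Longrightarrow> c \<odot> x \<in> homog A m"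
    and homog_one: "\<one> \<in> homog A 0"
    and homog_mult: "\<lbrakk>x \<in> homog A m; y \<in> homog A n\<rbrakk> \<Longrightarrow> x \<otimes> y \<in> homog A (m + n)"
    and graded_commutative: "\<lbrakk>x \<in> homog A m; y \<in> homog A n\<rbrakk> \<Longrightarrow>
      x \<otimes> y = (if odd m \<and> odd n then \<ominus> (y \<otimes> x) else y \<otimes> x)"

definition graded_algebra_hom ::
    "('p::prime_card mod_ring, 'a) graded \<Rightarrow> ('p mod_ring, 'b) graded \<Rightarrow> ('a \<Rightarrow> 'b) set"
  where "graded_algebra_hom A B = {h \<in> Ring.ring_hom A B.
    (\<forall>c. \<forall>x\<in>carrier A. h (c \<odot>\<^bsub>A\<^esub> x) = c \<odot>\<^bsub>B\<^esub> h x) \<and>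
    (\<forall>n. h ` homog A n \<subseteq> homog B n)}"

text \<open>
  The library's \<^locale>\<open>module\<close> requires a commutative ring of scalars, whereas a graded
  commutative ring is commutative only up to sign; hence the following left modules.
\<close>

locale graded_module = R: ring R + graded_abelian_group M
  for R :: "('p::prime_card mod_ring, 'r) graded" (structure)
    and M :: "('r, 'l) graded" (structure) +
  assumes act_closed: "\<lbrakk>r \<in> carrier R; x \<in> carrier M\<rbrakk> \<Longrightarrow> r \<odot>\<^bsub>M\<^esub> x \<in> carrier M"
    and act_add_left: "\<lbrakk>r \<in> carrier R; s \<in> carrier R; x \<in> carrier M\<rbrakk> \<Longrightarrow>
      (r \<oplus>\<^bsub>R\<^esub> s) \<odot>\<^bsub>M\<^esub> x = r \<odot>\<^bsub>M\<^esub> x \<oplus>\<^bsub>M\<^esub> s \<odot>\<^bsub>M\<^esub> x"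
    and act_add_right: "\<lbrakk>r \<in> carrier R; x \<in> carrier M; y \<in> carrier M\<rbrakk> \<Longrightarrow>
      r \<odot>\<^bsub>M\<^esub> (x \<oplus>\<^bsub>M\<^esub> y) = r \<odot>\<^bsub>M\<^esub> x \<oplus>\<^bsub>M\<^esub> r \<odot>\<^bsub>M\<^esub> y"
    and act_assoc: "\<lbrakk>r \<in> carrier R; s \<in> carrier R; x \<in> carrier M\<rbrakk> \<Longrightarrow>
      (r \<otimes>\<^bsub>R\<^esub> s) \<odot>\<^bsub>M\<^esub> x = r \<odot>\<^bsub>M\<^esub> (s \<odot>\<^bsub>M\<^esub> x)"
    and act_one: "x \<in> carrier M \<Longrightarrow> \<one>\<^bsub>R\<^esub> \<odot>\<^bsub>M\<^esub> x = x"
    and homog_act: "\<lbrakk>r \<in> homog R m; x \<in> homog M n\<rbrakk> \<Longrightarrow> r \<odot>\<^bsub>M\<^esub> x \<in> homog M (m + n)"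

definition graded_module_iso ::
    "('p::prime_card mod_ring, 'r) graded \<Rightarrow> ('r, 'a) graded \<Rightarrow> ('r, 'b) graded \<Rightarrow> ('a \<Rightarrow> 'b) set"
  where "graded_module_iso R M N = {h. bij_betw h (carrier M) (carrier N) \<and>
    (\<forall>x\<in>carrier M. \<forall>y\<in>carrier M. h (x \<oplus>\<^bsub>M\<^esub> y) = h x \<oplus>\<^bsub>N\<^esub> h y) \<and>
    (\<forall>r\<in>carrier R. \<forall>x\<in>carrier M. h (r \<odot>\<^bsub>M\<^esub> x) = r \<odot>\<^bsub>N\<^esub> h x) \<and>
    (\<forall>n. h ` homog M n = homog N n)}"

definition graded_sub :: "('a, 'b) graded \<Rightarrow> 'b set \<Rightarrow> ('a, 'b) graded"
  where "graded_sub M S = M\<lparr>carrier := S, homog := (\<lambda>n. homog M n \<inter> S)\<rparr>"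

definition graded_submodule ::
    "('p::prime_card mod_ring, 'r) graded \<Rightarrow> ('r, 'l) graded \<Rightarrow> 'l set \<Rightarrow> bool"
  where "graded_submodule R M S \<longleftrightarrow> S \<subseteq> carrier M \<and> graded_module R (graded_sub M S)"

text \<open>The quotient of a module by a submodule, and also of an algebra by a two-sided ideal.\<close>

definition graded_quot :: "('a, 'b) graded \<Rightarrow> 'b set \<Rightarrow> ('a, 'b set) graded"
  where "graded_quot M S =
    \<lparr>carrier = a_rcosets\<^bsub>M\<^esub> S, monoid.mult = rcoset_mult M S, one = S +>\<^bsub>M\<^esub> \<one>\<^bsub>M\<^esub>,
     ring.zero = S, ring.add = set_add M,
     module.smult = (\<lambda>r C. \<Union>x\<in>C. S +>\<^bsub>M\<^esub> (r \<odot>\<^bsub>M\<^esub> x)),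
     homog = (\<lambda>n. (\<lambda>x. S +>\<^bsub>M\<^esub> x) ` homog M n)\<rparr>"

definition suspension :: "int \<Rightarrow> ('a, 'b) graded \<Rightarrow> ('a, 'b) graded"
  where "suspension d M = M\<lparr>homog := (\<lambda>n. homog M (n - d))\<rparr>"

text \<open>
  Some authors let \<open>r\<close> act on the \<open>d\<close>-fold suspension with the sign \<open>(- 1) ^ (d * \<bar>r\<bar>)\<close>.
  The two conventions give isomorphic modules, via \<open>x \<mapsto> (- 1) ^ (d * \<bar>x\<bar>) * x\<close>.
\<close>

definition via_hom :: "('r \<Rightarrow> 'b) \<Rightarrow> ('k, 'b) graded \<Rightarrow> ('r, 'b) graded"
  where "via_hom \<rho> A =
    \<lparr>carrier = carrier A, monoid.mult = monoid.mult A, one = \<one>\<^bsub>A\<^esub>, ring.zero = \<zero>\<^bsub>A\<^esub>,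
     ring.add = ring.add A, module.smult = (\<lambda>r x. \<rho> r \<otimes>\<^bsub>A\<^esub> x), homog = homog A\<rparr>"

text \<open>External direct sum; only used for a finite index set \<open>I\<close>.\<close>

definition graded_sum :: "'i set \<Rightarrow> ('i \<Rightarrow> ('a, 'b) graded) \<Rightarrow> ('a, 'i \<Rightarrow> 'b) graded"
  where "graded_sum I M =
    \<lparr>carrier = (\<Pi>\<^sub>E i\<in>I. carrier (M i)),
     monoid.mult = (\<lambda>f g. \<lambda>i\<in>I. f i \<otimes>\<^bsub>M i\<^esub> g i), one = (\<lambda>i\<in>I. \<one>\<^bsub>M i\<^esub>),
     ring.zero = (\<lambda>i\<in>I. \<zero>\<^bsub>M i\<^esub>), ring.add = (\<lambda>f g. \<lambda>i\<in>I. f i \<oplus>\<^bsub>M i\<^esub> g i),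
     module.smult = (\<lambda>r f. \<lambda>i\<in>I. r \<odot>\<^bsub>M i\<^esub> f i),
     homog = (\<lambda>n. \<Pi>\<^sub>E i\<in>I. homog (M i) n)\<rparr>"


section \<open>Symmetric algebras\<close>

type_synonym ('k, 'w) dpoly = "(('w \<Rightarrow> 'k) \<Rightarrow>\<^sub>0 nat) \<Rightarrow>\<^sub>0 'k"

type_synonym ('k, 'w) sym = "('k, 'w) dpoly set"

text \<open>A linear functional on \<open>V\<close> is encoded by its extension by \<open>0\<close> outside \<open>V\<close>.\<close>

definition dual :: "('k::field \<Rightarrow> 'w::ab_group_add \<Rightarrow> 'w) \<Rightarrow> 'w set \<Rightarrow> ('w \<Rightarrow> 'k) set"
  where "dual scale V = {f. (\<forall>x. x \<notin> V \<longrightarrow> f x = 0) \<and>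
    (\<forall>x\<in>V. \<forall>y\<in>V. f (x + y) = f x + f y) \<and> (\<forall>c. \<forall>x\<in>V. f (scale c x) = c * f x)}"

definition var :: "('w \<Rightarrow> 'k) \<Rightarrow> ('k::field, 'w) dpoly"
  where "var f = Poly_Mapping.single (Poly_Mapping.single f 1) 1"

definition gen_degree :: "'p itself \<Rightarrow> nat"
  where "gen_degree _ = (if CARD('p) = 2 then 1 else 2)"

text \<open>The polynomial ring with one variable for each element of the dual space.\<close>

definition dual_poly_algebra ::
    "('p::prime_card mod_ring \<Rightarrow> 'w::ab_group_add \<Rightarrow> 'w) \<Rightarrow> 'w set \<Rightarrow>
     ('p mod_ring, ('p mod_ring, 'w) dpoly) graded"
  where "dual_poly_algebra scale V =
    (let C = {q. \<forall>m\<in>Poly_Mapping.keys q. Poly_Mapping.keys m \<subseteq> dual scale V} in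
     \<lparr>carrier = C, monoid.mult = (*), one = 1, ring.zero = 0, ring.add = (+),
      module.smult = (\<lambda>c q. Poly_Mapping.single 0 c * q),
      homog = (\<lambda>n. {q \<in> C. \<forall>m\<in>Poly_Mapping.keys q.
        int (gen_degree TYPE('p) * (\<Sum>f\<in>Poly_Mapping.keys m. Poly_Mapping.lookup m f)) = n})\<rparr>)"

definition sym_relations ::
    "('k::field \<Rightarrow> 'w::ab_group_add \<Rightarrow> 'w) \<Rightarrow> 'w set \<Rightarrow> ('k, 'w) dpoly set"
  where "sym_relations scale V =
    {var (\<lambda>x. f x + g x) - var f - var g | f g. f \<in> dual scale V \<and> g \<in> dual scale V} \<union>
    {var (\<lambda>x. c * f x) - Poly_Mapping.single 0 c * var f | c f. f \<in> dual scale V}"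

definition sym_ideal ::
    "('p::prime_card mod_ring \<Rightarrow> 'w::ab_group_add \<Rightarrow> 'w) \<Rightarrow> 'w set \<Rightarrow> ('p mod_ring, 'w) dpoly set"
  where "sym_ideal scale V = Idl\<^bsub>dual_poly_algebra scale V\<^esub> (sym_relations scale V)"

text \<open>The symmetric algebra \<open>P\<^sub>V\<close> on the dual of \<open>V\<close>.\<close>

definition sym_algebra ::
    "('p::prime_card mod_ring \<Rightarrow> 'w::ab_group_add \<Rightarrow> 'w) \<Rightarrow> 'w set \<Rightarrow>
     ('p mod_ring, ('p mod_ring, 'w) sym) graded"
  where "sym_algebra scale V = graded_quot (dual_poly_algebra scale V) (sym_ideal scale V)"

text \<open>The substitution of the variable of \<open>\<rho> f\<close> for the variable of \<open>f\<close>.\<close>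

definition rename :: "(('w \<Rightarrow> 'k) \<Rightarrow> ('w \<Rightarrow> 'k)) \<Rightarrow> ('k::field, 'w) dpoly \<Rightarrow> ('k, 'w) dpoly"
  where "rename \<rho> q = (\<Sum>m\<in>Poly_Mapping.keys q. Poly_Mapping.single
    (\<Sum>f\<in>Poly_Mapping.keys m. Poly_Mapping.single (\<rho> f) (Poly_Mapping.lookup m f))
    (Poly_Mapping.lookup q m))"

definition restrict_functional :: "'w set \<Rightarrow> ('w \<Rightarrow> 'k::field) \<Rightarrow> ('w \<Rightarrow> 'k)"
  where "restrict_functional V f = (\<lambda>x. if x \<in> V then f x else 0)"

text \<open>
  The map \<open>P\<^sub>W \<rightarrow> P\<^sub>V\<close> induced by the inclusion of \<open>V\<close> into the whole space.  Here and
  below, \<^const>\<open>the_elem\<close> is applied to the image of a coset under a map constant on it.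
\<close>

definition sym_restrict ::
    "('p::prime_card mod_ring \<Rightarrow> 'w::ab_group_add \<Rightarrow> 'w) \<Rightarrow> 'w set \<Rightarrow>
     ('p mod_ring, 'w) sym \<Rightarrow> ('p mod_ring, 'w) sym"
  where "sym_restrict scale V C = the_elem
    ((\<lambda>q. sym_ideal scale V +>\<^bsub>dual_poly_algebra scale V\<^esub> rename (restrict_functional V) q) ` C)"


section \<open>Tensor products\<close>

text \<open>
  The free vector space on pairs \<open>(a, b)\<close>, with \<open>(a, b) * (a', b') = (a * a', b * b')\<close>.  The sign
  \<open>(- 1) ^ (\<bar>b\<bar> * \<bar>a'\<bar>)\<close> of the graded tensor product is omitted: in what follows \<open>A\<close> is some
  \<open>P\<^sub>V\<close>, which is concentrated in even degrees if \<open>p\<close> is odd, and signs are irrelevant if \<open>p = 2\<close>.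

  The sets \<^const>\<open>homog\<close> do not define a grading before the tensor relations are divided
  out, since only homogeneous pairs are given a degree.
\<close>

definition pair_algebra ::
    "('k::field, 'a) graded \<Rightarrow> ('k, 'b) graded \<Rightarrow> ('k, ('a \<times> 'b) \<Rightarrow>\<^sub>0 'k) graded"
  where "pair_algebra A B =
    (let C = {t. Poly_Mapping.keys t \<subseteq> carrier A \<times> carrier B} in
     \<lparr>carrier = C,
      monoid.mult = (\<lambda>s t. \<Sum>x\<in>Poly_Mapping.keys s. \<Sum>y\<in>Poly_Mapping.keys t.
        Poly_Mapping.single (fst x \<otimes>\<^bsub>A\<^esub> fst y, snd x \<otimes>\<^bsub>B\<^esub> snd y)
          (Poly_Mapping.lookup s x * Poly_Mapping.lookup t y)),
      one = Poly_Mapping.single (\<one>\<^bsub>A\<^esub>, \<one>\<^bsub>B\<^esub>) 1, ring.zero = 0, ring.add = (+),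
      module.smult = (\<lambda>c t. Poly_Mapping.map (\<lambda>z. c * z) t),
      homog = (\<lambda>n. {t \<in> C. \<forall>(a, b)\<in>Poly_Mapping.keys t.
        \<exists>i j. i + j = n \<and> a \<in> homog A i \<and> b \<in> homog B j})\<rparr>)"

definition tensor_relations ::
    "('k::field, 'a) graded \<Rightarrow> ('k, 'b) graded \<Rightarrow> (('a \<times> 'b) \<Rightarrow>\<^sub>0 'k) set"
  where "tensor_relations A B =
    {Poly_Mapping.single (a \<oplus>\<^bsub>A\<^esub> a', b) 1 - Poly_Mapping.single (a, b) 1 -
       Poly_Mapping.single (a', b) 1
     | a a' b. a \<in> carrier A \<and> a' \<in> carrier A \<and> b \<in> carrier B} \<union>
    {Poly_Mapping.single (a, b \<oplus>\<^bsub>B\<^esub> b') 1 - Poly_Mapping.single (a, b) 1 -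
       Poly_Mapping.single (a, b') 1
     | a b b'. a \<in> carrier A \<and> b \<in> carrier B \<and> b' \<in> carrier B} \<union>
    {Poly_Mapping.single (c \<odot>\<^bsub>A\<^esub> a, b) 1 - Poly_Mapping.single (a, b) c
     | c a b. a \<in> carrier A \<and> b \<in> carrier B} \<union>
    {Poly_Mapping.single (a, c \<odot>\<^bsub>B\<^esub> b) 1 - Poly_Mapping.single (a, b) c
     | c a b. a \<in> carrier A \<and> b \<in> carrier B}"

definition tensor ::
    "('k::field, 'a) graded \<Rightarrow> ('k, 'b) graded \<Rightarrow> ('k, (('a \<times> 'b) \<Rightarrow>\<^sub>0 'k) set) graded"
  where "tensor A B = graded_quot (pair_algebra A B) (Idl\<^bsub>pair_algebra A B\<^esub> (tensor_relations A B))"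


section \<open>Free rank filtrations\<close>

definition bounded_graded :: "('a, 'b) graded \<Rightarrow> bool"
  where "bounded_graded N \<longleftrightarrow> finite {n. homog N n \<noteq> {\<zero>\<^bsub>N\<^esub>}}"

definition connected_graded :: "('p::prime_card mod_ring, 'b) graded \<Rightarrow> bool"
  where "connected_graded N \<longleftrightarrow> (\<forall>n<0. homog N n = {\<zero>\<^bsub>N\<^esub>}) \<and>
    bij_betw (\<lambda>c. c \<odot>\<^bsub>N\<^esub> \<one>\<^bsub>N\<^esub>) UNIV (homog N 0)"

text \<open>The augmentation of a connected algebra.\<close>

definition augmentation :: "('p::prime_card mod_ring, 'b) graded \<Rightarrow> 'b \<Rightarrow> 'p mod_ring"
  where "augmentation N x = (THE c. c \<odot>\<^bsub>N\<^esub> \<one>\<^bsub>N\<^esub> = homog_part N 0 x)"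

definition tensor_augmentation ::
    "('p::prime_card mod_ring, 'a) graded \<Rightarrow> ('p mod_ring, 'b) graded \<Rightarrow>
     (('a \<times> 'b) \<Rightarrow>\<^sub>0 'p mod_ring) set \<Rightarrow> 'a"
  where "tensor_augmentation A N C = the_elem
    ((\<lambda>t. finsum A (\<lambda>(a, b). (Poly_Mapping.lookup t (a, b) * augmentation N b) \<odot>\<^bsub>A\<^esub> a)
        (Poly_Mapping.keys t)) ` C)"

text \<open>\<open>R\<close> is a finite algebra over \<open>P\<^sub>W\<close> by means of \<open>\<eta>\<close>.\<close>

definition finite_sym_algebra ::
    "('p::prime_card mod_ring \<Rightarrow> 'w::ab_group_add \<Rightarrow> 'w) \<Rightarrow>
     ('p mod_ring, 'r) graded \<Rightarrow> (('p mod_ring, 'w) sym \<Rightarrow> 'r) \<Rightarrow> bool"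
  where "finite_sym_algebra scale R \<eta> \<longleftrightarrow>
    graded_fp_algebra R \<and> \<eta> \<in> graded_algebra_hom (sym_algebra scale UNIV) R \<and>
    (\<exists>S. finite S \<and> S \<subseteq> carrier R \<and>
      (\<forall>r\<in>carrier R. \<exists>a \<in> S \<rightarrow> carrier (sym_algebra scale UNIV).
        r = (\<Oplus>\<^bsub>R\<^esub>s\<in>S. \<eta> (a s) \<otimes>\<^bsub>R\<^esub> s)))"

type_synonym ('k, 'w, 'n) tens = "((('k, 'w) sym \<times> 'n) \<Rightarrow>\<^sub>0 'k) set"

text \<open>The structure map \<open>R \<rightarrow> P\<^sub>V \<otimes> N \<rightarrow> P\<^sub>V\<close>, where \<open>\<rho>\<close> makes \<open>P\<^sub>V \<otimes> N\<close> an \<open>R\<close>-algebra.\<close>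

definition structure_map ::
    "('p::prime_card mod_ring \<Rightarrow> 'w::ab_group_add \<Rightarrow> 'w) \<Rightarrow> 'w set \<Rightarrow> ('p mod_ring, 'n) graded \<Rightarrow>
     ('r \<Rightarrow> ('p mod_ring, 'w, 'n) tens) \<Rightarrow> 'r \<Rightarrow> ('p mod_ring, 'w) sym"
  where "structure_map scale V N \<rho> r = tensor_augmentation (sym_algebra scale V) N (\<rho> r)"

definition free_algebra ::
    "('p::prime_card mod_ring \<Rightarrow> 'w::ab_group_add \<Rightarrow> 'w) \<Rightarrow>
     ('p mod_ring, 'r) graded \<Rightarrow> (('p mod_ring, 'w) sym \<Rightarrow> 'r) \<Rightarrow>
     'w set \<Rightarrow> ('p mod_ring, 'n) graded \<Rightarrow> ('r \<Rightarrow> ('p mod_ring, 'w, 'n) tens) \<Rightarrow> bool"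
  where "free_algebra scale R \<eta> V N \<rho> \<longleftrightarrow>
    graded_fp_algebra N \<and> bounded_graded N \<and> connected_graded N \<and>
    \<rho> \<in> graded_algebra_hom R (tensor (sym_algebra scale V) N) \<and>
    (\<forall>x\<in>carrier (sym_algebra scale UNIV). structure_map scale V N \<rho> (\<eta> x) = sym_restrict scale V x)"

definition free_module ::
    "('p::prime_card mod_ring \<Rightarrow> 'w::ab_group_add \<Rightarrow> 'w) \<Rightarrow> 'w set \<Rightarrow> int \<Rightarrow>
     ('p mod_ring, 'n) graded \<Rightarrow> ('r \<Rightarrow> ('p mod_ring, 'w, 'n) tens) \<Rightarrow>
     ('r, ('p mod_ring, 'w, 'n) tens) graded"
  where "free_module scale V d N \<rho> = suspension d (via_hom \<rho> (tensor (sym_algebra scale V) N))"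

text \<open>
  The indices \<open>(V, k)\<close> of the summands in rank \<open>j\<close>: there are \<open>m V\<close> summands for each \<open>V\<close>.
\<close>

definition summands ::
    "('k::field \<Rightarrow> 'w::ab_group_add \<Rightarrow> 'w) \<Rightarrow> ('w set \<Rightarrow> nat) \<Rightarrow> nat \<Rightarrow> ('w set \<times> nat) set"
  where "summands scale m j =
    {(V, k). Modules.module.subspace scale V \<and> vector_space.dim scale V = j \<and> k < m V}"

definition free_rank_filtration ::
    "('p::prime_card mod_ring \<Rightarrow> 'w::ab_group_add \<Rightarrow> 'w) \<Rightarrow>
     ('p mod_ring, 'r) graded \<Rightarrow> (('p mod_ring, 'w) sym \<Rightarrow> 'r) \<Rightarrow> ('r, 'l) graded \<Rightarrow>
     nat \<Rightarrow> (nat \<Rightarrow> 'l set) \<Rightarrow> ('w set \<Rightarrow> nat) \<Rightarrow> ('w set \<Rightarrow> nat \<Rightarrow> int) \<Rightarrow>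
     ('w set \<Rightarrow> nat \<Rightarrow> ('p mod_ring, 'n) graded) \<Rightarrow>
     ('w set \<Rightarrow> nat \<Rightarrow> 'r \<Rightarrow> ('p mod_ring, 'w, 'n) tens) \<Rightarrow> bool"
  where "free_rank_filtration scale R \<eta> L i F m d N \<rho> \<longleftrightarrow>
    F 0 = carrier L \<and> F (Suc i) = {\<zero>\<^bsub>L\<^esub>} \<and>
    (\<forall>j\<le>Suc i. graded_submodule R L (F j)) \<and> (\<forall>j\<le>i. F (Suc j) \<subseteq> F j) \<and>
    (\<forall>j\<le>i. (\<forall>(V, k)\<in>summands scale m j. free_algebra scale R \<eta> V (N V k) (\<rho> V k)) \<and>
      (\<exists>h. h \<in> graded_module_iso R
        (graded_quot (graded_sub L (F j)) (F (Suc j)))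
        (graded_sum (summands scale m j)
          (\<lambda>(V, k). free_module scale V (d V k) (N V k) (\<rho> V k)))))"


section \<open>Associated primes\<close>

text \<open>
  A two-sided ideal \<open>\<pp>\<close> that is completely prime and is the annihilator of some element of the
  module.  Neither \<open>\<pp>\<close> nor the element has to be homogeneous.  This includes the graded notion:
  a homogeneous ideal of a ring graded by the integers is prime as soon as it is prime with
  respect to homogeneous elements (compare top-degree components).
\<close>

definition associated_prime :: "('k, 'r) graded \<Rightarrow> ('r, 'l) graded \<Rightarrow> 'r set \<Rightarrow> bool"
  where "associated_prime R L \<pp> \<longleftrightarrow> ideal \<pp> R \<and> \<pp> \<noteq> carrier R \<and>
    (\<forall>a\<in>carrier R. \<forall>b\<in>carrier R. a \<otimes>\<^bsub>R\<^esub> b \<in> \<pp> \<longrightarrow> a \<in> \<pp> \<or> b \<in> \<pp>) \<and>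
    (\<exists>x\<in>carrier L. \<pp> = {r \<in> carrier R. r \<odot>\<^bsub>L\<^esub> x = \<zero>\<^bsub>L\<^esub>})"

end

theory Submission
  imports Defs
begin

text \<open>
  Let \<open>\<pp>\<close> be the annihilator of \<open>x\<close>.  Since \<open>\<pp>\<close> is completely prime, every multiple \<open>s x\<close> with \<open>s \<notin> \<pp>\<close>
  has the annihilator \<open>\<pp>\<close> again, and this freedom is used twice.  First, \<open>x\<close> is replaced by a nonzero
  multiple that lies as deep in the filtration as possible; then no further nonzero multiple goes
  deeper, so \<open>\<pp>\<close> is the annihilator of a class in one quotient \<open>F j / F (j + 1)\<close>
  (\<open>annihilator_in_layer\<close>).  This quotient is a finite direct sum of free modules.  Second, a
  multiple with as few nonzero components as possible has a component whose annihilator is already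
  \<open>\<pp>\<close> (\<open>finite_intersection\<close>).

  It remains to see that a completely prime annihilator of an element \<open>w\<close> of \<open>P\<^sub>V \<otimes> N\<close> is the kernel of
  the structure map (\<open>free_annihilator_toral\<close>).  Let \<open>\<epsilon> : P\<^sub>V \<otimes> N \<rightarrow> P\<^sub>V\<close> be the augmentation.

  \<^item> If \<open>\<epsilon> u = 0\<close>, then all second factors of \<open>u\<close> can be taken in positive degrees, so \<open>u\<close> is nilpotent
    because \<open>N\<close> is bounded (\<open>proj_zero_nilpotent\<close>).  Hence the kernel lies in \<open>\<pp>\<close>.
  \<^item> If \<open>u w = 0\<close> and \<open>w \<noteq> 0\<close>, then \<open>\<epsilon> u = 0\<close> (\<open>proj_nonzero_divisor\<close>).  For, filter \<open>P\<^sub>V \<otimes> N\<close> by the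
    degree in \<open>N\<close>: on the successive quotients \<open>P\<^sub>V \<otimes> N\<^sup>n\<close> the element \<open>u\<close> acts as multiplication by
    \<open>\<epsilon> u\<close>, which is injective if \<open>\<epsilon> u \<noteq> 0\<close>, as \<open>P\<^sub>V\<close> is a domain.  Hence \<open>\<pp>\<close> lies in the kernel.

  The tensor product is presented by generators and relations, so that a proof that something is not
  zero in it needs a bilinear map.  By the universal property (\<open>lin_ext_tensor_ideal\<close>) each linear
  functional \<open>\<kappa>\<close> on \<open>P\<^sub>V\<close> gives a contraction \<open>\<kappa> \<otimes> id : P\<^sub>V \<otimes> N \<rightarrow> N\<close>, and together these determine an
  element (\<open>tensor_expansion\<close>).  Functionals on \<open>P\<^sub>V\<close>, as well as the absence of zero divisors, come
  from an embedding of \<open>P\<^sub>V\<close> into a polynomial ring (\<open>sym_algebra_embedding\<close>).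
\<close>

section \<open>Algebras over the prime field and their quotients\<close>

lemma Fp_simps [simp]:
  "carrier Fp = UNIV" "monoid.mult Fp = (*)" "\<one>\<^bsub>Fp\<^esub> = 1" "\<zero>\<^bsub>Fp\<^esub> = 0" "ring.add Fp = (+)"
  by (simp_all add: Fp_def)

text \<open>
  The scalars form a whole type, so the laws are stated with the arithmetic of that type instead of
  the ring structure \<^const>\<open>Fp\<close>.
\<close>

locale fp_module = abelian_group M
  for M :: "('p::prime_card mod_ring, 'a, 'm) module_scheme" (structure) +
  assumes smult_closed [simp, intro]: "x \<in> carrier M \<Longrightarrow> c \<odot> x \<in> carrier M"
    and smult_l_distr: "x \<in> carrier M \<Longrightarrow> (c + d) \<odot> x = c \<odot> x \<oplus> d \<odot> x"
    and smult_r_distr: "\<lbrakk>x \<in> carrier M; y \<in> carrier M\<rbrakk> \<Longrightarrow> c \<odot> (x \<oplus> y) = c \<odot> x \<oplus> c \<odot> y"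
    and smult_assoc: "x \<in> carrier M \<Longrightarrow> (c * d) \<odot> x = c \<odot> (d \<odot> x)"
    and smult_one [simp]: "x \<in> carrier M \<Longrightarrow> 1 \<odot> x = x"
begin

lemma smult_l_null [simp]: "x \<in> carrier M \<Longrightarrow> 0 \<odot> x = \<zero>"
  using smult_l_distr[of x 0 0] by (simp add: add.r_cancel_one')

lemma smult_r_null [simp]: "c \<odot> \<zero> = \<zero>"
  using smult_r_distr[of \<zero> \<zero> c] by (simp add: add.r_cancel_one')

end

locale fp_algebra = ring A + fp_module A
  for A :: "('p::prime_card mod_ring, 'a, 'm) module_scheme" (structure) +
  assumes smult_mult_left:
      "\<lbrakk>x \<in> carrier A; y \<in> carrier A\<rbrakk> \<Longrightarrow> (c \<odot> x) \<otimes> y = c \<odot> (x \<otimes> y)"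
    and smult_mult_right:
      "\<lbrakk>x \<in> carrier A; y \<in> carrier A\<rbrakk> \<Longrightarrow> x \<otimes> (c \<odot> y) = c \<odot> (x \<otimes> y)"

lemma (in graded_fp_algebra) fp_algebra: "fp_algebra A"
proof -
  show ?thesis
    by unfold_locales
      (simp_all add: smult_l_distr[unfolded Fp_simps] smult_r_distr[unfolded Fp_simps]
        smult_assoc1[unfolded Fp_simps] smult_one[unfolded Fp_simps] smult_closed[unfolded Fp_simps]
        smult_mult_left smult_mult_right)
qed

lemma graded_quot_simps:
  "carrier (graded_quot M S) = a_rcosets\<^bsub>M\<^esub> S" "monoid.mult (graded_quot M S) = rcoset_mult M S"
  "\<one>\<^bsub>graded_quot M S\<^esub> = S +>\<^bsub>M\<^esub> \<one>\<^bsub>M\<^esub>" "\<zero>\<^bsub>graded_quot M S\<^esub> = S"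
  "ring.add (graded_quot M S) = set_add M"
  by (simp_all add: graded_quot_def)

lemma in_graded_quotE:
  assumes "Z \<in> carrier (graded_quot M S)"
  obtains x where "x \<in> carrier M" "Z = S +>\<^bsub>M\<^esub> x"
  using assms by (auto simp: graded_quot_simps A_RCOSETS_def RCOSETS_def a_r_coset_def)

lemma ring_graded_quot:
  assumes "ideal S M"
  shows "ring (graded_quot M S)"
proof -
  interpret ideal S M by fact
  interpret Q: ring "M Quot S" by (rule quotient_is_ring)
  have eqs: "carrier (graded_quot M S) = carrier (M Quot S)"
    "monoid.mult (graded_quot M S) = monoid.mult (M Quot S)"
    "\<one>\<^bsub>graded_quot M S\<^esub> = \<one>\<^bsub>M Quot S\<^esub>" "\<zero>\<^bsub>graded_quot M S\<^esub> = \<zero>\<^bsub>M Quot S\<^esub>"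
    "ring.add (graded_quot M S) = ring.add (M Quot S)"
    by (simp_all add: graded_quot_def FactRing_def)
  show ?thesis
  proof (rule ringI)
    show "abelian_group (graded_quot M S)"
    proof (rule abelian_groupI)
      show "\<exists>y\<in>carrier (graded_quot M S). y \<oplus>\<^bsub>graded_quot M S\<^esub> x = \<zero>\<^bsub>graded_quot M S\<^esub>"
        if "x \<in> carrier (graded_quot M S)" for x
        using that unfolding eqs by (rule Q.add.l_inv_ex)
    qed (unfold eqs, simp_all add: Q.a_assoc, simp add: Q.a_comm)
    show "Group.monoid (graded_quot M S)"
      by (rule monoidI) (auto simp: eqs Q.m_assoc)
  qed (simp_all add: eqs Q.l_distr Q.r_distr)
qed

context abelian_subgroup
begin

lemma coset_eq_iff: "\<lbrakk>x \<in> carrier G; y \<in> carrier G\<rbrakk> \<Longrightarrow> H +> x = H +> y \<longleftrightarrow> x \<oplus> \<ominus> y \<in> H"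
  by (metis a_rcos_module a_rcos_self a_repr_independence a_subgroup)

lemma coset_eq_zero_iff: "x \<in> carrier G \<Longrightarrow> H +> x = H \<longleftrightarrow> x \<in> H"
  by (metis a_rcos_self a_rcos_const)

end

text \<open>
  The action on a quotient is a union over representatives; the hypothesis says that they all
  contribute the same coset.
\<close>

lemma smult_graded_quot:
  assumes "abelian_subgroup S M" "x \<in> carrier M"
    and "\<And>h. h \<in> S \<Longrightarrow> S +>\<^bsub>M\<^esub> (r \<odot>\<^bsub>M\<^esub> (h \<oplus>\<^bsub>M\<^esub> x)) = S +>\<^bsub>M\<^esub> (r \<odot>\<^bsub>M\<^esub> x)"
  shows "r \<odot>\<^bsub>graded_quot M S\<^esub> (S +>\<^bsub>M\<^esub> x) = S +>\<^bsub>M\<^esub> (r \<odot>\<^bsub>M\<^esub> x)"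
proof -
  interpret abelian_subgroup S M by fact
  have ne: "S \<noteq> {}"
    using additive_subgroup.zero_closed[OF additive_subgroup_axioms] by fast
  have "(\<Union>y\<in>S +>\<^bsub>M\<^esub> x. S +>\<^bsub>M\<^esub> (r \<odot>\<^bsub>M\<^esub> y)) = (\<Union>h\<in>S. S +>\<^bsub>M\<^esub> (r \<odot>\<^bsub>M\<^esub> (h \<oplus>\<^bsub>M\<^esub> x)))"
    by (simp add: a_r_coset_def')
  also have "\<dots> = (\<Union>h\<in>S. S +>\<^bsub>M\<^esub> (r \<odot>\<^bsub>M\<^esub> x))"
    using assms(3) by (rule SUP_cong[OF refl])
  also have "\<dots> = S +>\<^bsub>M\<^esub> (r \<odot>\<^bsub>M\<^esub> x)"
    using ne by simp
  finally show ?thesis by (simp add: graded_quot_def)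
qed

lemma fp_algebra_graded_quot:
  fixes M :: "('p::prime_card mod_ring, 'a) graded" (structure)
  assumes "fp_algebra M" "ideal S M"
  shows "fp_algebra (graded_quot M S)"
    and "\<And>c x. x \<in> carrier M \<Longrightarrow> c \<odot>\<^bsub>graded_quot M S\<^esub> (S +> x) = S +> (c \<odot> x)"
proof -
  interpret fp_algebra M by fact
  interpret I: ideal S M by fact
  interpret Q: ring "graded_quot M S" by (rule ring_graded_quot) fact
  have smS: "c \<odot> h \<in> S" if "h \<in> S" for c h
  proof -
    have h: "h \<in> carrier M" using that I.a_subset by auto
    have "(c \<odot> \<one>) \<otimes> h = c \<odot> h" using h smult_mult_left[of \<one> h c] by simp
    thus ?thesis using I.I_l_closed[OF that, of "c \<odot> \<one>"] by simp
  qed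
  show sm: "c \<odot>\<^bsub>graded_quot M S\<^esub> (S +> x) = S +> (c \<odot> x)" if x: "x \<in> carrier M" for c x
  proof (rule smult_graded_quot)
    fix h assume h: "h \<in> S"
    hence hM: "h \<in> carrier M" using I.a_subset by auto
    have "c \<odot> (h \<oplus> x) \<oplus> \<ominus> (c \<odot> x) = c \<odot> h"
      using x hM by (simp add: smult_r_distr a_assoc r_neg)
    thus "S +> (c \<odot> (h \<oplus> x)) = S +> (c \<odot> x)"
      using x hM h smS by (simp add: I.coset_eq_iff)
  qed (use x I.abelian_subgroup_axioms in auto)
  have add: "(S +> x) \<oplus>\<^bsub>graded_quot M S\<^esub> (S +> y) = S +> (x \<oplus> y)"
    if "x \<in> carrier M" "y \<in> carrier M" for x y
    using that by (simp add: graded_quot_simps I.a_rcos_sum)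
  have mult: "(S +> x) \<otimes>\<^bsub>graded_quot M S\<^esub> (S +> y) = S +> (x \<otimes> y)"
    if "x \<in> carrier M" "y \<in> carrier M" for x y
    using that by (simp add: graded_quot_simps I.rcoset_mult_add)
  have clos: "S +> x \<in> carrier (graded_quot M S)" if "x \<in> carrier M" for x
    using that by (simp add: graded_quot_simps a_rcosetsI I.a_subset)
  show "fp_algebra (graded_quot M S)"
  proof (intro fp_algebra.intro fp_module.intro fp_module_axioms.intro fp_algebra_axioms.intro
      Q.ring_axioms Q.abelian_group_axioms)
    let ?Q = "graded_quot M S"
    fix U V :: "'a set" and c d :: "'p mod_ring"
    show "c \<odot>\<^bsub>?Q\<^esub> U \<in> carrier ?Q" if "U \<in> carrier ?Q"
      using that by (rule in_graded_quotE) (simp add: sm clos)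
    show "(c + d) \<odot>\<^bsub>?Q\<^esub> U = c \<odot>\<^bsub>?Q\<^esub> U \<oplus>\<^bsub>?Q\<^esub> d \<odot>\<^bsub>?Q\<^esub> U" if "U \<in> carrier ?Q"
      using that by (rule in_graded_quotE) (simp add: sm add smult_l_distr)
    show "(c * d) \<odot>\<^bsub>?Q\<^esub> U = c \<odot>\<^bsub>?Q\<^esub> (d \<odot>\<^bsub>?Q\<^esub> U)" if "U \<in> carrier ?Q"
      using that by (rule in_graded_quotE) (simp add: sm smult_assoc)
    show "1 \<odot>\<^bsub>?Q\<^esub> U = U" if "U \<in> carrier ?Q"
      using that by (rule in_graded_quotE) (simp add: sm)
    assume "U \<in> carrier ?Q" "V \<in> carrier ?Q"
    then obtain x y where "x \<in> carrier M" "U = S +> x" "y \<in> carrier M" "V = S +> y"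
      by (elim in_graded_quotE)
    thus "c \<odot>\<^bsub>?Q\<^esub> (U \<oplus>\<^bsub>?Q\<^esub> V) = c \<odot>\<^bsub>?Q\<^esub> U \<oplus>\<^bsub>?Q\<^esub> c \<odot>\<^bsub>?Q\<^esub> V"
      and "(c \<odot>\<^bsub>?Q\<^esub> U) \<otimes>\<^bsub>?Q\<^esub> V = c \<odot>\<^bsub>?Q\<^esub> (U \<otimes>\<^bsub>?Q\<^esub> V)"
      and "U \<otimes>\<^bsub>?Q\<^esub> (c \<odot>\<^bsub>?Q\<^esub> V) = c \<odot>\<^bsub>?Q\<^esub> (U \<otimes>\<^bsub>?Q\<^esub> V)"
      by (simp_all add: sm add mult smult_r_distr smult_mult_left smult_mult_right)
  qed
qed

section \<open>Linear extension from a basis\<close>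

lemma poly_mapping_sum_singles:
  fixes t :: "'x \<Rightarrow>\<^sub>0 'a::comm_monoid_add"
  shows "t = (\<Sum>x\<in>Poly_Mapping.keys t. Poly_Mapping.single x (Poly_Mapping.lookup t x))"
  by (rule poly_mapping_eqI) (auto simp: lookup_sum lookup_single when_def in_keys_iff)

lemma poly_mapping_span_induct [consumes 1, case_names zero single add]:
  fixes t :: "'x \<Rightarrow>\<^sub>0 'a::comm_monoid_add"
  assumes "Poly_Mapping.keys t \<subseteq> S" "P 0"
    and single: "\<And>x c. x \<in> S \<Longrightarrow> P (Poly_Mapping.single x c)"
    and add: "\<And>s t. \<lbrakk>Poly_Mapping.keys s \<subseteq> S; Poly_Mapping.keys t \<subseteq> S; P s; P t\<rbrakk> \<Longrightarrow> P (s + t)"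
  shows "P t"
proof -
  have "finite Z \<Longrightarrow> Z \<subseteq> S \<Longrightarrow> P (\<Sum>x\<in>Z. Poly_Mapping.single x (f x)) \<and>
      Poly_Mapping.keys (\<Sum>x\<in>Z. Poly_Mapping.single x (f x)) \<subseteq> S" for Z f
  proof (induction Z rule: finite_induct)
    case (insert x Z)
    have k: "Poly_Mapping.keys (Poly_Mapping.single x (f x)) \<subseteq> S"
      using insert.prems by (simp add: )
    show ?case
      using insert k add[OF k, of "\<Sum>x\<in>Z. Poly_Mapping.single x (f x)"] single[of x "f x"]
        keys_add[of "Poly_Mapping.single x (f x)" "\<Sum>x\<in>Z. Poly_Mapping.single x (f x)"]
      by auto
  qed (use assms(2) in auto)
  from this[of "Poly_Mapping.keys t" "Poly_Mapping.lookup t"] show ?thesis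
    using assms(1) poly_mapping_sum_singles[of t] by simp
qed

definition lin_ext ::
    "('p::prime_card mod_ring, 'a, 'm) module_scheme \<Rightarrow> ('x \<Rightarrow> 'a) \<Rightarrow> ('x \<Rightarrow>\<^sub>0 'p mod_ring) \<Rightarrow> 'a"
  where "lin_ext M g t =
    (\<Oplus>\<^bsub>M\<^esub>x\<in>Poly_Mapping.keys t. Poly_Mapping.lookup t x \<odot>\<^bsub>M\<^esub> g x)"

lemma keys_add_subset:
  "\<lbrakk>Poly_Mapping.keys s \<subseteq> S; Poly_Mapping.keys t \<subseteq> S\<rbrakk> \<Longrightarrow> Poly_Mapping.keys (s + t) \<subseteq> S"
  using keys_add[of s t] by blast

context
  fixes M :: "('p::prime_card mod_ring, 'a, 'm) module_scheme" (structure) and S :: "'x set" and g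
  assumes M: "fp_module M" and g: "g \<in> S \<rightarrow> carrier M"
begin

interpretation fp_module M by (rule M)

lemma lin_ext_eq:
  assumes "finite Z" "Poly_Mapping.keys t \<subseteq> Z" "Z \<subseteq> S"
  shows "lin_ext M g t = (\<Oplus>x\<in>Z. Poly_Mapping.lookup t x \<odot> g x)"
  unfolding lin_ext_def
  by (rule add.finprod_mono_neutral_cong_left)
    (use assms g smult_l_null in \<open>auto simp: in_keys_iff Pi_iff subset_iff\<close>)

lemma lin_ext_zero: "lin_ext M g 0 = \<zero>"
  by (simp add: lin_ext_def)

lemma lin_ext_closed: "Poly_Mapping.keys t \<subseteq> S \<Longrightarrow> lin_ext M g t \<in> carrier M"
  unfolding lin_ext_def using g by (intro finsum_closed) (auto intro!: smult_closed)

lemma lin_ext_single: "x \<in> S \<Longrightarrow> lin_ext M g (Poly_Mapping.single x c) = c \<odot> g x"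
  using g lin_ext_eq[of "{x}" "Poly_Mapping.single x c"]
  by (auto simp: Pi_iff)

lemma lin_ext_add:
  assumes "Poly_Mapping.keys s \<subseteq> S" "Poly_Mapping.keys t \<subseteq> S"
  shows "lin_ext M g (s + t) = lin_ext M g s \<oplus> lin_ext M g t"
proof -
  let ?Z = "Poly_Mapping.keys s \<union> Poly_Mapping.keys t"
  have Z: "finite ?Z" "?Z \<subseteq> S" "Poly_Mapping.keys (s + t) \<subseteq> ?Z" using assms keys_add[of s t] by auto
  have gx: "g x \<in> carrier M" if "x \<in> ?Z" for x using g that Z by auto
  have "lin_ext M g (s + t) =
      (\<Oplus>x\<in>?Z. Poly_Mapping.lookup s x \<odot> g x \<oplus> Poly_Mapping.lookup t x \<odot> g x)"
    unfolding lin_ext_eq[OF Z(1,3,2)] by (rule finsum_cong')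
      (use gx smult_l_distr in \<open>auto simp: lookup_add\<close>)
  also have "\<dots> = lin_ext M g s \<oplus> lin_ext M g t"
    using gx Z by (subst (1 2) lin_ext_eq[OF Z(1)]) (auto intro!: finsum_addf)
  finally show ?thesis .
qed

lemma lin_ext_uminus:
  assumes "Poly_Mapping.keys t \<subseteq> S"
  shows "lin_ext M g (- t) = \<ominus> lin_ext M g t"
proof -
  have "lin_ext M g (- t) \<oplus> lin_ext M g t = \<zero>"
    using lin_ext_add[of "- t" t] assms lin_ext_zero by (simp add: keys_def)
  thus ?thesis
    using assms lin_ext_closed by (intro minus_equality[symmetric]) (auto simp: keys_def)
qed

lemma lin_ext_in_subgroup:
  assumes "additive_subgroup H M" "\<And>c x. x \<in> Poly_Mapping.keys t \<Longrightarrow> c \<odot> g x \<in> H"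
  shows "lin_ext M g t \<in> H"
proof -
  interpret H: additive_subgroup H M by fact
  have "finite Z \<Longrightarrow> Z \<subseteq> Poly_Mapping.keys t \<Longrightarrow> (\<Oplus>x\<in>Z. Poly_Mapping.lookup t x \<odot> g x) \<in> H" for Z
    by (induction Z rule: finite_induct)
      (use assms(2) H.a_subset in \<open>auto simp: Pi_iff subset_iff\<close>)
  thus ?thesis by (simp add: lin_ext_def)
qed

end

section \<open>The tensor product and its universal property\<close>

lemma pair_algebra_simps:
  "carrier (pair_algebra A B) = {t. Poly_Mapping.keys t \<subseteq> carrier A \<times> carrier B}"
  "\<one>\<^bsub>pair_algebra A B\<^esub> = Poly_Mapping.single (\<one>\<^bsub>A\<^esub>, \<one>\<^bsub>B\<^esub>) 1" "\<zero>\<^bsub>pair_algebra A B\<^esub> = 0"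
  "ring.add (pair_algebra A B) = (+)"
  by (simp_all add: pair_algebra_def Let_def)

text \<open>
  The double sum over the keys can be taken over any larger finite sets, since the additional terms
  vanish.  Sums for different factors can thus be compared over common index sets, which gives
  bi-additivity.
\<close>

lemma pair_mult_eq:
  assumes "finite Z" "Poly_Mapping.keys s \<subseteq> Z" "finite Y" "Poly_Mapping.keys t \<subseteq> Y"
  shows "s \<otimes>\<^bsub>pair_algebra A B\<^esub> t = (\<Sum>x\<in>Z. \<Sum>y\<in>Y.
    Poly_Mapping.single (fst x \<otimes>\<^bsub>A\<^esub> fst y, snd x \<otimes>\<^bsub>B\<^esub> snd y)
      (Poly_Mapping.lookup s x * Poly_Mapping.lookup t y))"
proof -
  have "s \<otimes>\<^bsub>pair_algebra A B\<^esub> t = (\<Sum>x\<in>Poly_Mapping.keys s. \<Sum>y\<in>Poly_Mapping.keys t.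
    Poly_Mapping.single (fst x \<otimes>\<^bsub>A\<^esub> fst y, snd x \<otimes>\<^bsub>B\<^esub> snd y)
      (Poly_Mapping.lookup s x * Poly_Mapping.lookup t y))"
    by (simp add: pair_algebra_def Let_def)
  also have "\<dots> = (\<Sum>x\<in>Poly_Mapping.keys s. \<Sum>y\<in>Y.
    Poly_Mapping.single (fst x \<otimes>\<^bsub>A\<^esub> fst y, snd x \<otimes>\<^bsub>B\<^esub> snd y)
      (Poly_Mapping.lookup s x * Poly_Mapping.lookup t y))"
    using assms by (intro sum.cong refl sum.mono_neutral_left) (auto simp: in_keys_iff)
  also have "\<dots> = (\<Sum>x\<in>Z. \<Sum>y\<in>Y.
    Poly_Mapping.single (fst x \<otimes>\<^bsub>A\<^esub> fst y, snd x \<otimes>\<^bsub>B\<^esub> snd y)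
      (Poly_Mapping.lookup s x * Poly_Mapping.lookup t y))"
    using assms by (intro sum.mono_neutral_left) (auto simp: in_keys_iff)
  finally show ?thesis .
qed

lemma pair_mult_single:
  "Poly_Mapping.single x c \<otimes>\<^bsub>pair_algebra A B\<^esub> Poly_Mapping.single y d =
    Poly_Mapping.single (fst x \<otimes>\<^bsub>A\<^esub> fst y, snd x \<otimes>\<^bsub>B\<^esub> snd y) (c * d)"
  by (subst pair_mult_eq[of "{x}" _ "{y}"]) auto

lemma pair_mult_add_left:
  "(s + s') \<otimes>\<^bsub>pair_algebra A B\<^esub> t = s \<otimes>\<^bsub>pair_algebra A B\<^esub> t + s' \<otimes>\<^bsub>pair_algebra A B\<^esub> t"
proof -
  let ?Z = "Poly_Mapping.keys s \<union> Poly_Mapping.keys s'"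
  show ?thesis using keys_add[of s s']
    by (subst (1 2 3) pair_mult_eq[of ?Z _ "Poly_Mapping.keys t"])
      (auto simp: lookup_add distrib_right single_add sum.distrib)
qed

lemma pair_mult_add_right:
  "s \<otimes>\<^bsub>pair_algebra A B\<^esub> (t + t') = s \<otimes>\<^bsub>pair_algebra A B\<^esub> t + s \<otimes>\<^bsub>pair_algebra A B\<^esub> t'"
proof -
  let ?Z = "Poly_Mapping.keys t \<union> Poly_Mapping.keys t'"
  show ?thesis using keys_add[of t t']
    by (subst (1 2 3) pair_mult_eq[of "Poly_Mapping.keys s" _ ?Z])
      (auto simp: lookup_add distrib_left single_add sum.distrib)
qed

lemma pair_mult_zero [simp]:
  "0 \<otimes>\<^bsub>pair_algebra A B\<^esub> t = 0" "t \<otimes>\<^bsub>pair_algebra A B\<^esub> 0 = 0"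
  by (simp_all add: pair_algebra_def Let_def)

lemma pair_mult_diff_left:
  "(s - s') \<otimes>\<^bsub>pair_algebra A B\<^esub> t = s \<otimes>\<^bsub>pair_algebra A B\<^esub> t - s' \<otimes>\<^bsub>pair_algebra A B\<^esub> t"
  using pair_mult_add_left[where s="s - s'" and s'=s' and t=t and A=A and B=B]
  by (simp add: eq_diff_eq)

lemma pair_mult_diff_right:
  "s \<otimes>\<^bsub>pair_algebra A B\<^esub> (t - t') = s \<otimes>\<^bsub>pair_algebra A B\<^esub> t - s \<otimes>\<^bsub>pair_algebra A B\<^esub> t'"
  using pair_mult_add_right[where s=s and t="t - t'" and t'=t' and A=A and B=B]
  by (simp add: eq_diff_eq)

lemma keys_pair_mult:
  assumes "\<And>x y. \<lbrakk>x \<in> Poly_Mapping.keys s; y \<in> Poly_Mapping.keys t\<rbrakk> \<Longrightarrow>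
      (fst x \<otimes>\<^bsub>A\<^esub> fst y, snd x \<otimes>\<^bsub>B\<^esub> snd y) \<in> K"
  shows "Poly_Mapping.keys (s \<otimes>\<^bsub>pair_algebra A B\<^esub> t) \<subseteq> K"
proof -
  have "Poly_Mapping.keys (\<Sum>x\<in>Z. \<Sum>y\<in>Y. f x y) \<subseteq> (\<Union>x\<in>Z. \<Union>y\<in>Y. Poly_Mapping.keys (f x y))"
    for f :: "_ \<Rightarrow> _ \<Rightarrow> ('x \<Rightarrow>\<^sub>0 'y::comm_monoid_add)" and Z Y
  proof (cases "finite Z")
    case True
    thus ?thesis
    proof (induction Z rule: finite_induct)
      case (insert x F)
      have "Poly_Mapping.keys (\<Sum>y\<in>Y. f x y) \<subseteq> (\<Union>y\<in>Y. Poly_Mapping.keys (f x y))"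
      proof (cases "finite Y")
        case True
        thus ?thesis
        proof (induction Y rule: finite_induct)
          case (insert y Y)
          thus ?case using keys_add[of "f x y" "\<Sum>y\<in>Y. f x y"] by auto
        qed auto
      qed auto
      thus ?case using insert keys_add[of "\<Sum>y\<in>Y. f x y" "\<Sum>x\<in>F. \<Sum>y\<in>Y. f x y"] by auto
    qed auto
  qed auto
  note sub = this
  show ?thesis
    by (subst pair_mult_eq[OF finite_keys subset_refl finite_keys subset_refl],
      rule order_trans[OF sub]) (use assms in auto)
qed

locale fp_algebra_pair = A: fp_algebra A + B: fp_algebra B
  for A :: "('p::prime_card mod_ring, 'a) graded" and B :: "('p mod_ring, 'b) graded"
begin

abbreviation C where "C \<equiv> carrier (pair_algebra A B)"
abbreviation pair_mult (infixl \<open>\<star>\<close> 70) where "s \<star> t \<equiv> s \<otimes>\<^bsub>pair_algebra A B\<^esub> t"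
abbreviation tensor_ideal where "tensor_ideal \<equiv> Idl\<^bsub>pair_algebra A B\<^esub> (tensor_relations A B)"

lemma C_iff: "t \<in> C \<longleftrightarrow> Poly_Mapping.keys t \<subseteq> carrier A \<times> carrier B"
  by (simp add: pair_algebra_simps)

lemma single_in_C: "\<lbrakk>a \<in> carrier A; b \<in> carrier B\<rbrakk> \<Longrightarrow> Poly_Mapping.single (a, b) c \<in> C"
  by (auto simp: C_iff)

lemma C_add: "\<lbrakk>s \<in> C; t \<in> C\<rbrakk> \<Longrightarrow> s + t \<in> C"
  by (simp add: C_iff keys_add_subset)

lemma C_uminus: "s \<in> C \<Longrightarrow> - s \<in> C"
  by (simp add: C_iff keys_def)

lemma C_diff: "\<lbrakk>s \<in> C; t \<in> C\<rbrakk> \<Longrightarrow> s - t \<in> C"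
  using C_add[OF _ C_uminus] by fastforce

lemma C_mult: "\<lbrakk>s \<in> C; t \<in> C\<rbrakk> \<Longrightarrow> s \<star> t \<in> C"
  unfolding C_iff by (rule keys_pair_mult) (auto dest!: subsetD)

lemma C_induct [consumes 1, case_names zero single add]:
  assumes "t \<in> C" "P 0"
    and "\<And>a b c. \<lbrakk>a \<in> carrier A; b \<in> carrier B\<rbrakk> \<Longrightarrow> P (Poly_Mapping.single (a, b) c)"
    and "\<And>s t. \<lbrakk>s \<in> C; t \<in> C; P s; P t\<rbrakk> \<Longrightarrow> P (s + t)"
  shows "P t"
  using assms(1)[unfolded C_iff]
  by (induction t rule: poly_mapping_span_induct) (use assms(2-) in \<open>auto simp: C_iff\<close>)

lemma pair_mult_assoc:
  assumes "r \<in> C" "s \<in> C" "t \<in> C"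
  shows "(r \<star> s) \<star> t = r \<star> (s \<star> t)"
  using assms
proof (induction r rule: C_induct)
  case (single a b c)
  note ab = single(1,2)
  from single(3,4) show ?case
  proof (induction s rule: C_induct)
    case (single a' b' c')
    note ab' = single(1,2)
    from single(3) show ?case
    proof (induction t rule: C_induct)
      case (single a'' b'' c'')
      thus ?case using ab ab' by (simp add: pair_mult_single A.m_assoc B.m_assoc mult.assoc)
    qed (auto simp: pair_mult_add_left pair_mult_add_right)
  qed (auto simp: pair_mult_add_left pair_mult_add_right)
qed (auto simp: pair_mult_add_left pair_mult_add_right)

lemma pair_mult_one:
  assumes "t \<in> C"
  shows "Poly_Mapping.single (\<one>\<^bsub>A\<^esub>, \<one>\<^bsub>B\<^esub>) 1 \<star> t = t" "t \<star> Poly_Mapping.single (\<one>\<^bsub>A\<^esub>, \<one>\<^bsub>B\<^esub>) 1 = t"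
  using assms
  by (induction t rule: C_induct)
    (auto simp: pair_mult_single pair_mult_add_left pair_mult_add_right)

lemma ring_pair_algebra: "ring (pair_algebra A B)"
proof (rule ringI)
  show "abelian_group (pair_algebra A B)"
  proof (rule abelian_groupI)
    fix t assume "t \<in> C"
    thus "\<exists>s\<in>C. s \<oplus>\<^bsub>pair_algebra A B\<^esub> t = \<zero>\<^bsub>pair_algebra A B\<^esub>"
      by (intro bexI[of _ "- t"] C_uminus) (simp_all add: pair_algebra_simps)
  next
    fix s t assume "s \<in> C" "t \<in> C"
    thus "s \<oplus>\<^bsub>pair_algebra A B\<^esub> t \<in> C" using C_add by (simp add: pair_algebra_simps(4))
  qed (simp_all add: pair_algebra_simps add_ac)
  show "Group.monoid (pair_algebra A B)"
    by (rule monoidI)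
      (simp_all add: C_mult pair_mult_assoc pair_mult_one pair_algebra_simps(2) single_in_C)
qed (simp_all add: pair_algebra_simps(4) pair_mult_add_left pair_mult_add_right)

sublocale ring "pair_algebra A B" rewrites "\<zero>\<^bsub>pair_algebra A B\<^esub> = 0" and "ring.add (pair_algebra A B) = (+)"
  by (simp_all add: ring_pair_algebra pair_algebra_simps)

lemma a_inv_pair: "t \<in> C \<Longrightarrow> \<ominus>\<^bsub>pair_algebra A B\<^esub> t = - t"
  by (rule minus_equality) (auto intro: C_uminus)

lemma relations_subset: "tensor_relations A B \<subseteq> C"
  unfolding tensor_relations_def
  by (auto intro!: C_diff single_in_C)

sublocale T: ideal tensor_ideal "pair_algebra A B"
  by (rule genideal_ideal) (rule relations_subset)

lemma ideal_zero: "0 \<in> tensor_ideal"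
  using T.zero_closed by (simp add: pair_algebra_simps)

lemma ideal_add: "\<lbrakk>s \<in> tensor_ideal; t \<in> tensor_ideal\<rbrakk> \<Longrightarrow> s + t \<in> tensor_ideal"
  using T.a_closed by (simp add: pair_algebra_simps)

lemma ideal_in_C: "t \<in> tensor_ideal \<Longrightarrow> t \<in> C"
  using T.a_subset by blast

lemma ideal_uminus: "t \<in> tensor_ideal \<Longrightarrow> - t \<in> tensor_ideal"
  using T.a_inv_closed[of t] a_inv_pair[OF ideal_in_C, of t] by simp

lemma ideal_diff: "\<lbrakk>s \<in> tensor_ideal; t \<in> tensor_ideal\<rbrakk> \<Longrightarrow> s - t \<in> tensor_ideal"
  using ideal_add[OF _ ideal_uminus] by fastforce

lemma relation_in_ideal: "t \<in> tensor_relations A B \<Longrightarrow> t \<in> tensor_ideal"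
  using genideal_self[OF relations_subset] by blast

lemma ideal_scale:
  assumes "t \<in> tensor_ideal"
  shows "Poly_Mapping.single (\<one>\<^bsub>A\<^esub>, \<one>\<^bsub>B\<^esub>) c \<star> t \<in> tensor_ideal"
  using assms by (intro T.I_l_closed single_in_C) auto

text \<open>
  The ideal absorbs multiplication by scalars \<open>c (1 \<otimes> 1)\<close>, so the relations hold with any coefficient.
\<close>

lemma tensor_add_left:
  assumes "a \<in> carrier A" "a' \<in> carrier A" "b \<in> carrier B"
  shows "Poly_Mapping.single (a \<oplus>\<^bsub>A\<^esub> a', b) c - Poly_Mapping.single (a, b) c -
    Poly_Mapping.single (a', b) c \<in> tensor_ideal"
  using ideal_scale[OF relation_in_ideal, of "Poly_Mapping.single (a \<oplus>\<^bsub>A\<^esub> a', b) 1 -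
      Poly_Mapping.single (a, b) 1 - Poly_Mapping.single (a', b) 1" c] assms
  by (fastforce simp: tensor_relations_def pair_mult_single pair_mult_diff_right)

lemma tensor_add_right:
  assumes "a \<in> carrier A" "b \<in> carrier B" "b' \<in> carrier B"
  shows "Poly_Mapping.single (a, b \<oplus>\<^bsub>B\<^esub> b') c - Poly_Mapping.single (a, b) c -
    Poly_Mapping.single (a, b') c \<in> tensor_ideal"
  using ideal_scale[OF relation_in_ideal, of "Poly_Mapping.single (a, b \<oplus>\<^bsub>B\<^esub> b') 1 -
      Poly_Mapping.single (a, b) 1 - Poly_Mapping.single (a, b') 1" c] assms
  by (fastforce simp: tensor_relations_def pair_mult_single pair_mult_diff_right)

lemma tensor_smult_left:
  assumes "a \<in> carrier A" "b \<in> carrier B"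
  shows "Poly_Mapping.single (d \<odot>\<^bsub>A\<^esub> a, b) c - Poly_Mapping.single (a, b) (c * d) \<in> tensor_ideal"
  using ideal_scale[OF relation_in_ideal, of "Poly_Mapping.single (d \<odot>\<^bsub>A\<^esub> a, b) 1 -
      Poly_Mapping.single (a, b) d" c] assms
  by (fastforce simp: tensor_relations_def pair_mult_single pair_mult_diff_right)

lemma tensor_smult_right:
  assumes "a \<in> carrier A" "b \<in> carrier B"
  shows "Poly_Mapping.single (a, d \<odot>\<^bsub>B\<^esub> b) c - Poly_Mapping.single (a, b) (c * d) \<in> tensor_ideal"
  using ideal_scale[OF relation_in_ideal, of "Poly_Mapping.single (a, d \<odot>\<^bsub>B\<^esub> b) 1 -
      Poly_Mapping.single (a, b) d" c] assms
  by (fastforce simp: tensor_relations_def pair_mult_single pair_mult_diff_right)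

definition bilinear_map :: "('p mod_ring, 'c, 'm) module_scheme \<Rightarrow> ('a \<times> 'b \<Rightarrow> 'c) \<Rightarrow> bool"
  where "bilinear_map M g \<longleftrightarrow> g \<in> carrier A \<times> carrier B \<rightarrow> carrier M \<and>
    (\<forall>a\<in>carrier A. \<forall>a'\<in>carrier A. \<forall>b\<in>carrier B. g (a \<oplus>\<^bsub>A\<^esub> a', b) = g (a, b) \<oplus>\<^bsub>M\<^esub> g (a', b)) \<and>
    (\<forall>a\<in>carrier A. \<forall>b\<in>carrier B. \<forall>b'\<in>carrier B. g (a, b \<oplus>\<^bsub>B\<^esub> b') = g (a, b) \<oplus>\<^bsub>M\<^esub> g (a, b')) \<and>
    (\<forall>c. \<forall>a\<in>carrier A. \<forall>b\<in>carrier B. g (c \<odot>\<^bsub>A\<^esub> a, b) = c \<odot>\<^bsub>M\<^esub> g (a, b)) \<and>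
    (\<forall>c. \<forall>a\<in>carrier A. \<forall>b\<in>carrier B. g (a, c \<odot>\<^bsub>B\<^esub> b) = c \<odot>\<^bsub>M\<^esub> g (a, b))"

text \<open>
  Multiplying the argument by a pair amounts to translating the bilinear map by that pair.  So whatever
  all bilinear maps kill is closed under multiplication, on both sides.
\<close>

lemma bilinear_map_translate:
  assumes "bilinear_map M g" "a \<in> carrier A" "b \<in> carrier B"
  shows "bilinear_map M (\<lambda>(a', b'). g (a \<otimes>\<^bsub>A\<^esub> a', b \<otimes>\<^bsub>B\<^esub> b'))"
    and "bilinear_map M (\<lambda>(a', b'). g (a' \<otimes>\<^bsub>A\<^esub> a, b' \<otimes>\<^bsub>B\<^esub> b))"
  using assms unfolding bilinear_map_def
  by (auto simp: A.r_distr B.r_distr A.l_distr B.l_distr A.smult_mult_right B.smult_mult_right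
    A.smult_mult_left B.smult_mult_left)

lemma lin_ext_translate:
  assumes "fp_module M" "bilinear_map M g" "a \<in> carrier A" "b \<in> carrier B" "t \<in> C"
  shows "lin_ext M g (Poly_Mapping.single (a, b) c \<star> t) =
      c \<odot>\<^bsub>M\<^esub> lin_ext M (\<lambda>(a', b'). g (a \<otimes>\<^bsub>A\<^esub> a', b \<otimes>\<^bsub>B\<^esub> b')) t"
    and "lin_ext M g (t \<star> Poly_Mapping.single (a, b) c) =
      c \<odot>\<^bsub>M\<^esub> lin_ext M (\<lambda>(a', b'). g (a' \<otimes>\<^bsub>A\<^esub> a, b' \<otimes>\<^bsub>B\<^esub> b)) t"
proof -
  interpret M: fp_module M by fact
  have g: "g \<in> carrier A \<times> carrier B \<rightarrow> carrier M"
    and g1: "(\<lambda>(a', b'). g (a \<otimes>\<^bsub>A\<^esub> a', b \<otimes>\<^bsub>B\<^esub> b')) \<in> carrier A \<times> carrier B \<rightarrow> carrier M"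
    and g2: "(\<lambda>(a', b'). g (a' \<otimes>\<^bsub>A\<^esub> a, b' \<otimes>\<^bsub>B\<^esub> b)) \<in> carrier A \<times> carrier B \<rightarrow> carrier M"
    using assms(2) bilinear_map_translate[OF assms(2-4)] by (auto simp: bilinear_map_def)
  from assms(5) show "lin_ext M g (Poly_Mapping.single (a, b) c \<star> t) =
      c \<odot>\<^bsub>M\<^esub> lin_ext M (\<lambda>(a', b'). g (a \<otimes>\<^bsub>A\<^esub> a', b \<otimes>\<^bsub>B\<^esub> b')) t"
  proof (induction t rule: C_induct)
    case zero
    show ?case by (simp add: lin_ext_def)
  next
    case (single a' b' d)
    have "g (a \<otimes>\<^bsub>A\<^esub> a', b \<otimes>\<^bsub>B\<^esub> b') \<in> carrier M" using g single assms(3,4) by auto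
    thus ?case using single assms(3,4)
      by (simp add: pair_mult_single lin_ext_single[OF assms(1) g] lin_ext_single[OF assms(1) g1]
          M.smult_assoc)
  next
    case (add s t)
    have "Poly_Mapping.single (a, b) c \<star> s \<in> C" "Poly_Mapping.single (a, b) c \<star> t \<in> C"
      using add assms by (auto intro!: C_mult single_in_C)
    thus ?case using add unfolding C_iff
      by (simp add: pair_mult_add_right lin_ext_add[OF assms(1) g] lin_ext_add[OF assms(1) g1]
          M.smult_r_distr lin_ext_closed[OF assms(1) g1])
  qed
  from assms(5) show "lin_ext M g (t \<star> Poly_Mapping.single (a, b) c) =
      c \<odot>\<^bsub>M\<^esub> lin_ext M (\<lambda>(a', b'). g (a' \<otimes>\<^bsub>A\<^esub> a, b' \<otimes>\<^bsub>B\<^esub> b)) t"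
  proof (induction t rule: C_induct)
    case zero
    show ?case by (simp add: lin_ext_def)
  next
    case (single a' b' d)
    have "g (a' \<otimes>\<^bsub>A\<^esub> a, b' \<otimes>\<^bsub>B\<^esub> b) \<in> carrier M" using g single assms(3,4) by auto
    thus ?case using single assms(3,4)
      by (simp add: pair_mult_single lin_ext_single[OF assms(1) g] lin_ext_single[OF assms(1) g2]
          M.smult_assoc[symmetric] mult.commute)
  next
    case (add s t)
    have "s \<star> Poly_Mapping.single (a, b) c \<in> C" "t \<star> Poly_Mapping.single (a, b) c \<in> C"
      using add assms by (auto intro!: C_mult single_in_C)
    thus ?case using add unfolding C_iff
      by (simp add: pair_mult_add_left lin_ext_add[OF assms(1) g] lin_ext_add[OF assms(1) g2]
          M.smult_r_distr lin_ext_closed[OF assms(1) g2])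
  qed
qed

text \<open>
  The elements killed by every bilinear map into \<open>M\<close> form an ideal, because translating a bilinear
  map by a pair gives a bilinear map again; and this ideal contains the tensor relations.
\<close>

lemma lin_ext_tensor_ideal:
  assumes "fp_module M" "bilinear_map M g" "t \<in> tensor_ideal"
  shows "lin_ext M g t = \<zero>\<^bsub>M\<^esub>"
proof -
  interpret M: fp_module M by fact
  define K where "K = {t \<in> C. \<forall>g. bilinear_map M g \<longrightarrow> lin_ext M g t = \<zero>\<^bsub>M\<^esub>}"
  have gM: "g \<in> carrier A \<times> carrier B \<rightarrow> carrier M" if "bilinear_map M g" for g
    using that by (simp add: bilinear_map_def)
  note ext = lin_ext_single[OF assms(1) gM] lin_ext_add[OF assms(1) gM]
    lin_ext_closed[OF assms(1) gM] lin_ext_uminus[OF assms(1) gM]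
  have K0: "0 \<in> K" by (simp add: K_def lin_ext_def C_iff)
  have Kadd: "s + t \<in> K" if "s \<in> K" "t \<in> K" for s t
    using that C_add[of s t] by (simp add: K_def ext C_iff)
  have Kneg: "- t \<in> K" if "t \<in> K" for t
    using that C_uminus[of t] by (simp add: K_def ext C_iff)
  have "ideal K (pair_algebra A B)"
  proof (rule idealI[OF ring_pair_algebra])
    show "subgroup K (add_monoid (pair_algebra A B))"
    proof (rule group.subgroupI[OF abelian_group.a_group[OF ring.is_abelian_group[OF ring_pair_algebra]]])
      fix t assume t: "t \<in> K"
      hence "t \<in> C" by (simp add: K_def)
      thus "inv\<^bsub>add_monoid (pair_algebra A B)\<^esub> t \<in> K"
        using Kneg[OF t] a_inv_pair by (simp add: a_inv_def)
    next
      show "K \<subseteq> carrier (add_monoid (pair_algebra A B))" by (auto simp: K_def)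
      show "K \<noteq> {}" using K0 by blast
    qed (use Kadd in \<open>simp add: pair_algebra_simps\<close>)
  next
    fix t s assume t: "t \<in> K" and s: "s \<in> C"
    from s show "s \<star> t \<in> K"
    proof (induction s rule: C_induct)
      case (single a b c)
      thus ?case using t bilinear_map_translate(1)[of M, OF _ single]
        by (auto simp: K_def lin_ext_translate[OF assms(1)] intro!: C_mult single_in_C)
    qed (auto simp: K0 Kadd pair_mult_add_left)
    from s show "t \<star> s \<in> K"
    proof (induction s rule: C_induct)
      case (single a b c)
      thus ?case using t bilinear_map_translate(2)[of M, OF _ single]
        by (auto simp: K_def lin_ext_translate[OF assms(1)] intro!: C_mult single_in_C)
    qed (auto simp: K0 Kadd pair_mult_add_right)
  qed
  moreover have "tensor_relations A B \<subseteq> K"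
  proof
    fix t assume t: "t \<in> tensor_relations A B"
    hence tC: "t \<in> C" using relations_subset by blast
    have "lin_ext M g t = \<zero>\<^bsub>M\<^esub>" if g: "bilinear_map M g" for g
    proof -
      have diff: "lin_ext M g (u - v) = lin_ext M g u \<oplus>\<^bsub>M\<^esub> \<ominus>\<^bsub>M\<^esub> lin_ext M g v" if "u \<in> C" "v \<in> C" for u v
        using ext(2)[OF g, of u "- v"] ext(4)[OF g, of v] that C_uminus[of v] by (simp add: C_iff)
      have sing: "lin_ext M g (Poly_Mapping.single (a, b) c) = c \<odot>\<^bsub>M\<^esub> g (a, b)"
        if "a \<in> carrier A" "b \<in> carrier B" for a b c
        using ext(1)[OF g] that by simp
      have gc: "g (a, b) \<in> carrier M" if "a \<in> carrier A" "b \<in> carrier B" for a b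
        using gM[OF g] that by auto
      have bil: "\<And>a a' b. \<lbrakk>a \<in> carrier A; a' \<in> carrier A; b \<in> carrier B\<rbrakk> \<Longrightarrow>
          g (a \<oplus>\<^bsub>A\<^esub> a', b) = g (a, b) \<oplus>\<^bsub>M\<^esub> g (a', b)"
        "\<And>a b b'. \<lbrakk>a \<in> carrier A; b \<in> carrier B; b' \<in> carrier B\<rbrakk> \<Longrightarrow>
          g (a, b \<oplus>\<^bsub>B\<^esub> b') = g (a, b) \<oplus>\<^bsub>M\<^esub> g (a, b')"
        "\<And>a b c. \<lbrakk>a \<in> carrier A; b \<in> carrier B\<rbrakk> \<Longrightarrow> g (c \<odot>\<^bsub>A\<^esub> a, b) = c \<odot>\<^bsub>M\<^esub> g (a, b)"
        "\<And>a b c. \<lbrakk>a \<in> carrier A; b \<in> carrier B\<rbrakk> \<Longrightarrow> g (a, c \<odot>\<^bsub>B\<^esub> b) = c \<odot>\<^bsub>M\<^esub> g (a, b)"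
        using g by (simp_all add: bilinear_map_def)
      have cancel: "x \<oplus>\<^bsub>M\<^esub> y \<oplus>\<^bsub>M\<^esub> \<ominus>\<^bsub>M\<^esub> x \<oplus>\<^bsub>M\<^esub> \<ominus>\<^bsub>M\<^esub> y = \<zero>\<^bsub>M\<^esub>"
        if "x \<in> carrier M" "y \<in> carrier M" for x y
        using that M.r_neg[of "x \<oplus>\<^bsub>M\<^esub> y"] by (simp add: M.minus_add M.a_assoc)
      from t show ?thesis unfolding tensor_relations_def
        by (auto simp: diff sing C_diff single_in_C gc bil cancel M.r_neg)
    qed
    thus "t \<in> K" using tC by (simp add: K_def)
  qed
  ultimately have "tensor_ideal \<subseteq> K" by (rule genideal_minimal)
  thus ?thesis using assms by (auto simp: K_def)
qed

end

section \<open>Connected graded algebras\<close>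

text \<open>
  The part \<open>M\<^bsup>\<ge>n\<^esup>\<close>, generated as an additive group by homogeneous elements.  Closure under scalars and
  products then follows by induction, with no reference to homogeneous components.
\<close>

inductive_set high :: "('k, 'b) graded \<Rightarrow> nat \<Rightarrow> 'b set" for M n where
  zero: "\<zero>\<^bsub>M\<^esub> \<in> high M n"
| homog: "\<lbrakk>x \<in> homog M k; int n \<le> k\<rbrakk> \<Longrightarrow> x \<in> high M n"
| add: "\<lbrakk>x \<in> high M n; y \<in> high M n\<rbrakk> \<Longrightarrow> x \<oplus>\<^bsub>M\<^esub> y \<in> high M n"

lemma homog_decompI:
  assumes "graded_abelian_group M" "finite Z" "\<And>n. n \<notin> Z \<Longrightarrow> f n = \<zero>\<^bsub>M\<^esub>"
    "\<And>n. f n \<in> homog M n" "x = finsum M f Z"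
  shows "homog_decomp M x f"
proof -
  interpret graded_abelian_group M by fact
  have sub: "{n. f n \<noteq> \<zero>\<^bsub>M\<^esub>} \<subseteq> Z" using assms(3) by auto
  have "f n \<in> carrier M" for n
    using assms(4)[of n] additive_subgroup.a_subset[OF homog_subgroup] by blast
  hence "finsum M f {n. f n \<noteq> \<zero>\<^bsub>M\<^esub>} = finsum M f Z"
    using assms(2) sub by (intro add.finprod_mono_neutral_cong_left) auto
  thus ?thesis using assms finite_subset[OF sub] by (simp add: homog_decomp_def)
qed

locale connected_fp_algebra = fp_algebra N + graded_abelian_group N
  for N :: "('p::prime_card mod_ring, 'b) graded" (structure) +
  assumes homog_smult: "x \<in> homog N m \<Longrightarrow> c \<odot> x \<in> homog N m"
    and homog_mult: "\<lbrakk>x \<in> homog N m; y \<in> homog N n\<rbrakk> \<Longrightarrow> x \<otimes> y \<in> homog N (m + n)"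
    and connected: "connected_graded N"

lemma connected_fp_algebraI:
  assumes "graded_fp_algebra N" "connected_graded N"
  shows "connected_fp_algebra N"
proof -
  interpret graded_fp_algebra N by fact
  interpret N: fp_algebra N by (rule fp_algebra)
  show ?thesis
    by unfold_locales (use assms(2) homog_smult homog_mult in auto)
qed

context connected_fp_algebra
begin

lemma homog_closed: "x \<in> homog N n \<Longrightarrow> x \<in> carrier N"
  using additive_subgroup.a_subset[OF homog_subgroup] by blast

lemma high_closed: "x \<in> high N n \<Longrightarrow> x \<in> carrier N"
  by (induction rule: high.induct) (auto intro: homog_closed)

lemma high_smult: "x \<in> high N n \<Longrightarrow> c \<odot> x \<in> high N n"
  by (induction rule: high.induct)
    (auto intro: high.intros homog_smult simp: smult_r_distr high_closed)

lemma smult_minus_one: "x \<in> carrier N \<Longrightarrow> (- 1) \<odot> x = \<ominus> x"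
  using smult_l_distr[of x "- 1" 1] by (intro minus_equality[symmetric]) auto

lemma high_subgroup: "additive_subgroup (high N n) N"
proof (rule additive_subgroup.intro, rule add.subgroupI)
  show "\<ominus> x \<in> high N n" if "x \<in> high N n" for x
    using high_smult[OF that, of "- 1"] smult_minus_one[OF high_closed[OF that]] by simp
qed (use high.zero high.add high_closed in fast)+

lemma high_mult:
  assumes "x \<in> high N m" "y \<in> high N n"
  shows "x \<otimes> y \<in> high N (m + n)"
  using assms(1)
proof (induction rule: high.induct)
  case (homog x k)
  from assms(2) show ?case
  proof (induction rule: high.induct)
    case (homog y l)
    thus ?case using \<open>x \<in> homog N k\<close> \<open>int m \<le> k\<close> homog_mult[of x k y l]
      by (intro high.homog[of _ N "k + l"]) auto
  qed (use homog homog_closed high_closed in \<open>auto intro: high.intros simp: r_distr\<close>)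
qed (use assms(2) high_closed in \<open>auto intro: high.intros simp: l_distr\<close>)

lemma homog_decomp_homog_part:
  assumes "x \<in> carrier N"
  shows "homog_decomp N x (\<lambda>n. homog_part N n x)"
  unfolding homog_part_def by (rule theI'[OF unique_decomp[OF assms]])

lemma homog_part_eq: "homog_decomp N x f \<Longrightarrow> x \<in> carrier N \<Longrightarrow> homog_part N n x = f n"
  unfolding homog_part_def by (subst the1_equality[OF unique_decomp]) auto

lemma homog_part_in: "x \<in> carrier N \<Longrightarrow> homog_part N n x \<in> homog N n"
  using homog_decomp_homog_part by (simp add: homog_decomp_def)

lemma homog_part_closed: "x \<in> carrier N \<Longrightarrow> homog_part N n x \<in> carrier N"
  by (rule homog_closed[OF homog_part_in])

abbreviation support where "support x \<equiv> {n. homog_part N n x \<noteq> \<zero>}"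

lemma finite_support: "x \<in> carrier N \<Longrightarrow> finite (support x)"
  using homog_decomp_homog_part by (simp add: homog_decomp_def)

lemma finsum_homog_part:
  assumes "x \<in> carrier N" "finite Z" "support x \<subseteq> Z"
  shows "finsum N (\<lambda>n. homog_part N n x) Z = x"
proof -
  have "finsum N (\<lambda>n. homog_part N n x) (support x) = finsum N (\<lambda>n. homog_part N n x) Z"
    using assms homog_part_closed by (intro add.finprod_mono_neutral_cong_left) auto
  thus ?thesis using homog_decomp_homog_part[OF assms(1)] by (simp add: homog_decomp_def)
qed

lemma homog_part_add:
  assumes "x \<in> carrier N" "y \<in> carrier N"
  shows "homog_part N n (x \<oplus> y) = homog_part N n x \<oplus> homog_part N n y"
proof (rule homog_part_eq[OF homog_decompI[where Z="support x \<union> support y"]])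
  let ?Z = "support x \<union> support y"
  have "finsum N (\<lambda>n. homog_part N n x \<oplus> homog_part N n y) ?Z =
      finsum N (\<lambda>n. homog_part N n x) ?Z \<oplus> finsum N (\<lambda>n. homog_part N n y) ?Z"
    using assms homog_part_closed by (intro finsum_addf) auto
  also have "\<dots> = x \<oplus> y"
    using assms by (simp add: finsum_homog_part finite_support)
  finally show "x \<oplus> y = finsum N (\<lambda>n. homog_part N n x \<oplus> homog_part N n y) ?Z" by simp
  show "homog_part N k x \<oplus> homog_part N k y \<in> homog N k" for k
    using assms by (intro additive_subgroup.a_closed[OF homog_subgroup] homog_part_in)
qed (use assms finite_support in \<open>auto intro: graded_abelian_group_axioms\<close>)

lemma homog_part_smult:
  assumes "x \<in> carrier N"
  shows "homog_part N n (c \<odot> x) = c \<odot> homog_part N n x"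
proof (rule homog_part_eq[OF homog_decompI[where Z="support x"]])
  have "c \<odot> finsum N (\<lambda>n. homog_part N n x) Y = (\<Oplus>n\<in>Y. c \<odot> homog_part N n x)" if "finite Y" for Y
    using that assms by (induction Y rule: finite_induct) (auto simp: homog_part_closed smult_r_distr)
  from this[OF finite_support[OF assms]]
  show "c \<odot> x = (\<Oplus>n\<in>support x. c \<odot> homog_part N n x)"
    unfolding finsum_homog_part[OF assms finite_support[OF assms] subset_refl] .
  show "c \<odot> homog_part N k x \<in> homog N k" for k
    using assms by (intro homog_smult homog_part_in)
qed (use assms finite_support in \<open>auto intro: graded_abelian_group_axioms\<close>)

lemma unit_inj: "c \<odot> \<one> = d \<odot> \<one> \<longleftrightarrow> c = d"
  using connected by (auto simp: connected_graded_def bij_betw_def inj_on_def)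

lemma augmentation_eq:
  assumes "x \<in> carrier N"
  shows "augmentation N x \<odot> \<one> = homog_part N 0 x"
proof -
  have "range (\<lambda>c. c \<odot> \<one>) = homog N 0"
    using connected by (simp add: connected_graded_def bij_betw_def)
  then obtain c where c: "c \<odot> \<one> = homog_part N 0 x"
    using homog_part_in[OF assms, of 0] by (metis imageE)
  have "augmentation N x = c"
    unfolding augmentation_def by (rule the_equality) (simp_all add: c flip: unit_inj)
  thus ?thesis using c by simp
qed

lemma augmentation_add:
  assumes "x \<in> carrier N" "y \<in> carrier N"
  shows "augmentation N (x \<oplus> y) = augmentation N x + augmentation N y"
proof -
  have "augmentation N (x \<oplus> y) \<odot> \<one> = (augmentation N x + augmentation N y) \<odot> \<one>"
    using assms by (simp add: augmentation_eq homog_part_add smult_l_distr)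
  thus ?thesis by (simp add: unit_inj)
qed

lemma augmentation_smult:
  assumes "x \<in> carrier N"
  shows "augmentation N (c \<odot> x) = c * augmentation N x"
proof -
  have "augmentation N (c \<odot> x) \<odot> \<one> = (c * augmentation N x) \<odot> \<one>"
    using assms by (simp add: augmentation_eq homog_part_smult smult_assoc)
  thus ?thesis by (simp add: unit_inj)
qed

lemma finsum_in_high:
  assumes "finite Z" "\<And>k. f k \<in> homog N k" "\<And>k. k \<in> Z \<Longrightarrow> int n \<le> k"
  shows "finsum N f Z \<in> high N n"
  using assms(1,3)
proof (induction Z rule: finite_induct)
  case (insert k F)
  have "f \<in> F \<rightarrow> carrier N" "f k \<in> carrier N" using homog_closed[OF assms(2)] by auto
  moreover have "f k \<in> high N n" using insert.prems by (intro high.homog[OF assms(2)]) auto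
  moreover have "finsum N f F \<in> high N n" using insert by auto
  ultimately show ?case using insert.hyps by (simp add: high.add)
qed (simp add: high.zero)

text \<open>
  A connected algebra has nothing in negative degrees and only scalars in degree 0, so removing the
  degree-zero component leaves components of positive degree only.
\<close>

lemma augmentation_decomp:
  assumes "x \<in> carrier N"
  obtains y where "y \<in> high N 1" "x = augmentation N x \<odot> \<one> \<oplus> y"
proof -
  let ?f = "\<lambda>n. homog_part N n x"
  let ?P = "{n \<in> support x. 0 < n}"
  have neg: "?f n = \<zero>" if "n < 0" for n
    using that connected homog_part_in[OF assms, of n] by (simp add: connected_graded_def)
  have "n = 0 \<or> 0 < n" if "?f n \<noteq> \<zero>" for n using neg[of n] that by linarith
  hence "finsum N ?f (insert 0 ?P) = x"
    using assms finite_support by (intro finsum_homog_part) auto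
  moreover have "finsum N ?f (insert 0 ?P) = ?f 0 \<oplus> finsum N ?f ?P"
    using assms finite_support homog_part_closed by (intro finsum_insert) auto
  ultimately have "augmentation N x \<odot> \<one> \<oplus> finsum N ?f ?P = x"
    using augmentation_eq[OF assms] by simp
  note decomp = this[symmetric]
  show ?thesis
    by (rule that[OF _ decomp]) (use assms finite_support homog_part_in in \<open>auto intro: finsum_in_high\<close>)
qed

lemma high_Suc_subset: "x \<in> high N (Suc n) \<Longrightarrow> x \<in> high N n"
  by (induction rule: high.induct) (auto intro: high.intros)

lemma high_0: "x \<in> carrier N \<Longrightarrow> x \<in> high N 0"
proof -
  assume x: "x \<in> carrier N"
  then obtain y where y: "y \<in> high N 1" "x = augmentation N x \<odot> \<one> \<oplus> y"
    by (rule augmentation_decomp)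
  have "augmentation N x \<odot> \<one> \<in> homog N 0"
    using augmentation_eq[OF x] homog_part_in[OF x] by simp
  hence "augmentation N x \<odot> \<one> \<in> high N 0" by (rule high.homog) simp
  moreover have "y \<in> high N 0" using high_Suc_subset[of y 0] y(1) by simp
  ultimately have "augmentation N x \<odot> \<one> \<oplus> y \<in> high N 0" by (rule high.add)
  thus "x \<in> high N 0" by (subst y(2))
qed

lemma high_eventually_zero:
  assumes "bounded_graded N"
  obtains n where "high N n = {\<zero>}"
proof -
  have fin: "finite {k. homog N k \<noteq> {\<zero>}}" using assms by (simp add: bounded_graded_def)
  obtain b where b: "\<And>k. homog N k \<noteq> {\<zero>} \<Longrightarrow> k \<le> b"
    using bdd_above_finite[OF fin] by (auto simp: bdd_above_def)
  have "z = \<zero>" if "z \<in> high N (nat (b + 1))" for z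
    using that
  proof (induction rule: high.induct)
    case (homog x k)
    have "\<not> k \<le> b" using homog(2) by linarith
    hence "homog N k = {\<zero>}" using b[of k] by blast
    thus ?case using homog by auto
  qed auto
  hence "high N (nat (b + 1)) = {\<zero>}" using high.zero[of N] by auto
  thus ?thesis by (rule that)
qed

end

section \<open>Nilpotents and zero divisors in the tensor product\<close>

context fp_algebra_pair
begin

definition tcong (infix \<open>\<sim>\<^sub>T\<close> 50) where "s \<sim>\<^sub>T t \<longleftrightarrow> s - t \<in> tensor_ideal"

lemma tcong_refl [simp]: "s \<sim>\<^sub>T s"
  by (simp add: tcong_def ideal_zero)

lemma tcong_sym: "s \<sim>\<^sub>T t \<Longrightarrow> t \<sim>\<^sub>T s"
  using ideal_uminus[of "s - t"] by (simp add: tcong_def)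

lemma tcong_trans [trans]: "\<lbrakk>r \<sim>\<^sub>T s; s \<sim>\<^sub>T t\<rbrakk> \<Longrightarrow> r \<sim>\<^sub>T t"
  using ideal_add[of "r - s" "s - t"] by (simp add: tcong_def)

lemma tcong_add: "\<lbrakk>s \<sim>\<^sub>T t; s' \<sim>\<^sub>T t'\<rbrakk> \<Longrightarrow> s + s' \<sim>\<^sub>T t + t'"
  using ideal_add[of "s - t" "s' - t'"] by (simp add: tcong_def algebra_simps)

lemma tcong_sum: "(\<And>i. i \<in> Z \<Longrightarrow> f i \<sim>\<^sub>T g i) \<Longrightarrow> (\<Sum>i\<in>Z. f i) \<sim>\<^sub>T (\<Sum>i\<in>Z. g i)"
  by (induction Z rule: infinite_finite_induct) (auto intro: tcong_add)

lemma tcong_ideal: "s \<sim>\<^sub>T t \<Longrightarrow> s \<in> tensor_ideal \<longleftrightarrow> t \<in> tensor_ideal"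
  using ideal_add[of "s - t" t] ideal_diff[of s "s - t"] by (auto simp: tcong_def)

lemma tcong_mult_left: "\<lbrakk>s \<sim>\<^sub>T t; r \<in> C\<rbrakk> \<Longrightarrow> r \<star> s \<sim>\<^sub>T r \<star> t"
  using T.I_l_closed[of "s - t" r] by (simp add: tcong_def pair_mult_diff_right)

lemma tcong_mult_right: "\<lbrakk>s \<sim>\<^sub>T t; r \<in> C\<rbrakk> \<Longrightarrow> s \<star> r \<sim>\<^sub>T t \<star> r"
  using T.I_r_closed[of "s - t" r] by (simp add: tcong_def pair_mult_diff_left)

lemma tcong_add_left:
  assumes "a \<in> carrier A" "a' \<in> carrier A" "b \<in> carrier B"
  shows "Poly_Mapping.single (a \<oplus>\<^bsub>A\<^esub> a', b) c \<sim>\<^sub>T Poly_Mapping.single (a, b) c + Poly_Mapping.single (a', b) c"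
  using tensor_add_left[OF assms] by (simp add: tcong_def algebra_simps)

lemma tcong_add_right:
  assumes "a \<in> carrier A" "b \<in> carrier B" "b' \<in> carrier B"
  shows "Poly_Mapping.single (a, b \<oplus>\<^bsub>B\<^esub> b') c \<sim>\<^sub>T Poly_Mapping.single (a, b) c + Poly_Mapping.single (a, b') c"
  using tensor_add_right[OF assms] by (simp add: tcong_def algebra_simps)

lemma tcong_smult_left:
  assumes "a \<in> carrier A" "b \<in> carrier B"
  shows "Poly_Mapping.single (d \<odot>\<^bsub>A\<^esub> a, b) c \<sim>\<^sub>T Poly_Mapping.single (a, b) (c * d)"
  using tensor_smult_left[OF assms] by (simp add: tcong_def)

lemma tcong_smult_right:
  assumes "a \<in> carrier A" "b \<in> carrier B"
  shows "Poly_Mapping.single (a, d \<odot>\<^bsub>B\<^esub> b) c \<sim>\<^sub>T Poly_Mapping.single (a, b) (c * d)"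
  using tensor_smult_right[OF assms] by (simp add: tcong_def)

lemma tcong_zero_right: "a \<in> carrier A \<Longrightarrow> Poly_Mapping.single (a, \<zero>\<^bsub>B\<^esub>) c \<sim>\<^sub>T 0"
  using tcong_smult_right[of a "\<zero>\<^bsub>B\<^esub>" 0 c] by simp

lemma tcong_zero_left: "b \<in> carrier B \<Longrightarrow> Poly_Mapping.single (\<zero>\<^bsub>A\<^esub>, b) c \<sim>\<^sub>T 0"
  using tcong_smult_left[of "\<zero>\<^bsub>A\<^esub>" b 0 c] by simp

lemma tcong_finsum_left:
  assumes "finite Z" "f \<in> Z \<rightarrow> carrier A" "b \<in> carrier B"
  shows "Poly_Mapping.single (finsum A f Z, b) c \<sim>\<^sub>T (\<Sum>i\<in>Z. Poly_Mapping.single (f i, b) c)"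
  using assms(1,2)
proof (induction Z rule: finite_induct)
  case (insert i Z)
  hence "Poly_Mapping.single (f i \<oplus>\<^bsub>A\<^esub> finsum A f Z, b) c \<sim>\<^sub>T
      Poly_Mapping.single (f i, b) c + Poly_Mapping.single (finsum A f Z, b) c"
    using assms(3) by (intro tcong_add_left) auto
  also have "\<dots> \<sim>\<^sub>T Poly_Mapping.single (f i, b) c + (\<Sum>i\<in>Z. Poly_Mapping.single (f i, b) c)"
    using insert by (intro tcong_add) auto
  finally show ?case using insert by simp
qed (use assms(3) tcong_zero_left in simp)

end

locale connected_pair = fp_algebra_pair A B + N: connected_fp_algebra B
  for A :: "('p::prime_card mod_ring, 'a) graded" and B :: "('p mod_ring, 'b) graded"
begin

text \<open>
  The augmentation \<open>id \<otimes> \<epsilon> : A \<otimes> B \<rightarrow> A\<close>, on representatives.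
\<close>

definition proj :: "('a \<times> 'b \<Rightarrow>\<^sub>0 'p mod_ring) \<Rightarrow> 'a"
  where "proj t = lin_ext A (\<lambda>(a, b). augmentation B b \<odot>\<^bsub>A\<^esub> a) t"

lemma proj_bilinear: "bilinear_map A (\<lambda>(a, b). augmentation B b \<odot>\<^bsub>A\<^esub> a)"
  unfolding bilinear_map_def
  by (auto simp: A.smult_r_distr A.smult_l_distr N.augmentation_add N.augmentation_smult
      mult.commute simp flip: A.smult_assoc)

lemmas proj_in = proj_bilinear[unfolded bilinear_map_def, THEN conjunct1]

lemma proj_add: "\<lbrakk>s \<in> C; t \<in> C\<rbrakk> \<Longrightarrow> proj (s + t) = proj s \<oplus>\<^bsub>A\<^esub> proj t"
  unfolding proj_def C_iff by (rule lin_ext_add[OF A.fp_module_axioms proj_in])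

lemma proj_closed: "t \<in> C \<Longrightarrow> proj t \<in> carrier A"
  unfolding proj_def C_iff by (rule lin_ext_closed[OF A.fp_module_axioms proj_in])

lemma proj_single:
  "\<lbrakk>a \<in> carrier A; b \<in> carrier B\<rbrakk> \<Longrightarrow>
    proj (Poly_Mapping.single (a, b) c) = (c * augmentation B b) \<odot>\<^bsub>A\<^esub> a"
  unfolding proj_def using lin_ext_single[OF A.fp_module_axioms proj_in, of "(a, b)" c]
  by (simp add: A.smult_assoc)

lemma proj_ideal: "t \<in> tensor_ideal \<Longrightarrow> proj t = \<zero>\<^bsub>A\<^esub>"
  unfolding proj_def by (rule lin_ext_tensor_ideal[OF A.fp_module_axioms proj_bilinear])

lemma proj_tcong:
  assumes "s \<sim>\<^sub>T t" "s \<in> C" "t \<in> C"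
  shows "proj s = proj t"
proof -
  have "proj (s - t) = \<zero>\<^bsub>A\<^esub>" using assms(1) by (intro proj_ideal) (simp add: tcong_def)
  thus ?thesis using proj_add[OF C_diff[OF assms(2,3)] assms(3)] assms(3) by (simp add: proj_closed)
qed

abbreviation Chigh where
  "Chigh n \<equiv> {t. Poly_Mapping.keys t \<subseteq> carrier A \<times> high B n}"

lemma Chigh_C: "t \<in> Chigh n \<Longrightarrow> t \<in> C"
  using N.high_closed by (auto simp: C_iff)

lemma Chigh_mult:
  assumes "s \<in> Chigh m" "t \<in> Chigh n"
  shows "s \<star> t \<in> Chigh (m + n)"
proof -
  have "Poly_Mapping.keys (s \<star> t) \<subseteq> carrier A \<times> high B (m + n)"
  proof (rule keys_pair_mult)
    fix x y assume "x \<in> Poly_Mapping.keys s" "y \<in> Poly_Mapping.keys t"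
    hence "x \<in> carrier A \<times> high B m" "y \<in> carrier A \<times> high B n" using assms by blast+
    thus "(fst x \<otimes>\<^bsub>A\<^esub> fst y, snd x \<otimes>\<^bsub>B\<^esub> snd y) \<in> carrier A \<times> high B (m + n)"
      by (auto intro: N.high_mult)
  qed
  thus ?thesis by simp
qed

lemma Chigh_zero:
  assumes "high B n = {\<zero>\<^bsub>B\<^esub>}" "t \<in> Chigh n"
  shows "t \<in> tensor_ideal"
proof -
  have "Poly_Mapping.keys t \<subseteq> carrier A \<times> {\<zero>\<^bsub>B\<^esub>}" using assms by simp
  thus ?thesis
  proof (induction t rule: poly_mapping_span_induct)
    case (single x c)
    thus ?case using tcong_zero_right[of "fst x" c] by (auto simp: tcong_def)
  qed (auto intro: ideal_zero ideal_add)
qed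

text \<open>Split each second factor into its degree-zero part and the rest.\<close>

lemma proj_decomp:
  assumes "t \<in> C"
  obtains u where "u \<in> Chigh 1" "t \<sim>\<^sub>T Poly_Mapping.single (proj t, \<one>\<^bsub>B\<^esub>) 1 + u"
proof -
  have "\<exists>u\<in>Chigh 1. t \<sim>\<^sub>T Poly_Mapping.single (proj t, \<one>\<^bsub>B\<^esub>) 1 + u"
    using assms
  proof (induction t rule: C_induct)
    case zero
    show ?case using tcong_zero_left[of "\<one>\<^bsub>B\<^esub>" 1, THEN tcong_sym]
      by (intro bexI[of _ 0]) (simp_all add: proj_def lin_ext_def)
  next
    case (single a b c)
    obtain y where y: "y \<in> high B 1" "b = augmentation B b \<odot>\<^bsub>B\<^esub> \<one>\<^bsub>B\<^esub> \<oplus>\<^bsub>B\<^esub> y"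
      by (rule N.augmentation_decomp[OF single(2)])
    have yN: "y \<in> carrier B" using y(1) by (rule N.high_closed)
    let ?e = "augmentation B b"
    have "Poly_Mapping.single (a, ?e \<odot>\<^bsub>B\<^esub> \<one>\<^bsub>B\<^esub> \<oplus>\<^bsub>B\<^esub> y) c \<sim>\<^sub>T
        Poly_Mapping.single (a, ?e \<odot>\<^bsub>B\<^esub> \<one>\<^bsub>B\<^esub>) c + Poly_Mapping.single (a, y) c"
      using single yN by (intro tcong_add_right) auto
    also have "\<dots> \<sim>\<^sub>T Poly_Mapping.single (a, \<one>\<^bsub>B\<^esub>) (c * ?e) + Poly_Mapping.single (a, y) c"
      using single by (intro tcong_add tcong_smult_right) auto
    also have "\<dots> \<sim>\<^sub>T Poly_Mapping.single ((c * ?e) \<odot>\<^bsub>A\<^esub> a, \<one>\<^bsub>B\<^esub>) 1 + Poly_Mapping.single (a, y) c"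
      using single tcong_smult_left[of a "\<one>\<^bsub>B\<^esub>" "c * ?e" 1] by (intro tcong_add) (auto intro: tcong_sym)
    finally have "Poly_Mapping.single (a, b) c \<sim>\<^sub>T
        Poly_Mapping.single (proj (Poly_Mapping.single (a, b) c), \<one>\<^bsub>B\<^esub>) 1 + Poly_Mapping.single (a, y) c"
      unfolding y(2)[symmetric] using single by (simp add: proj_single)
    thus ?case using single(1) y(1) by (intro bexI[of _ "Poly_Mapping.single (a, y) c"]) auto
  next
    case (add s t)
    then obtain u v where u: "u \<in> Chigh 1" "s \<sim>\<^sub>T Poly_Mapping.single (proj s, \<one>\<^bsub>B\<^esub>) 1 + u"
      and v: "v \<in> Chigh 1" "t \<sim>\<^sub>T Poly_Mapping.single (proj t, \<one>\<^bsub>B\<^esub>) 1 + v" by blast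
    have "s + t \<sim>\<^sub>T (Poly_Mapping.single (proj s, \<one>\<^bsub>B\<^esub>) 1 + u) + (Poly_Mapping.single (proj t, \<one>\<^bsub>B\<^esub>) 1 + v)"
      using u(2) v(2) by (rule tcong_add)
    also have "\<dots> = (Poly_Mapping.single (proj s, \<one>\<^bsub>B\<^esub>) 1 + Poly_Mapping.single (proj t, \<one>\<^bsub>B\<^esub>) 1) + (u + v)"
      by (simp add: add_ac)
    also have "\<dots> \<sim>\<^sub>T Poly_Mapping.single (proj s \<oplus>\<^bsub>A\<^esub> proj t, \<one>\<^bsub>B\<^esub>) 1 + (u + v)"
      using add proj_closed tcong_add_left[of "proj s" "proj t" "\<one>\<^bsub>B\<^esub>" 1]
      by (intro tcong_add) (auto intro: tcong_sym)
    finally show ?case using u(1) v(1) add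
      by (intro bexI[of _ "u + v"]) (simp_all add: proj_add keys_add_subset)
  qed
  thus ?thesis using that by blast
qed

text \<open>
  An element of \<open>A \<otimes> B\<close> that the augmentation kills is congruent to one with all second factors of
  positive degree; its powers run out of degrees in \<open>B\<close>.
\<close>

lemma proj_zero_nilpotent:
  assumes "bounded_graded B" "t \<in> C" "proj t = \<zero>\<^bsub>A\<^esub>"
  obtains n where "t [^]\<^bsub>pair_algebra A B\<^esub> (n::nat) \<in> tensor_ideal"
proof -
  obtain u where u: "u \<in> Chigh 1" "t \<sim>\<^sub>T Poly_Mapping.single (proj t, \<one>\<^bsub>B\<^esub>) 1 + u"
    by (rule proj_decomp[OF assms(2)])
  have "Poly_Mapping.single (proj t, \<one>\<^bsub>B\<^esub>) 1 + u \<sim>\<^sub>T 0 + u"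
    unfolding assms(3) by (intro tcong_add tcong_zero_left) auto
  hence tu: "t \<sim>\<^sub>T u" using tcong_trans[OF u(2)] by simp
  have uC: "u \<in> C" using u(1) by (rule Chigh_C)
  have pow: "t [^]\<^bsub>pair_algebra A B\<^esub> n \<sim>\<^sub>T u [^]\<^bsub>pair_algebra A B\<^esub> n" for n :: nat
  proof (induction n)
    case (Suc n)
    have "t [^]\<^bsub>pair_algebra A B\<^esub> n \<star> t \<sim>\<^sub>T u [^]\<^bsub>pair_algebra A B\<^esub> n \<star> t"
      by (rule tcong_mult_right[OF Suc assms(2)])
    also have "\<dots> \<sim>\<^sub>T u [^]\<^bsub>pair_algebra A B\<^esub> n \<star> u"
      using tu uC by (intro tcong_mult_left) (auto intro: nat_pow_closed)
    finally show ?case by simp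
  qed simp
  have high: "u [^]\<^bsub>pair_algebra A B\<^esub> n \<in> Chigh n" for n :: nat
  proof (induction n)
    case 0
    show ?case by (auto simp: pair_algebra_simps intro: N.high_0)
  next
    case (Suc n)
    show ?case using Chigh_mult[OF Suc u(1)] by simp
  qed
  obtain n where "high B n = {\<zero>\<^bsub>B\<^esub>}" by (rule N.high_eventually_zero[OF assms(1)])
  hence "u [^]\<^bsub>pair_algebra A B\<^esub> n \<in> tensor_ideal" using high by (rule Chigh_zero)
  thus ?thesis using pow tcong_ideal that by blast
qed

end

text \<open>
  Here \<open>\<Theta>\<close> embeds the first factor \<open>A\<close> into an integral domain that is a whole type.  Vector spaces on
  whole types have bases, left inverses and enough linear functionals, and the functionals restrict
  to \<open>A\<close>.
\<close>

locale domain_connected_pair = connected_pair A B + Q: vector_space sc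
  for A :: "('p::prime_card mod_ring, 'a) graded" and B :: "('p mod_ring, 'b) graded"
    and sc :: "'p mod_ring \<Rightarrow> 'q::idom \<Rightarrow> 'q" +
  fixes \<Theta> :: "'a \<Rightarrow> 'q::idom"
  assumes embed_add: "\<lbrakk>x \<in> carrier A; y \<in> carrier A\<rbrakk> \<Longrightarrow> \<Theta> (x \<oplus>\<^bsub>A\<^esub> y) = \<Theta> x + \<Theta> y"
    and embed_mult: "\<lbrakk>x \<in> carrier A; y \<in> carrier A\<rbrakk> \<Longrightarrow> \<Theta> (x \<otimes>\<^bsub>A\<^esub> y) = \<Theta> x * \<Theta> y"
    and embed_smult: "x \<in> carrier A \<Longrightarrow> \<Theta> (c \<odot>\<^bsub>A\<^esub> x) = sc c (\<Theta> x)"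
    and embed_eq_0: "\<lbrakk>x \<in> carrier A; \<Theta> x = 0\<rbrakk> \<Longrightarrow> x = \<zero>\<^bsub>A\<^esub>"
    and sc_mult: "u * sc c v = sc c (u * v)"
begin

lemma embed_zero [simp]: "\<Theta> \<zero>\<^bsub>A\<^esub> = 0"
  using embed_add[of "\<zero>\<^bsub>A\<^esub>" "\<zero>\<^bsub>A\<^esub>"] by (metis A.r_zero A.zero_closed add_cancel_left_right)

lemma embed_inj: "inj_on \<Theta> (carrier A)"
proof (rule inj_onI)
  fix x y assume xy: "x \<in> carrier A" "y \<in> carrier A" "\<Theta> x = \<Theta> y"
  have "\<Theta> (\<ominus>\<^bsub>A\<^esub> y) + \<Theta> y = 0"
    using xy embed_add[of "\<ominus>\<^bsub>A\<^esub> y" y] by (simp add: A.l_neg)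
  hence "\<Theta> (x \<oplus>\<^bsub>A\<^esub> \<ominus>\<^bsub>A\<^esub> y) = 0" using xy by (simp add: embed_add add.commute)
  hence "x \<oplus>\<^bsub>A\<^esub> \<ominus>\<^bsub>A\<^esub> y = \<zero>\<^bsub>A\<^esub>" using xy by (intro embed_eq_0) auto
  thus "x = y" using xy A.minus_equality[of x "\<ominus>\<^bsub>A\<^esub> y"] by simp
qed

lemma embed_finsum: "\<lbrakk>finite Z; f \<in> Z \<rightarrow> carrier A\<rbrakk> \<Longrightarrow> \<Theta> (finsum A f Z) = (\<Sum>i\<in>Z. \<Theta> (f i))"
  by (induction Z rule: finite_induct) (auto simp: embed_add A.finsum_closed)

definition functional :: "('q \<Rightarrow> 'p mod_ring) \<Rightarrow> bool"
  where "functional \<kappa> \<longleftrightarrow> (\<forall>x y. \<kappa> (x + y) = \<kappa> x + \<kappa> y) \<and> (\<forall>c x. \<kappa> (sc c x) = c * \<kappa> x)"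

lemma functional_zero: "functional \<kappa> \<Longrightarrow> \<kappa> 0 = 0"
  unfolding functional_def by (metis add_cancel_right_left)

lemma functional_sum: "functional \<kappa> \<Longrightarrow> \<kappa> (\<Sum>i\<in>Z. f i) = (\<Sum>i\<in>Z. \<kappa> (f i))"
  by (induction Z rule: infinite_finite_induct) (auto simp: functional_zero, auto simp: functional_def)

lemma field_vector_space: "vector_space ((*) :: 'p mod_ring \<Rightarrow> _ \<Rightarrow> _)"
  by unfold_locales (auto simp: algebra_simps)

text \<open>
  The map \<open>\<kappa> \<otimes> id : A \<otimes> B \<rightarrow> B\<close>, on representatives.
\<close>

definition contract :: "('q \<Rightarrow> 'p mod_ring) \<Rightarrow> ('a \<times> 'b \<Rightarrow>\<^sub>0 'p mod_ring) \<Rightarrow> 'b"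
  where "contract \<kappa> t = lin_ext B (\<lambda>(a, b). \<kappa> (\<Theta> a) \<odot>\<^bsub>B\<^esub> b) t"

lemma contract_bilinear:
  "functional \<kappa> \<Longrightarrow> bilinear_map B (\<lambda>(a, b). \<kappa> (\<Theta> a) \<odot>\<^bsub>B\<^esub> b)"
  unfolding bilinear_map_def functional_def
  by (auto simp: embed_add embed_smult B.smult_l_distr B.smult_r_distr B.smult_assoc
      mult.commute simp flip: B.smult_assoc)

lemmas contract_in = contract_bilinear[unfolded bilinear_map_def, THEN conjunct1]

lemma contract_add:
  "\<lbrakk>functional \<kappa>; s \<in> C; t \<in> C\<rbrakk> \<Longrightarrow> contract \<kappa> (s + t) = contract \<kappa> s \<oplus>\<^bsub>B\<^esub> contract \<kappa> t"
  unfolding contract_def C_iff by (rule lin_ext_add[OF B.fp_module_axioms contract_in])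

lemma contract_closed: "\<lbrakk>functional \<kappa>; t \<in> C\<rbrakk> \<Longrightarrow> contract \<kappa> t \<in> carrier B"
  unfolding contract_def C_iff by (rule lin_ext_closed[OF B.fp_module_axioms contract_in])

lemma contract_single:
  "\<lbrakk>functional \<kappa>; a \<in> carrier A; b \<in> carrier B\<rbrakk> \<Longrightarrow>
    contract \<kappa> (Poly_Mapping.single (a, b) c) = (c * \<kappa> (\<Theta> a)) \<odot>\<^bsub>B\<^esub> b"
  unfolding contract_def using lin_ext_single[OF B.fp_module_axioms contract_in, of \<kappa> "(a, b)" c]
  by (simp add: B.smult_assoc)

lemma contract_ideal: "\<lbrakk>functional \<kappa>; t \<in> tensor_ideal\<rbrakk> \<Longrightarrow> contract \<kappa> t = \<zero>\<^bsub>B\<^esub>"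
  unfolding contract_def by (rule lin_ext_tensor_ideal[OF B.fp_module_axioms contract_bilinear])

lemma contract_high:
  assumes "functional \<kappa>" "t \<in> Chigh n"
  shows "contract \<kappa> t \<in> high B n"
  unfolding contract_def
proof (rule lin_ext_in_subgroup[OF B.fp_module_axioms contract_in[OF assms(1)] N.high_subgroup])
  fix c x assume "x \<in> Poly_Mapping.keys t"
  hence "x \<in> carrier A \<times> high B n" using assms(2) by blast
  thus "c \<odot>\<^bsub>B\<^esub> (case x of (a, b) \<Rightarrow> \<kappa> (\<Theta> a) \<odot>\<^bsub>B\<^esub> b) \<in> high B n"
    by (auto intro: N.high_smult)
qed

text \<open>
  Multiplication by an element of the first factor is moved onto the functional.
\<close>

lemma contract_scalar_mult:
  assumes "functional \<kappa>" "a \<in> carrier A" "t \<in> C"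
  shows "contract \<kappa> (Poly_Mapping.single (a, \<one>\<^bsub>B\<^esub>) 1 \<star> t) = contract (\<lambda>x. \<kappa> (\<Theta> a * x)) t"
proof -
  have fun': "functional (\<lambda>x. \<kappa> (\<Theta> a * x))"
    using assms(1) by (simp add: functional_def distrib_left sc_mult)
  from assms(3) show ?thesis
  proof (induction t rule: C_induct)
    case zero
    show ?case by (simp add: contract_def lin_ext_def)
  next
    case (single a' b c)
    thus ?case using assms fun' by (simp add: pair_mult_single contract_single embed_mult)
  next
    case (add s t)
    have "Poly_Mapping.single (a, \<one>\<^bsub>B\<^esub>) 1 \<star> s \<in> C" "Poly_Mapping.single (a, \<one>\<^bsub>B\<^esub>) 1 \<star> t \<in> C"
      using add assms by (auto intro!: C_mult single_in_C)
    thus ?case using add assms fun' by (simp add: pair_mult_add_right contract_add)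
  qed
qed

text \<open>
  If the first factors of \<open>t\<close> lie in the span of an independent set \<open>P\<close> with dual functionals \<open>\<kappa>\<close>, then
  expanding them in terms of \<open>P\<close> and collecting gives one second factor for each element of \<open>P\<close>, and
  this factor is a contraction of \<open>t\<close>.  So the contractions of \<open>t\<close> determine its class.
\<close>

lemma tensor_expansion:
  assumes P: "finite P" "P \<subseteq> \<Theta> ` carrier A"
    and \<kappa>: "\<And>q. q \<in> P \<Longrightarrow> functional (\<kappa> q)" "\<And>q q'. \<lbrakk>q \<in> P; q' \<in> P\<rbrakk> \<Longrightarrow> \<kappa> q q' = (if q = q' then 1 else 0)"
    and t: "t \<in> C" "\<And>x. x \<in> Poly_Mapping.keys t \<Longrightarrow> \<Theta> (fst x) \<in> Q.span P"
  shows "t \<sim>\<^sub>T (\<Sum>q\<in>P. Poly_Mapping.single (the_inv_into (carrier A) \<Theta> q, contract (\<kappa> q) t) 1)"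
proof -
  let ?r = "the_inv_into (carrier A) \<Theta>"
  have r: "?r q \<in> carrier A" "\<Theta> (?r q) = q" if "q \<in> P" for q
    using that P(2) embed_inj by (auto simp: the_inv_into_f_f)
  have span: "v = (\<Sum>q\<in>P. sc (\<kappa> q v) q)" if v: "v \<in> Q.span P" for v
  proof -
    obtain u where u: "v = (\<Sum>q\<in>P. sc (u q) q)" using v unfolding Q.span_finite[OF P(1)] by blast
    have "\<kappa> q v = u q" if q: "q \<in> P" for q
    proof -
      have "\<kappa> q v = (\<Sum>q'\<in>P. u q' * \<kappa> q q')"
        unfolding u functional_sum[OF \<kappa>(1)[OF q]] using \<kappa>(1)[OF q] by (simp add: functional_def)
      also have "\<dots> = (\<Sum>q'\<in>P. if q' = q then u q else 0)" using \<kappa>(2)[OF q] by (intro sum.cong) auto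
      finally show ?thesis using q P(1) by simp
    qed
    thus ?thesis using u by simp
  qed
  have "Poly_Mapping.keys t \<subseteq> {x \<in> carrier A \<times> carrier B. \<Theta> (fst x) \<in> Q.span P}"
    using t unfolding C_iff by blast
  thus ?thesis
  proof (induction t rule: poly_mapping_span_induct)
    case zero
    have "(\<Sum>q\<in>P. Poly_Mapping.single (?r q, \<zero>\<^bsub>B\<^esub>) (1 :: 'p mod_ring)) \<sim>\<^sub>T (\<Sum>q\<in>P. 0)"
      by (rule tcong_sum, rule tcong_zero_right, rule r(1))
    from tcong_sym[OF this] show ?case by (simp add: contract_def lin_ext_def)
  next
    case (single x c)
    then obtain a b where ab: "x = (a, b)" "a \<in> carrier A" "b \<in> carrier B" "\<Theta> a \<in> Q.span P"
      by (cases x) auto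
    define k where "k q = \<kappa> q (\<Theta> a)" for q
    have f: "(\<lambda>q. k q \<odot>\<^bsub>A\<^esub> ?r q) \<in> P \<rightarrow> carrier A" using r by auto
    have "\<Theta> a = (\<Sum>q\<in>P. sc (k q) q)" unfolding k_def by (rule span[OF ab(4)])
    also have "\<dots> = \<Theta> (\<Oplus>\<^bsub>A\<^esub>q\<in>P. k q \<odot>\<^bsub>A\<^esub> ?r q)"
      using r unfolding embed_finsum[OF P(1) f] by (intro sum.cong) (simp_all add: embed_smult)
    finally have a: "a = (\<Oplus>\<^bsub>A\<^esub>q\<in>P. k q \<odot>\<^bsub>A\<^esub> ?r q)"
      by (rule inj_onD[OF embed_inj]) (use ab f in \<open>auto intro: A.finsum_closed\<close>)
    have "Poly_Mapping.single (\<Oplus>\<^bsub>A\<^esub>q\<in>P. k q \<odot>\<^bsub>A\<^esub> ?r q, b) c \<sim>\<^sub>T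
        (\<Sum>q\<in>P. Poly_Mapping.single (k q \<odot>\<^bsub>A\<^esub> ?r q, b) c)"
      by (rule tcong_finsum_left[OF P(1) f ab(3)])
    also have "\<dots> \<sim>\<^sub>T (\<Sum>q\<in>P. Poly_Mapping.single (?r q, b) (c * k q))"
      by (rule tcong_sum, rule tcong_smult_left, rule r(1), assumption, rule ab(3))
    also have "\<dots> \<sim>\<^sub>T (\<Sum>q\<in>P. Poly_Mapping.single (?r q, (c * k q) \<odot>\<^bsub>B\<^esub> b) 1)"
    proof (rule tcong_sum)
      fix q assume "q \<in> P"
      thus "Poly_Mapping.single (?r q, b) (c * k q) \<sim>\<^sub>T Poly_Mapping.single (?r q, (c * k q) \<odot>\<^bsub>B\<^esub> b) 1"
        using tcong_smult_right[of "?r q" b "c * k q" 1, THEN tcong_sym] r ab by simp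
    qed
    also have "(\<Sum>q\<in>P. Poly_Mapping.single (?r q, (c * k q) \<odot>\<^bsub>B\<^esub> b) 1) =
        (\<Sum>q\<in>P. Poly_Mapping.single (?r q, contract (\<kappa> q) (Poly_Mapping.single x c)) 1)"
      using ab \<kappa>(1) by (intro sum.cong) (simp_all add: contract_single k_def)
    finally show ?case unfolding a[symmetric] ab(1) .
  next
    case (add s t)
    have C: "s \<in> C" "t \<in> C" using add by (auto simp: C_iff)
    have "s + t \<sim>\<^sub>T (\<Sum>q\<in>P. Poly_Mapping.single (?r q, contract (\<kappa> q) s) 1) +
        (\<Sum>q\<in>P. Poly_Mapping.single (?r q, contract (\<kappa> q) t) 1)"
      by (rule tcong_add[OF add(3,4)])
    also have "\<dots> = (\<Sum>q\<in>P. Poly_Mapping.single (?r q, contract (\<kappa> q) s) 1 +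
        Poly_Mapping.single (?r q, contract (\<kappa> q) t) 1)" by (simp add: sum.distrib)
    also have "\<dots> \<sim>\<^sub>T (\<Sum>q\<in>P. Poly_Mapping.single (?r q, contract (\<kappa> q) s \<oplus>\<^bsub>B\<^esub> contract (\<kappa> q) t) 1)"
      by (rule tcong_sum, rule tcong_sym, rule tcong_add_right)
        (simp_all add: r C contract_closed[OF \<kappa>(1)])
    also have "\<dots> = (\<Sum>q\<in>P. Poly_Mapping.single (?r q, contract (\<kappa> q) (s + t)) 1)"
      using C \<kappa>(1) by (simp add: contract_add)
    finally show ?case .
  qed
qed

text \<open>
  By induction on \<open>n\<close>, the class of \<open>w\<close> can be represented with all second factors in degrees at least
  \<open>n\<close>; for large \<open>n\<close> there are no nonzero such factors.  In the induction step, \<open>t\<close> is \<open>e \<otimes> 1\<close> up to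
  terms that raise the degree, where \<open>e = proj t\<close>.  So \<open>t w = 0\<close> says that \<open>(e \<otimes> 1) w\<close> has degree at
  least \<open>n + 1\<close>.  Multiplication by \<open>e\<close> has a linear left inverse \<open>g\<close>, since \<open>e \<noteq> 0\<close> in a domain.
  Contracting with \<open>\<kappa> \<circ> g\<close> cancels \<open>e\<close>, so every contraction of \<open>w\<close> has degree at least \<open>n + 1\<close>, and
  then \<open>w\<close> has a representative of that degree, namely its expansion.
\<close>

lemma proj_nonzero_divisor:
  assumes "bounded_graded B" "t \<in> C" "w \<in> C" "t \<star> w \<in> tensor_ideal" "proj t \<noteq> \<zero>\<^bsub>A\<^esub>"
  shows "w \<in> tensor_ideal"
proof -
  interpret VK: vector_space "(*) :: 'p mod_ring \<Rightarrow> _ \<Rightarrow> _" by (rule field_vector_space)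
  interpret QQ: vector_space_pair sc sc ..
  interpret QK: vector_space_pair sc "(*) :: 'p mod_ring \<Rightarrow> _ \<Rightarrow> _" ..
  let ?e = "proj t"
  have e: "?e \<in> carrier A" by (rule proj_closed[OF assms(2)])
  have "\<Theta> ?e \<noteq> 0" using embed_eq_0[OF e] assms(5) by blast
  moreover have "Vector_Spaces.linear sc sc (\<lambda>x. \<Theta> ?e * x)"
    by unfold_locales (simp_all add: distrib_left sc_mult)
  ultimately obtain g where g: "Vector_Spaces.linear sc sc g" "g \<circ> (\<lambda>x. \<Theta> ?e * x) = id"
    using QQ.linear_injective_left_inverse[of "\<lambda>x. \<Theta> ?e * x"] by (auto simp: inj_def)
  have gid: "g (\<Theta> ?e * x) = x" for x using fun_cong[OF g(2), of x] by simp
  have glin: "g (x + y) = g x + g y" "g (sc c x) = sc c (g x)" for c x y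
    using g(1) by (simp_all add: QQ.linear_add QQ.linear_scale)
  obtain u where u: "u \<in> Chigh 1" "t \<sim>\<^sub>T Poly_Mapping.single (?e, \<one>\<^bsub>B\<^esub>) 1 + u"
    by (rule proj_decomp[OF assms(2)])
  have "\<exists>w'\<in>Chigh n. w \<sim>\<^sub>T w'" for n
  proof (induction n)
    case 0
    show ?case using assms(3) N.high_0 by (intro bexI[of _ w]) (auto simp: C_iff)
  next
    case (Suc n)
    then obtain w' where w': "w' \<in> Chigh n" "w \<sim>\<^sub>T w'" by blast
    have w'C: "w' \<in> C" using w'(1) by (rule Chigh_C)
    have "t \<star> w \<sim>\<^sub>T t \<star> w'" by (rule tcong_mult_left[OF w'(2) assms(2)])
    also have "\<dots> \<sim>\<^sub>T (Poly_Mapping.single (?e, \<one>\<^bsub>B\<^esub>) 1 + u) \<star> w'" by (rule tcong_mult_right[OF u(2) w'C])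
    finally have I: "Poly_Mapping.single (?e, \<one>\<^bsub>B\<^esub>) 1 \<star> w' + u \<star> w' \<in> tensor_ideal"
      using assms(4) tcong_ideal by (simp add: pair_mult_add_left)
    have uw: "u \<star> w' \<in> Chigh (Suc n)" using Chigh_mult[OF u(1) w'(1)] by simp
    have ew: "Poly_Mapping.single (?e, \<one>\<^bsub>B\<^esub>) 1 \<star> w' \<in> C"
      using e w'C by (auto intro!: C_mult single_in_C)
    have high: "contract \<kappa> w' \<in> high B (Suc n)" if \<kappa>: "functional \<kappa>" for \<kappa>
    proof -
      \<comment> \<open>Contract \<open>(e \<otimes> 1) w' + u w' = 0\<close> with \<open>\<kappa> \<circ> g\<close>; the second term stays in high degree.\<close>
      have \<kappa>g: "functional (\<lambda>x. \<kappa> (g x))" using \<kappa> by (simp add: functional_def glin)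
      have "contract (\<lambda>x. \<kappa> (g x)) (Poly_Mapping.single (?e, \<one>\<^bsub>B\<^esub>) 1 \<star> w') = contract \<kappa> w'"
        using contract_scalar_mult[OF \<kappa>g e w'C] by (simp add: gid)
      hence "contract \<kappa> w' \<oplus>\<^bsub>B\<^esub> contract (\<lambda>x. \<kappa> (g x)) (u \<star> w') = \<zero>\<^bsub>B\<^esub>"
        using contract_ideal[OF \<kappa>g I] contract_add[OF \<kappa>g ew Chigh_C[OF uw]] by simp
      hence "contract \<kappa> w' = \<ominus>\<^bsub>B\<^esub> contract (\<lambda>x. \<kappa> (g x)) (u \<star> w')"
        using contract_closed[OF \<kappa> w'C] contract_closed[OF \<kappa>g Chigh_C[OF uw]]
        by (intro B.minus_equality[symmetric]) auto
      thus ?thesis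
        using additive_subgroup.a_inv_closed[OF N.high_subgroup contract_high[OF \<kappa>g uw]] by simp
    qed
    \<comment> \<open>A basis of the span of the first factors in \<open>w'\<close>, for the expansion of \<open>w'\<close>.\<close>
    let ?S = "(\<lambda>x. \<Theta> (fst x)) ` Poly_Mapping.keys w'"
    obtain P where P: "P \<subseteq> ?S" "Q.independent P" "?S \<subseteq> Q.span P"
      using Q.maximal_independent_subset[of ?S] by blast
    have finP: "finite P" using P(1) by (rule finite_subset) simp
    have PA: "P \<subseteq> \<Theta> ` carrier A" using P(1) w'C by (fastforce simp: C_iff)
    have "\<exists>\<kappa>. functional \<kappa> \<and> (\<forall>q'\<in>P. \<kappa> q' = (if q = q' then 1 else 0))" for q
    proof -
      obtain \<kappa> where "Vector_Spaces.linear sc (*) \<kappa>" "\<forall>q'\<in>P. \<kappa> q' = (if q = q' then 1 else 0)"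
        using QK.linear_independent_extend[OF P(2), of "\<lambda>q'. if q = q' then 1 else 0"] by blast
      thus ?thesis by (intro exI[of _ \<kappa>]) (simp add: functional_def QK.linear_add QK.linear_scale)
    qed
    then obtain \<kappa> where \<kappa>: "\<And>q. functional (\<kappa> q)" "\<And>q q'. q' \<in> P \<Longrightarrow> \<kappa> q q' = (if q = q' then 1 else 0)"
      by metis
    let ?w = "\<Sum>q\<in>P. Poly_Mapping.single (the_inv_into (carrier A) \<Theta> q, contract (\<kappa> q) w') (1 :: 'p mod_ring)"
    have "w' \<sim>\<^sub>T ?w"
      using finP PA \<kappa> w'C P(3) by (intro tensor_expansion) auto
    hence "w \<sim>\<^sub>T ?w" using tcong_trans[OF w'(2)] by blast
    moreover have "?w \<in> Chigh (Suc n)"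
    proof -
      have "Poly_Mapping.keys (Poly_Mapping.single (the_inv_into (carrier A) \<Theta> q, contract (\<kappa> q) w')
          (1 :: 'p mod_ring)) \<subseteq> carrier A \<times> high B (Suc n)" if "q \<in> P" for q
        using that PA high[OF \<kappa>(1)] embed_inj by (auto simp: the_inv_into_f_f)
      thus ?thesis using finP
      proof (induction P rule: infinite_finite_induct)
        case (insert q P)
        thus ?case by (simp add: keys_add_subset)
      qed auto
    qed
    ultimately show ?case by blast
  qed
  moreover obtain n where "high B n = {\<zero>\<^bsub>B\<^esub>}" by (rule N.high_eventually_zero[OF assms(1)])
  ultimately show ?thesis using Chigh_zero tcong_ideal by blast
qed

end

section \<open>Evaluation of polynomials\<close>

definition mono_eval :: "('x \<Rightarrow> ('y \<Rightarrow>\<^sub>0 nat) \<Rightarrow>\<^sub>0 'k::field) \<Rightarrow> ('x \<Rightarrow>\<^sub>0 nat) \<Rightarrow> ('y \<Rightarrow>\<^sub>0 nat) \<Rightarrow>\<^sub>0 'k"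
  where "mono_eval v m = (\<Prod>f\<in>Poly_Mapping.keys m. v f ^ Poly_Mapping.lookup m f)"

definition poly_eval :: "('x \<Rightarrow> ('y \<Rightarrow>\<^sub>0 nat) \<Rightarrow>\<^sub>0 'k::field) \<Rightarrow> (('x \<Rightarrow>\<^sub>0 nat) \<Rightarrow>\<^sub>0 'k) \<Rightarrow> ('y \<Rightarrow>\<^sub>0 nat) \<Rightarrow>\<^sub>0 'k"
  where "poly_eval v q =
    (\<Sum>m\<in>Poly_Mapping.keys q. Poly_Mapping.single 0 (Poly_Mapping.lookup q m) * mono_eval v m)"

lemma mono_eval_superset:
  "\<lbrakk>finite Z; Poly_Mapping.keys m \<subseteq> Z\<rbrakk> \<Longrightarrow> mono_eval v m = (\<Prod>f\<in>Z. v f ^ Poly_Mapping.lookup m f)"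
  unfolding mono_eval_def by (rule prod.mono_neutral_left) (auto simp: in_keys_iff)

lemma mono_eval_add: "mono_eval v (m + n) = mono_eval v m * mono_eval v n"
proof -
  let ?Z = "Poly_Mapping.keys m \<union> Poly_Mapping.keys n"
  have "Poly_Mapping.keys (m + n) \<subseteq> ?Z" by (rule keys_add)
  thus ?thesis
    by (simp add: mono_eval_superset[of ?Z] lookup_add power_add prod.distrib)
qed

lemma poly_eval_superset:
  "\<lbrakk>finite Z; Poly_Mapping.keys q \<subseteq> Z\<rbrakk> \<Longrightarrow>
    poly_eval v q = (\<Sum>m\<in>Z. Poly_Mapping.single 0 (Poly_Mapping.lookup q m) * mono_eval v m)"
  unfolding poly_eval_def by (rule sum.mono_neutral_left) (auto simp: in_keys_iff)

lemma poly_eval_zero [simp]: "poly_eval v 0 = 0"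
  by (simp add: poly_eval_def)

lemma poly_eval_single: "poly_eval v (Poly_Mapping.single m c) = Poly_Mapping.single 0 c * mono_eval v m"
  by (subst poly_eval_superset[of "{m}"]) auto

lemma poly_eval_add: "poly_eval v (q + r) = poly_eval v q + poly_eval v r"
proof -
  let ?Z = "Poly_Mapping.keys q \<union> Poly_Mapping.keys r"
  have "Poly_Mapping.keys (q + r) \<subseteq> ?Z" by (rule keys_add)
  thus ?thesis
    by (simp add: poly_eval_superset[of ?Z] lookup_add single_add distrib_right sum.distrib)
qed

lemma poly_eval_diff: "poly_eval v (q - r) = poly_eval v q - poly_eval v r"
  using poly_eval_add[of v "q - r" r] by (simp add: eq_diff_eq)

lemma single_0_mult:
  "Poly_Mapping.single (0 :: 'm::comm_monoid_add) (c * d :: 'k::field) =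
    Poly_Mapping.single 0 c * Poly_Mapping.single 0 d"
  by (simp add: mult_single)

lemma poly_eval_mult: "poly_eval v (q * r) = poly_eval v q * poly_eval v r"
proof (induction q rule: poly_mapping_span_induct[OF subset_UNIV, case_names zero single add])
  case (single m c)
  show ?case
  proof (induction r rule: poly_mapping_span_induct[OF subset_UNIV, case_names zero single add])
    case (single n d)
    show ?case by (simp add: poly_eval_single mult_single[of m c n d] single_0_mult mono_eval_add mult_ac)
  qed (simp_all add: poly_eval_add distrib_left)
qed (simp_all add: poly_eval_add distrib_right)

lemma poly_eval_const [simp]: "poly_eval v (Poly_Mapping.single 0 c) = Poly_Mapping.single 0 c"
  by (simp add: poly_eval_single mono_eval_def)

lemma poly_eval_var: "poly_eval v (Poly_Mapping.single (Poly_Mapping.single f 1) 1) = v f"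
  by (simp add: poly_eval_single mono_eval_def)

lemma poly_eval_sum: "poly_eval v (\<Sum>i\<in>Z. q i) = (\<Sum>i\<in>Z. poly_eval v (q i))"
  by (induction Z rule: infinite_finite_induct) (auto simp: poly_eval_add)

text \<open>
  Polynomials in the variables from \<open>S\<close> are generated as a ring by constants and variables; this
  reduces comparisons of ring homomorphisms to the variables.
\<close>

lemma polynomial_induct [consumes 1, case_names const var add mult]:
  fixes q :: "('x \<Rightarrow>\<^sub>0 nat) \<Rightarrow>\<^sub>0 'k::field"
  assumes "\<forall>m\<in>Poly_Mapping.keys q. Poly_Mapping.keys m \<subseteq> S"
    and const: "\<And>c. P (Poly_Mapping.single 0 c)"
    and var: "\<And>f. f \<in> S \<Longrightarrow> P (Poly_Mapping.single (Poly_Mapping.single f 1) 1)"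
    and add: "\<And>q r. \<lbrakk>P q; P r\<rbrakk> \<Longrightarrow> P (q + r)"
    and mult: "\<And>q r. \<lbrakk>P q; P r\<rbrakk> \<Longrightarrow> P (q * r)"
  shows "P q"
proof -
  have pow: "P (Poly_Mapping.single (Poly_Mapping.single f n) c)" if "f \<in> S" for f c n
  proof (induction n)
    case (Suc n)
    have "Poly_Mapping.single (Poly_Mapping.single f (Suc n)) c =
        Poly_Mapping.single (Poly_Mapping.single f 1) 1 * Poly_Mapping.single (Poly_Mapping.single f n) c"
      by (simp add: mult_single flip: single_add)
    thus ?case using mult[OF var[OF that] Suc] by simp
  qed (simp add: const)
  have mono: "P (Poly_Mapping.single m c)" if "Poly_Mapping.keys m \<subseteq> S" for m c
    using that
  proof (induction m arbitrary: c rule: poly_mapping_span_induct)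
    case (add m n)
    have "P (Poly_Mapping.single m 1 * Poly_Mapping.single n c)" using add by (intro mult)
    thus ?case by (simp add: mult_single)
  qed (simp_all add: const pow)
  have "Poly_Mapping.keys q \<subseteq> {m. Poly_Mapping.keys m \<subseteq> S}" using assms(1) by auto
  thus ?thesis
    by (induction q rule: poly_mapping_span_induct) (use const[of 0] in \<open>simp_all add: mono add\<close>)
qed

section \<open>The symmetric algebra as a subring of a polynomial ring\<close>

lemma dual_poly_algebra_simps:
  "carrier (dual_poly_algebra scale V) =
    {q. \<forall>m\<in>Poly_Mapping.keys q. Poly_Mapping.keys m \<subseteq> dual scale V}"
  "monoid.mult (dual_poly_algebra scale V) = (*)" "\<one>\<^bsub>dual_poly_algebra scale V\<^esub> = 1"
  "\<zero>\<^bsub>dual_poly_algebra scale V\<^esub> = 0" "ring.add (dual_poly_algebra scale V) = (+)"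
  "module.smult (dual_poly_algebra scale V) = (\<lambda>c q. Poly_Mapping.single 0 c * q)"
  by (simp_all add: dual_poly_algebra_def Let_def)

context
  fixes scale :: "'p::prime_card mod_ring \<Rightarrow> 'w::ab_group_add \<Rightarrow> 'w" and V :: "'w set"
begin

abbreviation (input) D where "D \<equiv> dual_poly_algebra scale V"

lemma dual_poly_add: "\<lbrakk>q \<in> carrier D; r \<in> carrier D\<rbrakk> \<Longrightarrow> q + r \<in> carrier D"
  using keys_add[of q r] by (auto simp: dual_poly_algebra_simps)

lemma dual_poly_uminus: "q \<in> carrier D \<Longrightarrow> - q \<in> carrier D"
  by (simp add: dual_poly_algebra_simps keys_def)

lemma dual_poly_diff: "\<lbrakk>q \<in> carrier D; r \<in> carrier D\<rbrakk> \<Longrightarrow> q - r \<in> carrier D"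
  using dual_poly_add[OF _ dual_poly_uminus] by fastforce

lemma dual_poly_mult: "\<lbrakk>q \<in> carrier D; r \<in> carrier D\<rbrakk> \<Longrightarrow> q * r \<in> carrier D"
proof -
  assume "q \<in> carrier D" "r \<in> carrier D"
  hence qr: "\<And>m. m \<in> Poly_Mapping.keys q \<Longrightarrow> Poly_Mapping.keys m \<subseteq> dual scale V"
    "\<And>m. m \<in> Poly_Mapping.keys r \<Longrightarrow> Poly_Mapping.keys m \<subseteq> dual scale V"
    by (auto simp: dual_poly_algebra_simps)
  have "Poly_Mapping.keys k \<subseteq> dual scale V" if k: "k \<in> Poly_Mapping.keys (q * r)" for k
  proof -
    obtain m n where "k = m + n" "m \<in> Poly_Mapping.keys q" "n \<in> Poly_Mapping.keys r"
      using subsetD[OF keys_mult k] by blast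
    thus ?thesis using keys_add_subset[OF qr(1) qr(2)] by simp
  qed
  thus ?thesis by (auto simp: dual_poly_algebra_simps)
qed

lemma dual_poly_const: "Poly_Mapping.single 0 c \<in> carrier D"
  by (simp add: dual_poly_algebra_simps)

lemma dual_poly_one: "1 \<in> carrier D"
  using dual_poly_const[of 1] by simp

lemma dual_poly_var: "f \<in> dual scale V \<Longrightarrow> var f \<in> carrier D"
  by (simp add: dual_poly_algebra_simps var_def)

lemma dual_poly_sum: "(\<And>i. i \<in> Z \<Longrightarrow> q i \<in> carrier D) \<Longrightarrow> (\<Sum>i\<in>Z. q i) \<in> carrier D"
  using dual_poly_const[of 0]
  by (induction Z rule: infinite_finite_induct) (auto intro: dual_poly_add)

lemma ring_dual_poly: "ring D"
proof (rule ringI)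
  show "abelian_group D"
  proof (rule abelian_groupI)
    fix q assume "q \<in> carrier D"
    thus "\<exists>r\<in>carrier D. r \<oplus>\<^bsub>D\<^esub> q = \<zero>\<^bsub>D\<^esub>"
      by (intro bexI[of _ "- q"] dual_poly_uminus) (simp_all add: dual_poly_algebra_simps(2-))
  next
    show "\<zero>\<^bsub>D\<^esub> \<in> carrier D" by (simp add: dual_poly_algebra_simps)
  qed (simp_all add: dual_poly_algebra_simps(2-) dual_poly_add add_ac)
  show "Group.monoid D"
    by (rule monoidI)
      (simp_all add: dual_poly_algebra_simps(2-) dual_poly_mult dual_poly_one mult_ac)
qed (simp_all add: dual_poly_algebra_simps(2-) algebra_simps)

lemma fp_algebra_dual_poly: "fp_algebra D"
proof (intro fp_algebra.intro fp_module.intro fp_module_axioms.intro fp_algebra_axioms.intro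
    ring_dual_poly ring.is_abelian_group[OF ring_dual_poly])
  fix q and c d :: "'p mod_ring"
  show "(c * d) \<odot>\<^bsub>D\<^esub> q = c \<odot>\<^bsub>D\<^esub> (d \<odot>\<^bsub>D\<^esub> q)"
    by (simp add: dual_poly_algebra_simps(2-) mult_single flip: mult.assoc)
qed (simp_all add: dual_poly_algebra_simps(2-) dual_poly_mult dual_poly_const single_add algebra_simps)

lemma dual_add: "\<lbrakk>f \<in> dual scale V; g \<in> dual scale V\<rbrakk> \<Longrightarrow> (\<lambda>x. f x + g x) \<in> dual scale V"
  by (auto simp: dual_def algebra_simps)

lemma dual_smult: "f \<in> dual scale V \<Longrightarrow> (\<lambda>x. c * f x) \<in> dual scale V"
  by (auto simp: dual_def algebra_simps)

lemma sym_relation_add: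
  "\<lbrakk>f \<in> dual scale V; g \<in> dual scale V\<rbrakk> \<Longrightarrow> var (\<lambda>x. f x + g x) - var f - var g \<in> sym_relations scale V"
  by (auto simp: sym_relations_def)

lemma sym_relation_smult:
  "f \<in> dual scale V \<Longrightarrow> var (\<lambda>x. c * f x) - Poly_Mapping.single 0 c * var f \<in> sym_relations scale V"
  by (auto simp: sym_relations_def)

lemma sym_relations_subset: "sym_relations scale V \<subseteq> carrier D"
  unfolding sym_relations_def
  by (auto intro!: dual_poly_diff dual_poly_mult dual_poly_var dual_poly_const dual_add dual_smult)

lemma ideal_sym: "ideal (sym_ideal scale V) D"
  unfolding sym_ideal_def by (rule ring.genideal_ideal[OF ring_dual_poly sym_relations_subset])

lemma fp_algebra_sym_algebra: "fp_algebra (sym_algebra scale V)"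
  unfolding sym_algebra_def by (rule fp_algebra_graded_quot(1)[OF fp_algebra_dual_poly ideal_sym])

lemma sym_ideal_closed:
  shows sym_ideal_zero: "0 \<in> sym_ideal scale V"
    and sym_ideal_add: "\<lbrakk>q \<in> sym_ideal scale V; r \<in> sym_ideal scale V\<rbrakk> \<Longrightarrow> q + r \<in> sym_ideal scale V"
    and sym_ideal_mult_left: "\<lbrakk>q \<in> sym_ideal scale V; r \<in> carrier D\<rbrakk> \<Longrightarrow> r * q \<in> sym_ideal scale V"
    and sym_ideal_relation: "q \<in> sym_relations scale V \<Longrightarrow> q \<in> sym_ideal scale V"
proof -
  interpret ideal "sym_ideal scale V" D by (rule ideal_sym)
  show "0 \<in> sym_ideal scale V" using additive_subgroup.zero_closed[OF additive_subgroup_axioms]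
    by (simp add: dual_poly_algebra_simps)
  show "\<lbrakk>q \<in> sym_ideal scale V; r \<in> sym_ideal scale V\<rbrakk> \<Longrightarrow> q + r \<in> sym_ideal scale V"
    using additive_subgroup.a_closed[OF additive_subgroup_axioms] by (simp add: dual_poly_algebra_simps)
  show "\<lbrakk>q \<in> sym_ideal scale V; r \<in> carrier D\<rbrakk> \<Longrightarrow> r * q \<in> sym_ideal scale V"
    using I_l_closed[of q r] by (simp add: dual_poly_algebra_simps(2-))
  show "q \<in> sym_relations scale V \<Longrightarrow> q \<in> sym_ideal scale V"
    unfolding sym_ideal_def using genideal_self[OF sym_relations_subset] by blast
qed

text \<open>
  The defining relations say that \<^const>\<open>var\<close> is linear modulo \<^const>\<open>sym_ideal\<close>.  Applied to a dual
  basis, this expresses every variable by finitely many.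
\<close>

lemma var_linear_combination:
  assumes "finite Z" "\<And>b. b \<in> Z \<Longrightarrow> e b \<in> dual scale V"
  shows "var (\<lambda>x. \<Sum>b\<in>Z. c b * e b x) - (\<Sum>b\<in>Z. Poly_Mapping.single 0 (c b) * var (e b))
    \<in> sym_ideal scale V"
  using assms
proof (induction Z rule: finite_induct)
  case empty
  have "(\<lambda>x. 0) \<in> dual scale V" by (simp add: dual_def)
  from sym_relation_smult[OF this, of 0]
  have "var (\<lambda>x. 0) - Poly_Mapping.single 0 0 * var (\<lambda>x. 0) \<in> sym_relations scale V" by simp
  thus ?case using sym_ideal_relation by force
next
  case (insert b Z)
  let ?g = "\<lambda>x. \<Sum>b\<in>Z. c b * e b x" and ?s = "\<Sum>b\<in>Z. Poly_Mapping.single 0 (c b) * var (e b)"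
  have g: "?g \<in> dual scale V"
    using insert.prems by (auto simp: dual_def sum_distrib_left algebra_simps sum.distrib)
  have e: "e b \<in> dual scale V" using insert.prems by simp
  have "var (\<lambda>x. c b * e b x + ?g x) - var (\<lambda>x. c b * e b x) - var ?g \<in> sym_relations scale V"
    by (rule sym_relation_add[OF dual_smult[OF e] g])
  moreover have "var (\<lambda>x. c b * e b x) - Poly_Mapping.single 0 (c b) * var (e b) \<in> sym_relations scale V"
    by (rule sym_relation_smult[OF e])
  moreover have "var ?g - ?s \<in> sym_ideal scale V" using insert by auto
  ultimately have "(var (\<lambda>x. c b * e b x + ?g x) - var (\<lambda>x. c b * e b x) - var ?g) +
      ((var (\<lambda>x. c b * e b x) - Poly_Mapping.single 0 (c b) * var (e b)) + (var ?g - ?s)) \<in> sym_ideal scale V"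
    by (intro sym_ideal_add[OF sym_ideal_relation sym_ideal_add[OF sym_ideal_relation]])
  thus ?case using insert.hyps by (simp add: algebra_simps)
qed

end

text \<open>
  Let \<open>B\<close> be a basis of \<open>V\<close>.  The symmetric algebra is the polynomial ring on the dual basis: \<open>subst\<close>
  replaces the variable of a functional \<open>f\<close> by \<open>\<Sum>b\<in>B. f b * x\<^sub>b\<close> and kills the relations, while \<open>lift\<close>
  sends \<open>x\<^sub>b\<close> to the variable of the coordinate functional at \<open>b\<close>.  As \<open>lift \<circ> subst\<close> is the identity
  modulo the relations, nothing else is killed.  The new variables are natural numbers,
  whose order gives a monomial order and with it the absence of zero divisors.
\<close>

theorem sym_algebra_embedding:
  fixes scale :: "'p::prime_card mod_ring \<Rightarrow> 'w::ab_group_add \<Rightarrow> 'w"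
  assumes "finite_dimensional_vector_space scale Basis" "Modules.module.subspace scale V"
  shows "\<exists>\<Theta> :: ('p mod_ring, 'w) sym \<Rightarrow> (nat \<Rightarrow>\<^sub>0 nat) \<Rightarrow>\<^sub>0 'p mod_ring.
    (\<forall>x\<in>carrier (sym_algebra scale V). \<forall>y\<in>carrier (sym_algebra scale V).
      \<Theta> (x \<oplus>\<^bsub>sym_algebra scale V\<^esub> y) = \<Theta> x + \<Theta> y \<and>
      \<Theta> (x \<otimes>\<^bsub>sym_algebra scale V\<^esub> y) = \<Theta> x * \<Theta> y) \<and>
    (\<forall>x\<in>carrier (sym_algebra scale V).
      (\<forall>c. \<Theta> (c \<odot>\<^bsub>sym_algebra scale V\<^esub> x) = Poly_Mapping.single 0 c * \<Theta> x) \<and>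
      (\<Theta> x = 0 \<longrightarrow> x = \<zero>\<^bsub>sym_algebra scale V\<^esub>))"
proof -
  interpret vs: finite_dimensional_vector_space scale Basis by fact
  let ?D = "dual_poly_algebra scale V" and ?I = "sym_ideal scale V"
  interpret I: ideal ?I ?D by (rule ideal_sym)
  obtain B where B: "B \<subseteq> V" "vs.independent B" "V \<subseteq> vs.span B" "card B = vs.dim V"
    by (rule vs.basis_exists)
  have spanB: "vs.span B = V"
    using B assms(2) by (intro antisym vs.span_minimal) auto
  have finB: "finite B" by (rule vs.finiteI_independent[OF B(2)])
  obtain idx :: "'w \<Rightarrow> nat" where idx: "inj_on idx B"
    using finite_imp_inj_to_nat_seg[OF finB] by blast
  define co where "co b = (\<lambda>v. vs.representation B v b)" for b
  have co_outside: "co b v = 0" if "v \<notin> V" for b v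
    using that unfolding co_def vs.representation_def spanB by simp
  have co: "co b \<in> dual scale V" for b
    using co_outside[of _ b] B(2) spanB
    by (auto simp: dual_def co_def vs.representation_add vs.representation_scale)
  \<comment> \<open>The restriction of \<open>f\<close> to \<open>B\<close> gives its coefficients; outside \<open>V\<close> both sides vanish by convention.\<close>
  have coords: "f = (\<lambda>x. \<Sum>b\<in>B. f b * co b x)" if f: "f \<in> dual scale V" for f
  proof
    fix x
    have fadd: "f (v + w) = f v + f w" if "v \<in> V" "w \<in> V" for v w using f that by (simp add: dual_def)
    have fsc: "f (scale c v) = c * f v" if "v \<in> V" for c v using f that by (simp add: dual_def)
    have f0: "f 0 = 0" using fsc[of 0 0] vs.subspace_0[OF assms(2)] by simp
    show "f x = (\<Sum>b\<in>B. f b * co b x)"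
    proof (cases "x \<in> V")
      case True
      have "f (\<Sum>b\<in>Z. scale (u b) b) = (\<Sum>b\<in>Z. u b * f b)" if "finite Z" "Z \<subseteq> B" for Z u
        using that
      proof (induction Z rule: finite_induct)
        case (insert b Z)
        have "(\<Sum>b\<in>Z. scale (u b) b) \<in> V" "scale (u b) b \<in> V" "b \<in> V"
          using insert.prems B(1) assms(2) by (auto intro!: vs.subspace_sum vs.subspace_scale)
        thus ?case using insert by (simp add: fadd fsc)
      qed (simp add: f0)
      note lin = this[OF finB subset_refl, of "\<lambda>b. co b x"]
      have "(\<Sum>b\<in>B. scale (co b x) b) = x"
        unfolding co_def by (rule vs.sum_representation_eq[OF B(2) _ finB subset_refl]) (simp add: True spanB)
      from lin[unfolded this] show ?thesis by (simp add: mult.commute)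
    next
      case False
      thus ?thesis using f co_outside by (simp add: dual_def)
    qed
  qed
  define subst where "subst = poly_eval (\<lambda>f :: 'w \<Rightarrow> 'p mod_ring.
    \<Sum>b\<in>B. Poly_Mapping.single 0 (f b) * Poly_Mapping.single (Poly_Mapping.single (idx b) (1 :: nat)) (1 :: 'p mod_ring))"
  define lift where "lift = poly_eval (\<lambda>i. var (co (inv_into B idx i)))"
  have subst_var: "subst (var f) =
      (\<Sum>b\<in>B. Poly_Mapping.single 0 (f b) * Poly_Mapping.single (Poly_Mapping.single (idx b) 1) 1)" for f
    unfolding subst_def var_def by (rule poly_eval_var)
  have lift_subst_var: "lift (subst (var f)) = (\<Sum>b\<in>B. Poly_Mapping.single 0 (f b) * var (co b))" for f
    unfolding subst_var lift_def using idx
    by (simp add: poly_eval_sum poly_eval_mult poly_eval_var[unfolded One_nat_def])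
  have hom: "subst (q + r) = subst q + subst r" "subst (q - r) = subst q - subst r"
    "subst (q * r) = subst q * subst r" "subst (Poly_Mapping.single 0 c) = Poly_Mapping.single 0 c" for q r c
    unfolding subst_def by (simp_all add: poly_eval_add poly_eval_diff poly_eval_mult)
  have bhom: "lift (q + r) = lift q + lift r" "lift (q * r) = lift q * lift r"
    "lift (Poly_Mapping.single 0 c) = Poly_Mapping.single 0 c" for q r c
    unfolding lift_def by (simp_all add: poly_eval_add poly_eval_mult)
  have lift_subst: "q \<in> carrier ?D \<and> lift (subst q) \<in> carrier ?D \<and> q - lift (subst q) \<in> ?I"
    if "q \<in> carrier ?D" for q
  proof -
    have "\<forall>m\<in>Poly_Mapping.keys q. Poly_Mapping.keys m \<subseteq> dual scale V"
      using that by (simp add: dual_poly_algebra_simps)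
    thus ?thesis
    proof (induction q rule: polynomial_induct)
      case (const c)
      show ?case by (simp add: hom bhom dual_poly_const sym_ideal_zero)
    next
      case (var f)
      have "lift (subst (Defs.var f)) \<in> carrier ?D"
        unfolding lift_subst_var
        by (intro dual_poly_sum dual_poly_mult dual_poly_const dual_poly_var co)
      moreover have "Defs.var f - lift (subst (Defs.var f)) \<in> ?I"
        unfolding lift_subst_var using var_linear_combination[OF finB co, of f]
        by (subst coords[OF var])
      ultimately show ?case using dual_poly_var[OF var] unfolding var_def by blast
    next
      case (add q r)
      have "(q - lift (subst q)) + (r - lift (subst r)) \<in> ?I" using add by (intro sym_ideal_add) auto
      thus ?case using add by (simp add: hom bhom dual_poly_add algebra_simps)
    next
      case (mult q r)
      have "r * (q - lift (subst q)) + lift (subst q) * (r - lift (subst r)) \<in> ?I"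
        using mult by (intro sym_ideal_add sym_ideal_mult_left) auto
      thus ?case using mult by (simp add: hom bhom dual_poly_mult algebra_simps)
    qed
  qed
  have ker: "q \<in> ?I" if "q \<in> carrier ?D" "subst q = 0" for q
    using lift_subst[OF that(1)] that(2) by (simp add: lift_def)
  have subst_I: "subst q = 0" if "q \<in> ?I" for q
  proof -
    let ?K = "{q \<in> carrier ?D. subst q = 0}"
    have neg: "\<ominus>\<^bsub>?D\<^esub> q = - q" if "q \<in> carrier ?D" for q
      using that dual_poly_uminus[OF that]
      by (intro abelian_group.minus_equality[OF ring.is_abelian_group[OF ring_dual_poly]]) (simp_all add: dual_poly_algebra_simps(2-))
    have "ideal ?K ?D"
    proof (rule idealI[OF ring_dual_poly])
      show "subgroup ?K (add_monoid ?D)"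
      proof (rule I.add.subgroupI)
        show "?K \<noteq> {}" using dual_poly_const[of 0 scale V] hom(4)[of 0] by auto
        show "\<ominus>\<^bsub>?D\<^esub> q \<in> ?K" if "q \<in> ?K" for q
          using that hom(2)[of 0 q] hom(4)[of 0] dual_poly_uminus[of q scale V] by (simp add: neg)
      qed (auto simp: dual_poly_algebra_simps(2-) hom dual_poly_add)
    qed (auto simp: dual_poly_algebra_simps(2-) hom dual_poly_mult)
    moreover have "sym_relations scale V \<subseteq> ?K"
    proof
      fix q assume q: "q \<in> sym_relations scale V"
      hence "q \<in> carrier ?D" using sym_relations_subset by blast
      moreover have "subst q = 0" using q unfolding sym_relations_def
        by (auto simp: hom subst_var single_add distrib_right sum.distrib sum_distrib_left mult_single
            simp flip: mult.assoc)
      ultimately show "q \<in> ?K" by simp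
    qed
    ultimately have "?I \<subseteq> ?K" unfolding sym_ideal_def by (rule I.genideal_minimal)
    thus ?thesis using that by blast
  qed
  define \<Theta> where "\<Theta> x = the_elem (subst ` x)" for x
  have \<Theta>: "\<Theta> (?I +>\<^bsub>?D\<^esub> q) = subst q" if "q \<in> carrier ?D" for q
  proof -
    have "subst ` (?I +>\<^bsub>?D\<^esub> q) = {subst q}"
    proof
      show "subst ` (?I +>\<^bsub>?D\<^esub> q) \<subseteq> {subst q}"
        by (auto simp: a_r_coset_def' dual_poly_algebra_simps(5) hom subst_I)
      show "{subst q} \<subseteq> subst ` (?I +>\<^bsub>?D\<^esub> q)" using I.a_rcos_self[OF that] by blast
    qed
    thus ?thesis by (simp add: \<Theta>_def)
  qed
  have add: "(?I +>\<^bsub>?D\<^esub> q) \<oplus>\<^bsub>graded_quot ?D ?I\<^esub> (?I +>\<^bsub>?D\<^esub> r) = ?I +>\<^bsub>?D\<^esub> (q + r)"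
    if "q \<in> carrier ?D" "r \<in> carrier ?D" for q r
    using I.a_rcos_sum[OF that] by (simp add: graded_quot_simps dual_poly_algebra_simps(5))
  have mult: "(?I +>\<^bsub>?D\<^esub> q) \<otimes>\<^bsub>graded_quot ?D ?I\<^esub> (?I +>\<^bsub>?D\<^esub> r) = ?I +>\<^bsub>?D\<^esub> (q * r)"
    if "q \<in> carrier ?D" "r \<in> carrier ?D" for q r
    using I.rcoset_mult_add[OF that] by (simp add: graded_quot_simps dual_poly_algebra_simps(2))
  have smult: "c \<odot>\<^bsub>graded_quot ?D ?I\<^esub> (?I +>\<^bsub>?D\<^esub> q) = ?I +>\<^bsub>?D\<^esub> (Poly_Mapping.single 0 c * q)"
    if "q \<in> carrier ?D" for q c
    using fp_algebra_graded_quot(2)[OF fp_algebra_dual_poly ideal_sym that, of c]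
    by (simp add: dual_poly_algebra_simps(6))
  show ?thesis
    unfolding sym_algebra_def
  proof (intro exI[of _ \<Theta>] conjI ballI allI impI)
    fix x y assume "x \<in> carrier (graded_quot ?D ?I)" "y \<in> carrier (graded_quot ?D ?I)"
    then obtain q r where qr: "q \<in> carrier ?D" "x = ?I +>\<^bsub>?D\<^esub> q" "r \<in> carrier ?D" "y = ?I +>\<^bsub>?D\<^esub> r"
      by (elim in_graded_quotE)
    show "\<Theta> (x \<oplus>\<^bsub>graded_quot ?D ?I\<^esub> y) = \<Theta> x + \<Theta> y"
      using qr by (simp add: add \<Theta> dual_poly_add hom)
    show "\<Theta> (x \<otimes>\<^bsub>graded_quot ?D ?I\<^esub> y) = \<Theta> x * \<Theta> y"
      using qr by (simp add: mult \<Theta> dual_poly_mult hom)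
  next
    fix x c assume "x \<in> carrier (graded_quot ?D ?I)"
    then obtain q where q: "q \<in> carrier ?D" "x = ?I +>\<^bsub>?D\<^esub> q" by (elim in_graded_quotE)
    show "\<Theta> (c \<odot>\<^bsub>graded_quot ?D ?I\<^esub> x) = Poly_Mapping.single 0 c * \<Theta> x"
      using q by (simp add: smult \<Theta> dual_poly_mult dual_poly_const hom)
  next
    fix x assume x: "x \<in> carrier (graded_quot ?D ?I)" "\<Theta> x = 0"
    from x(1) obtain q where q: "q \<in> carrier ?D" "x = ?I +>\<^bsub>?D\<^esub> q" by (elim in_graded_quotE)
    hence "q \<in> ?I" using x(2) \<Theta> by (intro ker) simp_all
    thus "x = \<zero>\<^bsub>graded_quot ?D ?I\<^esub>"
      using q by (simp add: graded_quot_simps I.coset_eq_zero_iff)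
  qed
qed

section \<open>Annihilators of elements of a free module\<close>

context connected_pair
begin

lemma tensor_augmentation_coset:
  assumes "t \<in> C"
  shows "tensor_augmentation A B (tensor_ideal +>\<^bsub>pair_algebra A B\<^esub> t) = proj t"
proof -
  let ?E = "\<lambda>t. finsum A (\<lambda>(a, b). (Poly_Mapping.lookup t (a, b) * augmentation B b) \<odot>\<^bsub>A\<^esub> a)
    (Poly_Mapping.keys t)"
  have E: "?E s = proj s" if "s \<in> C" for s
    unfolding proj_def lin_ext_def
    by (rule A.finsum_cong') (use that in \<open>auto simp: C_iff A.smult_assoc\<close>)
  have "?E ` (tensor_ideal +>\<^bsub>pair_algebra A B\<^esub> t) = {proj t}"
  proof
    show "?E ` (tensor_ideal +>\<^bsub>pair_algebra A B\<^esub> t) \<subseteq> {proj t}"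
    proof (rule image_subsetI)
      fix s assume "s \<in> tensor_ideal +>\<^bsub>pair_algebra A B\<^esub> t"
      then obtain h where h: "h \<in> tensor_ideal" "s = h + t"
        by (auto simp: a_r_coset_def' pair_algebra_simps)
      have "s \<in> C" using h ideal_in_C assms by (auto intro: C_add)
      moreover have "proj s = proj t"
        using h \<open>s \<in> C\<close> assms by (intro proj_tcong) (simp_all add: tcong_def)
      ultimately show "?E s \<in> {proj t}" by (simp add: E)
    qed
    have "t \<in> tensor_ideal +>\<^bsub>pair_algebra A B\<^esub> t" using T.a_rcos_self[OF assms] .
    thus "{proj t} \<subseteq> ?E ` (tensor_ideal +>\<^bsub>pair_algebra A B\<^esub> t)" using E[OF assms] by force
  qed
  thus ?thesis unfolding tensor_augmentation_def by simp
qed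

lemma ring_tensor: "ring (tensor A B)"
  unfolding tensor_def by (rule ring_graded_quot[OF T.ideal_axioms])

lemma tensor_mult_coset:
  "\<lbrakk>s \<in> C; t \<in> C\<rbrakk> \<Longrightarrow> (tensor_ideal +>\<^bsub>pair_algebra A B\<^esub> s) \<otimes>\<^bsub>tensor A B\<^esub>
    (tensor_ideal +>\<^bsub>pair_algebra A B\<^esub> t) = tensor_ideal +>\<^bsub>pair_algebra A B\<^esub> (s \<star> t)"
  by (simp add: tensor_def graded_quot_simps T.rcoset_mult_add)

lemma tensor_pow_coset:
  assumes "t \<in> C"
  shows "(tensor_ideal +>\<^bsub>pair_algebra A B\<^esub> t) [^]\<^bsub>tensor A B\<^esub> (n::nat) =
    tensor_ideal +>\<^bsub>pair_algebra A B\<^esub> (t [^]\<^bsub>pair_algebra A B\<^esub> n)"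
proof (induction n)
  case 0
  show ?case by (simp add: nat_pow_def tensor_def graded_quot_simps)
next
  case (Suc n)
  interpret T': ring "tensor A B" by (rule ring_tensor)
  show ?case using assms Suc by (simp add: tensor_mult_coset)
qed

lemma tensor_augmentation_nilpotent:
  assumes "bounded_graded B" "U \<in> carrier (tensor A B)" "tensor_augmentation A B U = \<zero>\<^bsub>A\<^esub>"
  obtains n :: nat where "U [^]\<^bsub>tensor A B\<^esub> n = \<zero>\<^bsub>tensor A B\<^esub>"
proof -
  obtain t where t: "t \<in> C" "U = tensor_ideal +>\<^bsub>pair_algebra A B\<^esub> t"
    using assms(2) unfolding tensor_def by (rule in_graded_quotE)
  have "proj t = \<zero>\<^bsub>A\<^esub>" using assms(3) t by (simp add: tensor_augmentation_coset)
  then obtain n :: nat where "t [^]\<^bsub>pair_algebra A B\<^esub> n \<in> tensor_ideal"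
    by (rule proj_zero_nilpotent[OF assms(1) t(1)])
  hence "U [^]\<^bsub>tensor A B\<^esub> n = tensor_ideal"
    using t by (simp add: tensor_pow_coset T.coset_eq_zero_iff T.a_subset[THEN subsetD])
  thus ?thesis using that by (simp add: tensor_def graded_quot_simps)
qed

end

lemma (in domain_connected_pair) tensor_augmentation_zero_divisor:
  assumes "bounded_graded B" "U \<in> carrier (tensor A B)" "W \<in> carrier (tensor A B)"
    and "U \<otimes>\<^bsub>tensor A B\<^esub> W = \<zero>\<^bsub>tensor A B\<^esub>" "W \<noteq> \<zero>\<^bsub>tensor A B\<^esub>"
  shows "tensor_augmentation A B U = \<zero>\<^bsub>A\<^esub>"
proof (rule ccontr)
  assume nz: "tensor_augmentation A B U \<noteq> \<zero>\<^bsub>A\<^esub>"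
  obtain t where t: "t \<in> C" "U = tensor_ideal +>\<^bsub>pair_algebra A B\<^esub> t"
    using assms(2) unfolding tensor_def by (rule in_graded_quotE)
  obtain w where w: "w \<in> C" "W = tensor_ideal +>\<^bsub>pair_algebra A B\<^esub> w"
    using assms(3) unfolding tensor_def by (rule in_graded_quotE)
  have zero: "\<zero>\<^bsub>tensor A B\<^esub> = tensor_ideal" by (simp add: tensor_def graded_quot_simps)
  have "tensor_ideal +>\<^bsub>pair_algebra A B\<^esub> (t \<star> w) = tensor_ideal"
    using assms(4) t w zero by (simp add: tensor_mult_coset)
  hence "t \<star> w \<in> tensor_ideal" using C_mult[OF t(1) w(1)] T.coset_eq_zero_iff by blast
  moreover have "proj t \<noteq> \<zero>\<^bsub>A\<^esub>" using nz t by (simp add: tensor_augmentation_coset)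
  ultimately have "w \<in> tensor_ideal" by (rule proj_nonzero_divisor[OF assms(1) t(1) w(1)])
  thus False using assms(5) w zero T.coset_eq_zero_iff by blast
qed

text \<open>
  Everything about \<open>P\<^sub>V \<otimes> N\<close> that concerns annihilators, stated without reference to an embedding of
  \<open>P\<^sub>V\<close> or to representatives.
\<close>

lemma sym_tensor_augmentation:
  fixes scale :: "'p::prime_card mod_ring \<Rightarrow> 'w::ab_group_add \<Rightarrow> 'w" and N :: "('p mod_ring, 'n) graded"
  defines "T \<equiv> \<lambda>V. tensor (sym_algebra scale V) N"
  assumes "finite_dimensional_vector_space scale Basis" "Modules.module.subspace scale V"
    and "graded_fp_algebra N" "bounded_graded N" "connected_graded N"
  shows ring_sym_tensor: "ring (T V)"
    and sym_tensor_nilpotent: "\<lbrakk>U \<in> carrier (T V);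
        tensor_augmentation (sym_algebra scale V) N U = \<zero>\<^bsub>sym_algebra scale V\<^esub>\<rbrakk> \<Longrightarrow>
      \<exists>n::nat. U [^]\<^bsub>T V\<^esub> n = \<zero>\<^bsub>T V\<^esub>"
    and sym_tensor_zero_divisor: "\<lbrakk>U \<in> carrier (T V); W \<in> carrier (T V); U \<otimes>\<^bsub>T V\<^esub> W = \<zero>\<^bsub>T V\<^esub>;
        W \<noteq> \<zero>\<^bsub>T V\<^esub>\<rbrakk> \<Longrightarrow>
      tensor_augmentation (sym_algebra scale V) N U = \<zero>\<^bsub>sym_algebra scale V\<^esub>"
proof -
  let ?A = "sym_algebra scale V"
  obtain \<Theta> :: "('p mod_ring, 'w) sym \<Rightarrow> (nat \<Rightarrow>\<^sub>0 nat) \<Rightarrow>\<^sub>0 'p mod_ring" where \<Theta>: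
    "(\<forall>x\<in>carrier ?A. \<forall>y\<in>carrier ?A. \<Theta> (x \<oplus>\<^bsub>?A\<^esub> y) = \<Theta> x + \<Theta> y \<and> \<Theta> (x \<otimes>\<^bsub>?A\<^esub> y) = \<Theta> x * \<Theta> y) \<and>
    (\<forall>x\<in>carrier ?A. (\<forall>c. \<Theta> (c \<odot>\<^bsub>?A\<^esub> x) = Poly_Mapping.single 0 c * \<Theta> x) \<and>
      (\<Theta> x = 0 \<longrightarrow> x = \<zero>\<^bsub>?A\<^esub>))"
    using sym_algebra_embedding[OF assms(2,3)] by (rule exE)
  interpret N: connected_fp_algebra N by (rule connected_fp_algebraI[OF assms(4,6)])
  interpret domain_connected_pair ?A N
    "\<lambda>c (q :: (nat \<Rightarrow>\<^sub>0 nat) \<Rightarrow>\<^sub>0 'p mod_ring). Poly_Mapping.single 0 c * q" \<Theta>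
  proof (intro domain_connected_pair.intro connected_pair.intro fp_algebra_pair.intro
      domain_connected_pair_axioms.intro fp_algebra_sym_algebra N.fp_algebra_axioms
      N.connected_fp_algebra_axioms)
    show "vector_space (\<lambda>c (q :: (nat \<Rightarrow>\<^sub>0 nat) \<Rightarrow>\<^sub>0 'p mod_ring). Poly_Mapping.single 0 c * q)"
      by unfold_locales (simp_all add: algebra_simps single_add single_0_mult)
  qed (use \<Theta> in \<open>simp_all add: algebra_simps\<close>)
  show "ring (T V)" unfolding T_def by (rule ring_tensor)
  show "\<exists>n::nat. U [^]\<^bsub>T V\<^esub> n = \<zero>\<^bsub>T V\<^esub>"
    if "U \<in> carrier (T V)" "tensor_augmentation ?A N U = \<zero>\<^bsub>?A\<^esub>"
    unfolding T_def by (rule tensor_augmentation_nilpotent[OF assms(5) that[unfolded T_def]]) (rule exI)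
  show "tensor_augmentation ?A N U = \<zero>\<^bsub>?A\<^esub>"
    if "U \<in> carrier (T V)" "W \<in> carrier (T V)" "U \<otimes>\<^bsub>T V\<^esub> W = \<zero>\<^bsub>T V\<^esub>" "W \<noteq> \<zero>\<^bsub>T V\<^esub>"
    by (rule tensor_augmentation_zero_divisor[OF assms(5) that[unfolded T_def]])
qed

locale completely_prime_ideal = ideal \<pp> R for \<pp> and R (structure) +
  assumes proper: "\<pp> \<noteq> carrier R"
    and prime: "\<lbrakk>a \<in> carrier R; b \<in> carrier R; a \<otimes> b \<in> \<pp>\<rbrakk> \<Longrightarrow> a \<in> \<pp> \<or> b \<in> \<pp>"
begin

lemma one_notin: "\<one> \<notin> \<pp>"
  using proper one_imp_carrier by blast

lemma pow_in: "\<lbrakk>r \<in> carrier R; r [^] (n::nat) \<in> \<pp>\<rbrakk> \<Longrightarrow> r \<in> \<pp>"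
proof (induction n)
  case 0
  thus ?case using one_notin by simp
next
  case (Suc n)
  thus ?case using prime[of "r [^] n" r] by auto
qed

lemma mult_in_iff: "\<lbrakk>r \<in> carrier R; s \<in> carrier R; s \<notin> \<pp>\<rbrakk> \<Longrightarrow> r \<otimes> s \<in> \<pp> \<longleftrightarrow> r \<in> \<pp>"
  using prime I_r_closed by blast

text \<open>
  For \<open>s \<notin> \<pp>\<close>, the product \<open>r s\<close> lies in \<open>\<pp>\<close> only if \<open>r\<close> does.  Choose such an \<open>s\<close> that lies in as many
  of the \<open>J i\<close> as possible, and \<open>i\<close> with \<open>s \<notin> J i\<close>.  If \<open>r s \<in> J i\<close>, then \<open>r s\<close> lies in more of them
  than \<open>s\<close>, so \<open>r s \<in> \<pp>\<close> and \<open>r \<in> \<pp>\<close>.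
\<close>

lemma finite_intersection:
  assumes "finite I" "\<And>i r s. \<lbrakk>i \<in> I; r \<in> carrier R; s \<in> J i\<rbrakk> \<Longrightarrow> r \<otimes> s \<in> J i"
    and "\<pp> = {r \<in> carrier R. \<forall>i\<in>I. r \<in> J i}"
  shows "\<exists>i\<in>I. \<exists>s\<in>carrier R. \<pp> = {r \<in> carrier R. r \<otimes> s \<in> J i}"
proof -
  let ?bad = "\<lambda>s. {i \<in> I. s \<notin> J i}"
  define P where "P s \<longleftrightarrow> s \<in> carrier R \<and> s \<notin> \<pp>" for s
  have "P \<one>" using one_notin by (simp add: P_def)
  then obtain s where s: "P s" and min: "\<And>s'. P s' \<Longrightarrow> card (?bad s) \<le> card (?bad s')"
    using ex_has_least_nat[of P \<one> "\<lambda>s. card (?bad s)"] by blast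
  have sR: "s \<in> carrier R" "s \<notin> \<pp>" using s by (auto simp: P_def)
  then obtain i where i: "i \<in> I" "s \<notin> J i" using assms(3) by blast
  have "r \<in> \<pp> \<longleftrightarrow> r \<otimes> s \<in> J i" if r: "r \<in> carrier R" for r
  proof
    assume "r \<in> \<pp>"
    hence "r \<otimes> s \<in> \<pp>" using r sR mult_in_iff by blast
    thus "r \<otimes> s \<in> J i" using assms(3) i by blast
  next
    assume rs: "r \<otimes> s \<in> J i"
    have "?bad (r \<otimes> s) \<subseteq> ?bad s" using assms(2) r by blast
    hence "?bad (r \<otimes> s) \<subset> ?bad s" using rs i by blast
    hence "card (?bad (r \<otimes> s)) < card (?bad s)" using assms(1) by (intro psubset_card_mono) auto
    hence "\<not> P (r \<otimes> s)" using min by fastforce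
    hence "r \<otimes> s \<in> \<pp>" using r sR by (simp add: P_def)
    thus "r \<in> \<pp>" using r sR mult_in_iff by blast
  qed
  hence "\<pp> = {r \<in> carrier R. r \<otimes> s \<in> J i}" using a_subset by blast
  thus ?thesis using i(1) sR(1) by blast
qed

end

text \<open>
  An element of \<open>\<pp>\<close> becomes a zero divisor, hence the augmentation kills it.  Conversely, if the
  augmentation kills \<open>\<rho> r\<close>, then \<open>\<rho> r\<close> is nilpotent, so that a power of \<open>r\<close> annihilates \<open>W\<close>, and \<open>\<pp>\<close>
  contains \<open>r\<close> along with its power.
\<close>

lemma free_annihilator_toral:
  fixes scale :: "'p::prime_card mod_ring \<Rightarrow> 'w::ab_group_add \<Rightarrow> 'w" and N :: "('p mod_ring, 'n) graded"
    and R :: "('p mod_ring, 'r) graded" (structure)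
  assumes "finite_dimensional_vector_space scale Basis" "Modules.module.subspace scale V"
    and free: "free_algebra scale R \<eta> V N \<rho>"
    and "completely_prime_ideal \<pp> R"
    and W: "W \<in> carrier (tensor (sym_algebra scale V) N)"
    and ann: "\<pp> = {r \<in> carrier R. \<rho> r \<otimes>\<^bsub>tensor (sym_algebra scale V) N\<^esub> W = \<zero>\<^bsub>tensor (sym_algebra scale V) N\<^esub>}"
  shows "\<pp> = a_kernel R (sym_algebra scale V) (structure_map scale V N \<rho>)"
proof -
  interpret completely_prime_ideal \<pp> R by fact
  let ?T = "tensor (sym_algebra scale V) N"
  have N: "graded_fp_algebra N" "bounded_graded N" "connected_graded N" and "\<rho> \<in> Ring.ring_hom R ?T"
    using free by (auto simp: free_algebra_def graded_algebra_hom_def)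
  interpret T: ring ?T by (rule ring_sym_tensor[OF assms(1,2) N])
  interpret \<rho>: ring_hom_ring R ?T \<rho>
    by (rule ring_hom_ringI2) (unfold_locales, fact)
  have nz: "W \<noteq> \<zero>\<^bsub>?T\<^esub>"
  proof
    assume "W = \<zero>\<^bsub>?T\<^esub>"
    hence "\<pp> = carrier R" by (subst ann) auto
    with proper show False by (rule notE)
  qed
  have ann_iff: "r \<in> \<pp> \<longleftrightarrow> r \<in> carrier R \<and> \<rho> r \<otimes>\<^bsub>?T\<^esub> W = \<zero>\<^bsub>?T\<^esub>" for r
    by (subst ann) (rule mem_Collect_eq)
  have kernel_iff: "r \<in> a_kernel R (sym_algebra scale V) (structure_map scale V N \<rho>) \<longleftrightarrow> r \<in> carrier R \<and>
      tensor_augmentation (sym_algebra scale V) N (\<rho> r) = \<zero>\<^bsub>sym_algebra scale V\<^esub>" for r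
    unfolding a_kernel_def' structure_map_def by (rule mem_Collect_eq)
  show ?thesis
  proof (intro Set.set_eqI iffI)
    fix r assume "r \<in> \<pp>"
    hence r: "r \<in> carrier R" and rW: "\<rho> r \<otimes>\<^bsub>?T\<^esub> W = \<zero>\<^bsub>?T\<^esub>" unfolding ann_iff by blast+
    have "tensor_augmentation (sym_algebra scale V) N (\<rho> r) = \<zero>\<^bsub>sym_algebra scale V\<^esub>"
      by (rule sym_tensor_zero_divisor[OF assms(1,2) N \<rho>.hom_closed[OF r] W rW nz])
    with r show "r \<in> a_kernel R (sym_algebra scale V) (structure_map scale V N \<rho>)"
      unfolding kernel_iff by (rule conjI)
  next
    fix r assume "r \<in> a_kernel R (sym_algebra scale V) (structure_map scale V N \<rho>)"
    hence r: "r \<in> carrier R"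
      and e: "tensor_augmentation (sym_algebra scale V) N (\<rho> r) = \<zero>\<^bsub>sym_algebra scale V\<^esub>"
      unfolding kernel_iff by blast+
    obtain n :: nat where n: "\<rho> r [^]\<^bsub>?T\<^esub> n = \<zero>\<^bsub>?T\<^esub>"
      using sym_tensor_nilpotent[OF assms(1,2) N \<rho>.hom_closed[OF r] e] by (rule exE)
    have "\<rho> (r [^] n) = \<rho> r [^]\<^bsub>?T\<^esub> n" for n :: nat
      by (induction n) (simp_all add: r)
    hence "\<rho> (r [^] n) \<otimes>\<^bsub>?T\<^esub> W = \<zero>\<^bsub>?T\<^esub>" using n W by simp
    hence "r [^] n \<in> \<pp>" unfolding ann_iff using r by simp
    thus "r \<in> \<pp>" by (rule pow_in[OF r])
  qed
qed

section \<open>Descent along the filtration\<close>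

lemma graded_sub_simps:
  "carrier (graded_sub M S) = S" "\<zero>\<^bsub>graded_sub M S\<^esub> = \<zero>\<^bsub>M\<^esub>" "ring.add (graded_sub M S) = ring.add M"
  "module.smult (graded_sub M S) = module.smult M"
  by (simp_all add: graded_sub_def)

lemma graded_submodule_closed:
  assumes "graded_submodule R M S"
  shows "S \<subseteq> carrier M" "\<zero>\<^bsub>M\<^esub> \<in> S" "\<lbrakk>x \<in> S; y \<in> S\<rbrakk> \<Longrightarrow> x \<oplus>\<^bsub>M\<^esub> y \<in> S"
    "\<lbrakk>r \<in> carrier R; x \<in> S\<rbrakk> \<Longrightarrow> r \<odot>\<^bsub>M\<^esub> x \<in> S"
    and "x \<in> S \<Longrightarrow> \<exists>y\<in>S. y \<oplus>\<^bsub>M\<^esub> x = \<zero>\<^bsub>M\<^esub>"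
proof -
  interpret S: graded_module R "graded_sub M S" using assms by (simp add: graded_submodule_def)
  show "S \<subseteq> carrier M" using assms by (simp add: graded_submodule_def)
  show "\<zero>\<^bsub>M\<^esub> \<in> S" using S.zero_closed by (simp add: graded_sub_simps)
  show "\<lbrakk>x \<in> S; y \<in> S\<rbrakk> \<Longrightarrow> x \<oplus>\<^bsub>M\<^esub> y \<in> S" using S.a_closed[of x y] by (simp add: graded_sub_simps)
  show "\<lbrakk>r \<in> carrier R; x \<in> S\<rbrakk> \<Longrightarrow> r \<odot>\<^bsub>M\<^esub> x \<in> S" using S.act_closed[of r x] by (simp add: graded_sub_simps)
  show "x \<in> S \<Longrightarrow> \<exists>y\<in>S. y \<oplus>\<^bsub>M\<^esub> x = \<zero>\<^bsub>M\<^esub>" using S.add.l_inv_ex[of x] by (simp add: graded_sub_simps)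
qed

lemma abelian_subgroup_graded_sub:
  assumes "graded_submodule R L F" "graded_submodule R L S" "S \<subseteq> F"
  shows "abelian_subgroup S (graded_sub L F)"
proof -
  interpret M: graded_module R "graded_sub L F" using assms(1) by (simp add: graded_submodule_def)
  note S = graded_submodule_closed[OF assms(2)]
  have "additive_subgroup S (graded_sub L F)"
  proof (rule additive_subgroup.intro, rule M.add.subgroupI)
    fix x assume x: "x \<in> S"
    then obtain y where y: "y \<in> S" "y \<oplus>\<^bsub>L\<^esub> x = \<zero>\<^bsub>L\<^esub>" using S(5) by blast
    have "\<ominus>\<^bsub>graded_sub L F\<^esub> x = y"
      using x y assms(3) by (intro M.minus_equality) (auto simp: graded_sub_simps)
    thus "\<ominus>\<^bsub>graded_sub L F\<^esub> x \<in> S" using y(1) by simp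
  next
    show "S \<noteq> {}" using S(2) by blast
  qed (use S(3) assms(3) in \<open>simp_all add: graded_sub_simps\<close>)
  thus ?thesis by (rule abelian_subgroupI3) (rule M.abelian_group_axioms)
qed

lemma smult_filtration_quotient:
  assumes "graded_submodule R L F" "graded_submodule R L S" "S \<subseteq> F" "r \<in> carrier R" "y \<in> F"
  shows "r \<odot>\<^bsub>graded_quot (graded_sub L F) S\<^esub> (S +>\<^bsub>graded_sub L F\<^esub> y) = S +>\<^bsub>graded_sub L F\<^esub> (r \<odot>\<^bsub>L\<^esub> y)"
proof -
  let ?M = "graded_sub L F"
  interpret M: graded_module R ?M using assms(1) by (simp add: graded_submodule_def)
  interpret S: abelian_subgroup S ?M by (rule abelian_subgroup_graded_sub[OF assms(1-3)])
  have "S +>\<^bsub>?M\<^esub> (r \<odot>\<^bsub>?M\<^esub> (h \<oplus>\<^bsub>?M\<^esub> y)) = S +>\<^bsub>?M\<^esub> (r \<odot>\<^bsub>?M\<^esub> y)" if h: "h \<in> S" for h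
  proof -
    have c: "h \<in> carrier ?M" "y \<in> carrier ?M" using h assms(3,5) by (auto simp: graded_sub_simps)
    have "r \<odot>\<^bsub>?M\<^esub> (h \<oplus>\<^bsub>?M\<^esub> y) = r \<odot>\<^bsub>?M\<^esub> h \<oplus>\<^bsub>?M\<^esub> r \<odot>\<^bsub>?M\<^esub> y" by (rule M.act_add_right[OF assms(4) c])
    moreover have "r \<odot>\<^bsub>?M\<^esub> h \<in> S" using graded_submodule_closed(4)[OF assms(2,4) h] by (simp add: graded_sub_simps)
    moreover have "r \<odot>\<^bsub>?M\<^esub> h \<in> carrier ?M" "r \<odot>\<^bsub>?M\<^esub> y \<in> carrier ?M" using c assms(4) M.act_closed by auto
    ultimately show ?thesis by (simp add: S.coset_eq_iff M.a_assoc M.r_neg)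
  qed
  hence "r \<odot>\<^bsub>graded_quot ?M S\<^esub> (S +>\<^bsub>?M\<^esub> y) = S +>\<^bsub>?M\<^esub> (r \<odot>\<^bsub>?M\<^esub> y)"
    by (intro smult_graded_quot S.abelian_subgroup_axioms) (simp_all add: graded_sub_simps assms(5))
  thus ?thesis by (simp add: graded_sub_simps(4))
qed

text \<open>
  Among the nonzero multiples \<open>s x\<close>, all of which have the annihilator \<open>\<pp>\<close>, take one that lies as
  deep in the filtration as possible.  Then no nonzero multiple of it goes deeper.
\<close>

lemma annihilator_in_layer:
  assumes "completely_prime_ideal \<pp> R" "graded_module R L" "x \<in> carrier L"
    and ann: "\<pp> = {r \<in> carrier R. r \<odot>\<^bsub>L\<^esub> x = \<zero>\<^bsub>L\<^esub>}"
    and F: "F 0 = carrier L" "F (Suc i) = {\<zero>\<^bsub>L\<^esub>}" "\<And>j. j \<le> Suc i \<Longrightarrow> \<zero>\<^bsub>L\<^esub> \<in> F j"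
  shows "\<exists>j\<le>i. \<exists>y\<in>F j. \<pp> = {r \<in> carrier R. r \<odot>\<^bsub>L\<^esub> y \<in> F (Suc j)}"
proof -
  interpret completely_prime_ideal \<pp> R by fact
  interpret L: graded_module R L by fact
  define P where "P j \<longleftrightarrow> (\<exists>s\<in>carrier R. s \<notin> \<pp> \<and> s \<odot>\<^bsub>L\<^esub> x \<in> F j)" for j
  have "P 0" unfolding P_def F(1)
    using one_notin assms(3) L.act_closed by (intro bexI[of _ "\<one>\<^bsub>R\<^esub>"]) auto
  moreover have "\<not> P (Suc i)" unfolding P_def F(2) using ann by blast
  ultimately obtain j where j: "j \<le> i" "P j" "\<not> P (Suc j)"
  proof -
    have "\<exists>j\<le>i. P j \<and> \<not> P (Suc j)" if "P 0" "\<not> P (Suc i)"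
    proof (rule ccontr)
      assume no: "\<not> ?thesis"
      have "j \<le> Suc i \<longrightarrow> P j" for j
        by (induction j) (use that(1) no in auto)
      thus False using that(2) by blast
    qed
    thus ?thesis using that \<open>P 0\<close> \<open>\<not> P (Suc i)\<close> by blast
  qed
  then obtain s where s: "s \<in> carrier R" "s \<notin> \<pp>" "s \<odot>\<^bsub>L\<^esub> x \<in> F j" by (auto simp: P_def)
  have "r \<in> \<pp> \<longleftrightarrow> r \<odot>\<^bsub>L\<^esub> (s \<odot>\<^bsub>L\<^esub> x) \<in> F (Suc j)" if r: "r \<in> carrier R" for r
  proof -
    have assoc: "r \<odot>\<^bsub>L\<^esub> (s \<odot>\<^bsub>L\<^esub> x) = (r \<otimes>\<^bsub>R\<^esub> s) \<odot>\<^bsub>L\<^esub> x"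
      using r s(1) assms(3) by (simp add: L.act_assoc)
    have rs: "r \<otimes>\<^bsub>R\<^esub> s \<in> carrier R" using r s(1) by simp
    have "r \<otimes>\<^bsub>R\<^esub> s \<in> \<pp> \<longleftrightarrow> (r \<otimes>\<^bsub>R\<^esub> s) \<odot>\<^bsub>L\<^esub> x \<in> F (Suc j)"
    proof
      assume "r \<otimes>\<^bsub>R\<^esub> s \<in> \<pp>"
      hence "(r \<otimes>\<^bsub>R\<^esub> s) \<odot>\<^bsub>L\<^esub> x = \<zero>\<^bsub>L\<^esub>" using ann by blast
      thus "(r \<otimes>\<^bsub>R\<^esub> s) \<odot>\<^bsub>L\<^esub> x \<in> F (Suc j)" using F(3)[of "Suc j"] j(1) by simp
    next
      assume "(r \<otimes>\<^bsub>R\<^esub> s) \<odot>\<^bsub>L\<^esub> x \<in> F (Suc j)"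
      thus "r \<otimes>\<^bsub>R\<^esub> s \<in> \<pp>" using j(3) rs unfolding P_def by blast
    qed
    thus ?thesis unfolding assoc using mult_in_iff[OF r s(1,2)] by simp
  qed
  hence "\<pp> = {r \<in> carrier R. r \<odot>\<^bsub>L\<^esub> (s \<odot>\<^bsub>L\<^esub> x) \<in> F (Suc j)}" using a_subset by blast
  thus ?thesis using j(1) s(3) by blast
qed

text \<open>
  This makes the number of subspaces, and so the number of summands in each rank, finite.
\<close>

lemma finite_vector_space:
  fixes scale :: "'k::finite_field \<Rightarrow> 'w::ab_group_add \<Rightarrow> 'w"
  assumes "finite_dimensional_vector_space scale Basis"
  shows "finite (UNIV :: 'w set)"
proof -
  interpret finite_dimensional_vector_space scale Basis by fact
  have "v \<in> (\<lambda>u. \<Sum>b\<in>Basis. scale (u b) b) ` (Basis \<rightarrow>\<^sub>E UNIV)" for v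
  proof -
    have "v \<in> span Basis" using span_Basis by simp
    then obtain u where u: "v = (\<Sum>b\<in>Basis. scale (u b) b)"
      unfolding span_finite[OF finite_Basis] by blast
    have eq: "v = (\<Sum>b\<in>Basis. scale (restrict u Basis b) b)" unfolding u by (rule sum.cong) auto
    show ?thesis by (subst eq, rule imageI) auto
  qed
  hence "UNIV \<subseteq> (\<lambda>u. \<Sum>b\<in>Basis. scale (u b) b) ` (Basis \<rightarrow>\<^sub>E UNIV)" by blast
  thus ?thesis by (rule finite_subset) (intro finite_imageI finite_PiE finite_Basis finite)
qed

lemma free_module_simps:
  "carrier (free_module scale V d N \<rho>) = carrier (tensor (sym_algebra scale V) N)"
  "ring.add (free_module scale V d N \<rho>) = ring.add (tensor (sym_algebra scale V) N)"
  "r \<odot>\<^bsub>free_module scale V d N \<rho>\<^esub> x = \<rho> r \<otimes>\<^bsub>tensor (sym_algebra scale V) N\<^esub> x"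
  by (simp_all add: free_module_def suspension_def via_hom_def)

text \<open>
  The isomorphism \<open>h\<close> carries the coset of \<open>y\<close> to the family \<open>f\<close> of its components.  Being additive
  and injective, \<open>h\<close> detects zero, which in the direct sum means zero in every component.
\<close>

lemma annihilator_components:
  assumes M: "abelian_subgroup S M" "y \<in> carrier M"
    and smult: "\<And>r. r \<in> carrier R \<Longrightarrow> r \<odot>\<^bsub>M\<^esub> y \<in> carrier M"
      "\<And>r. r \<in> carrier R \<Longrightarrow> r \<odot>\<^bsub>graded_quot M S\<^esub> (S +>\<^bsub>M\<^esub> y) = S +>\<^bsub>M\<^esub> (r \<odot>\<^bsub>M\<^esub> y)"
    and h: "h \<in> graded_module_iso R (graded_quot M S) (graded_sum I K)"
    and K: "\<And>i. i \<in> I \<Longrightarrow> carrier (K i) = carrier (T i)" "\<And>i. i \<in> I \<Longrightarrow> ring.add (K i) = ring.add (T i)"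
    and T: "\<And>i. i \<in> I \<Longrightarrow> abelian_group (T i)"
  shows "\<exists>f. (\<forall>i\<in>I. f i \<in> carrier (T i)) \<and>
    (\<forall>r\<in>carrier R. r \<odot>\<^bsub>M\<^esub> y \<in> S \<longleftrightarrow> (\<forall>i\<in>I. r \<odot>\<^bsub>K i\<^esub> f i = \<zero>\<^bsub>T i\<^esub>))"
proof -
  interpret abelian_subgroup S M by fact
  let ?Q = "graded_quot M S"
  have bij: "bij_betw h (carrier ?Q) (\<Pi>\<^sub>E i\<in>I. carrier (K i))"
    and hadd: "\<And>u v. \<lbrakk>u \<in> carrier ?Q; v \<in> carrier ?Q\<rbrakk> \<Longrightarrow> h (u \<oplus>\<^bsub>?Q\<^esub> v) = (\<lambda>i\<in>I. h u i \<oplus>\<^bsub>K i\<^esub> h v i)"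
    and hsmult: "\<And>r u. \<lbrakk>r \<in> carrier R; u \<in> carrier ?Q\<rbrakk> \<Longrightarrow> h (r \<odot>\<^bsub>?Q\<^esub> u) = (\<lambda>i\<in>I. r \<odot>\<^bsub>K i\<^esub> h u i)"
    using h by (auto simp: graded_module_iso_def graded_sum_def)
  have coset: "S +>\<^bsub>M\<^esub> z \<in> carrier ?Q" if "z \<in> carrier M" for z
    using that by (simp add: graded_quot_simps a_rcosetsI a_subset)
  have hT: "h u i \<in> carrier (T i)" if "u \<in> carrier ?Q" "i \<in> I" for u i
    using bij_betwE[OF bij] that K(1) by (fastforce simp: PiE_iff)
  have SQ: "S = S +>\<^bsub>M\<^esub> \<zero>\<^bsub>M\<^esub>"
    using coset_eq_zero_iff[of "\<zero>\<^bsub>M\<^esub>"] additive_subgroup.zero_closed[OF additive_subgroup_axioms] a_Hcarr by blast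
  have Sc: "S \<in> carrier ?Q" by (subst SQ) (rule coset[OF abelian_monoid.zero_closed[OF abelian_monoid_axioms]])
  \<comment> \<open>The zero coset is idempotent under addition, hence so is each component of its image.\<close>
  have SS: "S \<oplus>\<^bsub>?Q\<^esub> S = S"
    using subgroup_add_id[OF a_subgroup] by (simp add: graded_quot_simps)
  have hS: "h S i = \<zero>\<^bsub>T i\<^esub>" if i: "i \<in> I" for i
  proof -
    interpret T: abelian_group "T i" by (rule T[OF i])
    have "h S i = h (S \<oplus>\<^bsub>?Q\<^esub> S) i" unfolding SS by (rule refl)
    also have "\<dots> = h S i \<oplus>\<^bsub>T i\<^esub> h S i" using hadd[OF Sc Sc] i K(2)[OF i] by simp
    finally show ?thesis using T.add.r_cancel_one'[OF hT[OF Sc i] hT[OF Sc i]] by simp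
  qed
  define f where "f = h (S +>\<^bsub>M\<^esub> y)"
  have ann: "r \<odot>\<^bsub>M\<^esub> y \<in> S \<longleftrightarrow> (\<forall>i\<in>I. r \<odot>\<^bsub>K i\<^esub> f i = \<zero>\<^bsub>T i\<^esub>)" if r: "r \<in> carrier R" for r
  proof -
    have "r \<odot>\<^bsub>M\<^esub> y \<in> S \<longleftrightarrow> S +>\<^bsub>M\<^esub> (r \<odot>\<^bsub>M\<^esub> y) = S"
      by (rule coset_eq_zero_iff[OF smult(1)[OF r], symmetric])
    also have "\<dots> \<longleftrightarrow> h (S +>\<^bsub>M\<^esub> (r \<odot>\<^bsub>M\<^esub> y)) = h S"
      by (rule inj_on_eq_iff[OF bij_betw_imp_inj_on[OF bij] coset[OF smult(1)[OF r]] Sc, symmetric])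
    also have "h (S +>\<^bsub>M\<^esub> (r \<odot>\<^bsub>M\<^esub> y)) = (\<lambda>i\<in>I. r \<odot>\<^bsub>K i\<^esub> f i)"
      unfolding smult(2)[OF r, symmetric] f_def by (rule hsmult[OF r coset[OF M(2)]])
    also have "(\<lambda>i\<in>I. r \<odot>\<^bsub>K i\<^esub> f i) = h S \<longleftrightarrow> (\<forall>i\<in>I. r \<odot>\<^bsub>K i\<^esub> f i = \<zero>\<^bsub>T i\<^esub>)"
    proof
      assume "(\<lambda>i\<in>I. r \<odot>\<^bsub>K i\<^esub> f i) = h S"
      thus "\<forall>i\<in>I. r \<odot>\<^bsub>K i\<^esub> f i = \<zero>\<^bsub>T i\<^esub>" using hS by (metis restrict_apply')
    next
      assume "\<forall>i\<in>I. r \<odot>\<^bsub>K i\<^esub> f i = \<zero>\<^bsub>T i\<^esub>"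
      moreover have "h S \<in> extensional I" using bij_betwE[OF bij] Sc by (auto simp: PiE_iff)
      ultimately show "(\<lambda>i\<in>I. r \<odot>\<^bsub>K i\<^esub> f i) = h S"
        using hS by (intro extensionalityI[of _ I]) auto
    qed
    finally show ?thesis .
  qed
  show ?thesis
  proof (intro exI[of _ f] conjI ballI)
    show "f i \<in> carrier (T i)" if "i \<in> I" for i
      unfolding f_def by (rule hT[OF coset[OF M(2)] that])
  qed (rule ann)
qed

theorem proposition2p7:
  fixes scale :: "'p::prime_card mod_ring \<Rightarrow> 'w::ab_group_add \<Rightarrow> 'w"
    and Basis :: "'w set"
    and R :: "('p mod_ring, 'r) graded"
    and \<eta> :: "('p mod_ring, 'w) sym \<Rightarrow> 'r"
    and L :: "('r, 'l) graded"
    and i :: nat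
    and F :: "nat \<Rightarrow> 'l set"
    and m :: "'w set \<Rightarrow> nat"
    and d :: "'w set \<Rightarrow> nat \<Rightarrow> int"
    and N :: "'w set \<Rightarrow> nat \<Rightarrow> ('p mod_ring, 'n) graded"
    and \<rho> :: "'w set \<Rightarrow> nat \<Rightarrow> 'r \<Rightarrow> ('p mod_ring, 'w, 'n) tens"
    and \<pp> :: "'r set"
  assumes "finite_dimensional_vector_space scale Basis"
    and "finite_sym_algebra scale R \<eta>"
    and "graded_module R L"
    and "free_rank_filtration scale R \<eta> L i F m d N \<rho>"
    and "associated_prime R L \<pp>"
  shows "\<exists>j\<le>i. \<exists>(V, k)\<in>summands scale m j.
    \<pp> = a_kernel R (sym_algebra scale V) (structure_map scale V (N V k) (\<rho> V k))"
proof -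
  interpret L: graded_module R L by fact
  have cprime: "completely_prime_ideal \<pp> R"
    using assms(5) unfolding associated_prime_def
    by (intro completely_prime_ideal.intro completely_prime_ideal_axioms.intro) blast+
  interpret completely_prime_ideal \<pp> R by (rule cprime)
  obtain x where x: "x \<in> carrier L" "\<pp> = {r \<in> carrier R. r \<odot>\<^bsub>L\<^esub> x = \<zero>\<^bsub>L\<^esub>}"
    using assms(5) unfolding associated_prime_def by blast
  have F: "F 0 = carrier L" "F (Suc i) = {\<zero>\<^bsub>L\<^esub>}" "\<And>j. j \<le> Suc i \<Longrightarrow> graded_submodule R L (F j)"
    "\<And>j. j \<le> i \<Longrightarrow> F (Suc j) \<subseteq> F j"
    and free: "\<And>j V k. \<lbrakk>j \<le> i; (V, k) \<in> summands scale m j\<rbrakk> \<Longrightarrow> free_algebra scale R \<eta> V (N V k) (\<rho> V k)"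
    and iso: "\<And>j. j \<le> i \<Longrightarrow> \<exists>h. h \<in> graded_module_iso R (graded_quot (graded_sub L (F j)) (F (Suc j)))
      (graded_sum (summands scale m j) (\<lambda>(V, k). free_module scale V (d V k) (N V k) (\<rho> V k)))"
    using assms(4) unfolding free_rank_filtration_def by blast+
  obtain j y where j: "j \<le> i" and y: "y \<in> F j" "\<pp> = {r \<in> carrier R. r \<odot>\<^bsub>L\<^esub> y \<in> F (Suc j)}"
    using annihilator_in_layer[OF cprime assms(3) x F(1,2) graded_submodule_closed(2)[OF F(3)]] by blast
  have Fj: "graded_submodule R L (F j)" "graded_submodule R L (F (Suc j))" "F (Suc j) \<subseteq> F j"
    by (rule F(3), use j in simp, rule F(3), use j in simp, rule F(4)[OF j])
  let ?I = "summands scale m j"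
  let ?P = "\<lambda>V k. tensor (sym_algebra scale V) (N V k)"
  let ?T = "\<lambda>(V, k). tensor (sym_algebra scale V) (N V k)"
  let ?K = "\<lambda>(V, k). free_module scale V (d V k) (N V k) (\<rho> V k)"
  have subspace: "Modules.module.subspace scale V" if "(V, k) \<in> ?I" for V k
    using that by (simp add: summands_def)
  have ringT: "ring (?T v)" if "v \<in> ?I" for v
  proof (cases v)
    case (Pair V k)
    hence Vk: "(V, k) \<in> ?I" using that by simp
    have "graded_fp_algebra (N V k)" "bounded_graded (N V k)" "connected_graded (N V k)"
      using free[OF j Vk] by (auto simp: free_algebra_def)
    from ring_sym_tensor[OF assms(1) subspace[OF Vk] this] show ?thesis by (simp add: Pair)
  qed
  obtain h where h: "h \<in> graded_module_iso R (graded_quot (graded_sub L (F j)) (F (Suc j))) (graded_sum ?I ?K)"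
    using iso[OF j] by blast
  have "\<exists>f. (\<forall>v\<in>?I. f v \<in> carrier (?T v)) \<and>
    (\<forall>r\<in>carrier R. r \<odot>\<^bsub>graded_sub L (F j)\<^esub> y \<in> F (Suc j) \<longleftrightarrow> (\<forall>v\<in>?I. r \<odot>\<^bsub>?K v\<^esub> f v = \<zero>\<^bsub>?T v\<^esub>))"
  proof (rule annihilator_components[OF abelian_subgroup_graded_sub[OF Fj] _ _ _ h])
    show "y \<in> carrier (graded_sub L (F j))" using y(1) by (simp add: graded_sub_simps)
    show "r \<odot>\<^bsub>graded_sub L (F j)\<^esub> y \<in> carrier (graded_sub L (F j))" if "r \<in> carrier R" for r
      using graded_submodule_closed(4)[OF Fj(1) that y(1)] by (simp add: graded_sub_simps)
    show "r \<odot>\<^bsub>graded_quot (graded_sub L (F j)) (F (Suc j))\<^esub> (F (Suc j) +>\<^bsub>graded_sub L (F j)\<^esub> y) =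
        F (Suc j) +>\<^bsub>graded_sub L (F j)\<^esub> (r \<odot>\<^bsub>graded_sub L (F j)\<^esub> y)" if "r \<in> carrier R" for r
      using smult_filtration_quotient[OF Fj that y(1)] by (simp add: graded_sub_simps(4))
    show "abelian_group (?T v)" if "v \<in> ?I" for v using ringT[OF that] by (rule ring.is_abelian_group)
  qed (auto simp: free_module_simps split: prod.splits)
  then obtain f where f: "\<And>v. v \<in> ?I \<Longrightarrow> f v \<in> carrier (?T v)"
    and ann: "\<And>r. r \<in> carrier R \<Longrightarrow> r \<odot>\<^bsub>L\<^esub> y \<in> F (Suc j) \<longleftrightarrow> (\<forall>v\<in>?I. r \<odot>\<^bsub>?K v\<^esub> f v = \<zero>\<^bsub>?T v\<^esub>)"
    unfolding graded_sub_simps(4) by blast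
  have hom: "ring_hom_ring R (?P V k) (\<rho> V k)" if "(V, k) \<in> ?I" for V k
    using free[OF j that] ringT[OF that] L.R.ring_axioms
    by (auto simp: free_algebra_def graded_algebra_hom_def intro: ring_hom_ringI2)
  have fP: "f (V, k) \<in> carrier (?P V k)" if "(V, k) \<in> ?I" for V k
    using f[OF that] by simp
  define J where "J v = {r \<in> carrier R. r \<odot>\<^bsub>?K v\<^esub> f v = \<zero>\<^bsub>?T v\<^esub>}" for v
  have "summands scale m j \<subseteq> (SIGMA V:UNIV. {..<m V})" by (auto simp: summands_def)
  hence fin: "finite ?I"
    by (rule finite_subset) (use finite_vector_space[OF assms(1)] in \<open>auto intro!: finite_SigmaI simp: Finite_Set.finite_set\<close>)
  have act: "(r \<otimes>\<^bsub>R\<^esub> s) \<odot>\<^bsub>?K (V, k)\<^esub> z = \<rho> V k r \<otimes>\<^bsub>?P V k\<^esub> (\<rho> V k s \<otimes>\<^bsub>?P V k\<^esub> z)"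
    if "(V, k) \<in> ?I" "r \<in> carrier R" "s \<in> carrier R" "z \<in> carrier (?P V k)" for V k r s z
  proof -
    interpret ring_hom_ring R "?P V k" "\<rho> V k" by (rule hom[OF that(1)])
    show ?thesis using that(2,3) S.m_assoc[OF hom_closed[OF that(2)] hom_closed[OF that(3)] that(4)]
      by (simp add: free_module_simps)
  qed
  have "\<exists>v\<in>?I. \<exists>s\<in>carrier R. \<pp> = {r \<in> carrier R. r \<otimes>\<^bsub>R\<^esub> s \<in> J v}"
  proof (rule finite_intersection[OF fin])
    show "\<pp> = {r \<in> carrier R. \<forall>v\<in>?I. r \<in> J v}" unfolding y(2) J_def using ann by blast
    show "r \<otimes>\<^bsub>R\<^esub> s \<in> J v" if "v \<in> ?I" "r \<in> carrier R" "s \<in> J v" for v r s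
    proof (cases v)
      case (Pair V k)
      have Vk: "(V, k) \<in> ?I" using that(1) Pair by simp
      interpret ring_hom_ring R "?P V k" "\<rho> V k" by (rule hom[OF Vk])
      have s: "s \<in> carrier R" "\<rho> V k s \<otimes>\<^bsub>?P V k\<^esub> f (V, k) = \<zero>\<^bsub>?P V k\<^esub>"
        using that(3) Pair by (simp_all add: J_def free_module_simps)
      show ?thesis
        using act[OF Vk that(2) s(1) fP[OF Vk]] s that(2) Pair
        by (simp add: J_def)
    qed
  qed
  then obtain v s where v: "v \<in> ?I" and s: "s \<in> carrier R"
    and pv: "\<pp> = {r \<in> carrier R. r \<otimes>\<^bsub>R\<^esub> s \<in> J v}" by blast
  obtain V k where Vk: "v = (V, k)" by (cases v)
  note ps = pv[unfolded Vk] and Vk = v[unfolded Vk]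
  interpret ring_hom_ring R "?P V k" "\<rho> V k" by (rule hom[OF Vk])
  let ?W = "\<rho> V k s \<otimes>\<^bsub>?P V k\<^esub> f (V, k)"
  have W: "?W \<in> carrier (?P V k)" using s fP[OF Vk] by (intro S.m_closed hom_closed)
  have "r \<otimes>\<^bsub>R\<^esub> s \<in> J (V, k) \<longleftrightarrow> \<rho> V k r \<otimes>\<^bsub>?P V k\<^esub> ?W = \<zero>\<^bsub>?P V k\<^esub>" if "r \<in> carrier R" for r
    unfolding J_def mem_Collect_eq act[OF Vk that s fP[OF Vk]] using that s by simp
  hence "\<pp> = {r \<in> carrier R. \<rho> V k r \<otimes>\<^bsub>?P V k\<^esub> ?W = \<zero>\<^bsub>?P V k\<^esub>}"
    by (subst ps) (rule Collect_cong, rule conj_cong[OF refl])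
  hence "\<pp> = a_kernel R (sym_algebra scale V) (structure_map scale V (N V k) (\<rho> V k))"
    by (rule free_annihilator_toral[OF assms(1) subspace[OF Vk] free[OF j Vk] cprime W])
  thus ?thesis using j Vk by blast
qed

end
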